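(* Let $M_1$ and $M_2$ be smooth generic manifolds in $\mathbb{C}^N$, and let $F:M_1\to M_2$ be a homeomorphism such that both $F$ and $F^{-1}$ are CR and satisfy a Lipschitz (Hölder) condition with some exponent $0<\alpha<1$. Let $F_1$ be the holomorphic extension of $F$ to a domain $D\subset\mathbb{C}^N$ described in the context. Let $f_1$ be a small stationary disc attached to $M_1$ such that $f_1(\Delta)\subset D$, and let $f_1^*$ be a supporting lift of $f_1$. Then the disc $f_2=F_1\circ f_1$ is also stationary, and $$f_2^*=f_1^*\,(F_1'\circ f_1)^{-1}$$ (where $f_1^*$ and $f_2^*$ are considered as row vectors and $F_1'$ is the complex Jacobian matrix of $F_1$) is a lift of $f_2$.
   Context: $\Delta=\{\zeta\in\mathbb{C}:|\zeta|<1\}$, with boundary circle $b\Delta$. A real submanifold $M\subset\mathbb{C}^N$ is generic if it is locally the zero set of real smooth functions $\rho_1,\dots,\rho_k$ with $\partial\rho_1,\dots,\partial\rho_k$ linearly independent over $\mathbb{C}$. Smooth means $C^\infty$. A continuous map on $M$ is CR if its components satisfy the tangential Cauchy-Riemann equations weakly. An analytic disc is a map $f:\bar\Delta\to\mathbb{C}^N$ that is continuous on $\bar\Delta$ and holomorphic in $\Delta$. It is attached to $M$ if $f(b\Delta)\subset M$. Elements of $T^*(\mathbb{C}^N)$ ((1,0)-forms $\sum a_jdz_j$) are identified with row vectors, and $\langle a,v\rangle=\sum a_jv_j$. A lift of a disc $f$ attached to $M$ is a map $f^*$ (row-vector valued), continuous on $\bar\Delta\setminus\{0\}$ and holomorphic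 in $\Delta\setminus\{0\}$ with a pole of order at most 1 at 0, such that for every $\zeta\in b\Delta$ the covector $f^*(\zeta)$ is conormal to $M$ at $f(\zeta)$, i.e. $\mathrm{Re}\langle f^*(\zeta),X\rangle=0$ for all $X\in T_{f(\zeta)}M$. A disc is stationary if it has a lift that is not identically zero. A (nonzero) lift $f^*$ is supporting if $\mathrm{Re}\langle f^*(\zeta),q-f(\zeta)\rangle\ge0$ for all $\zeta\in b\Delta$ and $q\in M$. "Small" disc: discs are of Hölder class $C^\beta(\bar\Delta)$ for a fixed $0<\beta<1$; the assertion is that, for each $p\in M_1$, there is $\varepsilon>0$ such that it holds for all $f_1$ with $\|f_1-p\|_{C^\beta(\bar\Delta)}<\varepsilon$. The extension $F_1$: fix $p\in M_1$. Choose neighborhoods $U_1\ni p$ and $U_2\ni F(p)$ such that $F$ and $F^{-1}$ are uniform limits of holomorphic polynomial maps on $M_1\cap U_1$ and $M_2\cap U_2$ respectively (Baouendi-Treves), and such that $F(M_1\cap U_1)\subset U_2$. Let $K_i$ be the union of $g(\bar\Delta)$ over all analytic discs $g$ with $g(b\Delta)\subset M_i\cap U_i$. By the maximum principle the polynomial maps converge uniformly on $K_1$ and $K_2$; the limits $F_1:K_1\to\mathbb{C}^N$ and $F_2:K_2\to\mathbb{C}^N$ are continuous extensions of $F$ and $F^{-1}$. One has $F_1(K_1)\subset K_2$ and $F_2\circ F_1=\mathrm{id}$ on $K_1$. $D$ is a domain contained in the interior of $K_1$; thus $F_1$ is holomorphic on $D$ and maps $D$ biholomorphically onto $F_1(D)$,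 with inverse $F_2$. The discs $f_1$ considered satisfy $f_1(b\Delta)\subset M_1\cap U_1$. *)

theory Defs
  imports "HOL-Complex_Analysis.Complex_Analysis"
begin

section \<open>Smooth maps, Hoelder classes\<close>

fun Ck_on :: "nat \<Rightarrow> 'a::real_normed_vector set \<Rightarrow> ('a \<Rightarrow> 'b::real_normed_vector) \<Rightarrow> bool" where
  "Ck_on 0 U f \<longleftrightarrow> continuous_on U f"
| "Ck_on (Suc k) U f \<longleftrightarrow> (\<forall>x\<in>U. f differentiable (at x)) \<and>
     (\<forall>v. Ck_on k U (\<lambda>x. frechet_derivative f (at x) v))"

text \<open>Only meant for open \<open>U\<close>.\<close>

definition smooth_on :: "'a::real_normed_vector set \<Rightarrow> ('a \<Rightarrow> 'b::real_normed_vector) \<Rightarrow> bool" where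
  "smooth_on U f \<longleftrightarrow> (\<forall>k. Ck_on k U f)"

definition holder_on :: "real \<Rightarrow> 'a::metric_space set \<Rightarrow> ('a \<Rightarrow> 'b::metric_space) \<Rightarrow> bool" where
  "holder_on \<alpha> S f \<longleftrightarrow> (\<exists>C. \<forall>x\<in>S. \<forall>y\<in>S. dist (f x) (f y) \<le> C * dist x y powr \<alpha>)"

text \<open>The terms with \<open>x = y\<close> contribute \<open>0\<close>, since \<open>0 / 0 = 0\<close>.
  The suprema are meaningful for bounded \<open>f\<close> with \<open>holder_on \<beta> S f\<close>.\<close>

definition holder_norm :: "real \<Rightarrow> 'a::metric_space set \<Rightarrow> ('a \<Rightarrow> 'b::real_normed_vector) \<Rightarrow> real" where
  "holder_norm \<beta> S f =
     (SUP x\<in>S. norm (f x)) + (SUP (x, y)\<in>S \<times> S. norm (f x - f y) / dist x y powr \<beta>)"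


section \<open>Generic submanifolds of complex space\<close>

text \<open>The row vector of the derivatives
  \<open>\<partial>\<rho>/\<partial>z\<^sub>j = (\<partial>\<rho>/\<partial>x\<^sub>j - \<i> \<partial>\<rho>/\<partial>y\<^sub>j) / 2\<close> of a real function.\<close>

definition del :: "(complex ^ 'n \<Rightarrow> real) \<Rightarrow> complex ^ 'n \<Rightarrow> complex ^ 'n" where
  "del \<rho> z = (\<chi> j. (complex_of_real (frechet_derivative \<rho> (at z) (axis j 1))
                   - \<i> * complex_of_real (frechet_derivative \<rho> (at z) (axis j \<i>))) / 2)"

definition generic_manifold :: "(complex ^ 'n) set \<Rightarrow> bool" where
  "generic_manifold M \<longleftrightarrow> (\<exists>k::nat. \<forall>p\<in>M. \<exists>U \<rho>. open U \<and> p \<in> U \<and>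
     (\<forall>j<k. smooth_on U (\<rho> j)) \<and>
     M \<inter> U = {z \<in> U. \<forall>j<k. \<rho> j z = (0::real)} \<and>
     (\<forall>z\<in>M \<inter> U. \<forall>c::nat \<Rightarrow> complex.
        (\<Sum>j<k. c j *s del (\<rho> j) z) = 0 \<longrightarrow> (\<forall>j<k. c j = 0)))"

definition tangent_space :: "(complex ^ 'n) set \<Rightarrow> complex ^ 'n \<Rightarrow> (complex ^ 'n) set" where
  "tangent_space M p = {X. \<exists>\<gamma> e. 0 < e \<and> smooth_on {-e<..<e} \<gamma> \<and> \<gamma> ` {-e<..<e} \<subseteq> M \<and>
     \<gamma> (0::real) = p \<and> (\<gamma> has_vector_derivative X) (at 0)}"


section \<open>Weak solutions of the tangential Cauchy--Riemann equations\<close>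

text \<open>A submanifold of real dimension \<open>d\<close> is parametrized locally by open subsets of a coordinate
  subspace \<open>span B\<close>, where \<open>B\<close> consists of \<open>d\<close> vectors of the real standard basis of
  \<open>complex ^ 'n\<close>; this avoids a separate type of dimension \<open>d\<close>. The measure
  \<open>coord_lborel B\<close> is the \<open>d\<close>-dimensional Lebesgue measure on \<open>span B\<close>.\<close>

definition coord_lborel :: "'a::euclidean_space set \<Rightarrow> 'a measure" where
  "coord_lborel B = distr (Pi\<^sub>M B (\<lambda>_. lborel)) borel (\<lambda>x. \<Sum>b\<in>B. x b *\<^sub>R b)"

definition local_param ::
  "(complex ^ 'n) set \<Rightarrow> (complex ^ 'n) set \<Rightarrow> (complex ^ 'n) set \<Rightarrow> (complex ^ 'n \<Rightarrow> complex ^ 'n) \<Rightarrow> bool"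
where
  "local_param M B V \<psi> \<longleftrightarrow> B \<subseteq> Basis \<and> open V \<and> smooth_on V \<psi> \<and>
     (\<exists>U. open U \<and> \<psi> ` (V \<inter> span B) = M \<inter> U) \<and>
     (\<exists>\<phi>. homeomorphism (V \<inter> span B) (\<psi> ` (V \<inter> span B)) \<psi> \<phi>) \<and>
     (\<forall>t\<in>V \<inter> span B. inj_on (frechet_derivative \<psi> (at t)) (span B))"

definition test_function :: "'a::euclidean_space set \<Rightarrow> ('a \<Rightarrow> complex) \<Rightarrow> bool" where
  "test_function V \<phi> \<longleftrightarrow> smooth_on UNIV \<phi> \<and>
     compact (closure {x. \<phi> x \<noteq> 0}) \<and> closure {x. \<phi> x \<noteq> 0} \<subseteq> V"

text \<open>In a local parametrization \<open>\<psi>\<close>, a complex tangent vector field \<open>L = \<Sum>b\<in>B. c\<^sub>b \<partial>\<^sub>b\<close> of \<open>M\<close> is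
  of type \<open>(0,1)\<close> iff it annihilates the coordinate functions, i.e.
  \<open>\<Sum>b\<in>B. c\<^sub>b \<partial>\<^sub>b \<psi> = 0\<close>. The equation \<open>L f = 0\<close> holds weakly if
  \<open>\<integral> (f \<circ> \<psi>) (\<Sum>b\<in>B. \<partial>\<^sub>b (c\<^sub>b \<phi>)) = 0\<close> for all test functions \<open>\<phi>\<close>.\<close>

definition weakly_CR :: "(complex ^ 'n) set \<Rightarrow> (complex ^ 'n \<Rightarrow> complex) \<Rightarrow> bool" where
  "weakly_CR M f \<longleftrightarrow> (\<forall>B V \<psi> c \<phi>.
     local_param M B V \<psi> \<longrightarrow>
     (\<forall>b\<in>B. smooth_on V (c b)) \<longrightarrow>
     (\<forall>t\<in>V \<inter> span B. (\<Sum>b\<in>B. c b t *s frechet_derivative \<psi> (at t) b) = 0) \<longrightarrow>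
     test_function V \<phi> \<longrightarrow>
     (LINT t|coord_lborel B. f (\<psi> t) *
        (\<Sum>b\<in>B. frechet_derivative (\<lambda>s. c b s * \<phi> s) (at t) b)) = 0)"

definition CR_map :: "(complex ^ 'n) set \<Rightarrow> (complex ^ 'n \<Rightarrow> complex ^ 'm) \<Rightarrow> bool" where
  "CR_map M F \<longleftrightarrow> continuous_on M F \<and> (\<forall>j. weakly_CR M (\<lambda>z. F z $ j))"


section \<open>Analytic discs and lifts\<close>

definition analytic_disc :: "(complex \<Rightarrow> complex ^ 'n) \<Rightarrow> bool" where
  "analytic_disc f \<longleftrightarrow> continuous_on (cball 0 1) f \<and>
     (\<forall>j. (\<lambda>\<zeta>. f \<zeta> $ j) holomorphic_on ball 0 1)"

definition attached_disc :: "(complex ^ 'n) set \<Rightarrow> (complex \<Rightarrow> complex ^ 'n) \<Rightarrow> bool" where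
  "attached_disc M f \<longleftrightarrow> analytic_disc f \<and> f ` sphere 0 1 \<subseteq> M"

definition pairing :: "complex ^ 'n \<Rightarrow> complex ^ 'n \<Rightarrow> complex" where
  "pairing a v = (\<Sum>j\<in>UNIV. a $ j * v $ j)"

definition is_lift ::
  "(complex ^ 'n) set \<Rightarrow> (complex \<Rightarrow> complex ^ 'n) \<Rightarrow> (complex \<Rightarrow> complex ^ 'n) \<Rightarrow> bool" where
  "is_lift M f g \<longleftrightarrow>
     continuous_on (cball 0 1 - {0}) g \<and>
     (\<forall>j. (\<lambda>\<zeta>. g \<zeta> $ j) holomorphic_on ball 0 1 - {0}) \<and>
     (\<forall>j. \<exists>h. h holomorphic_on ball 0 1 \<and> (\<forall>\<zeta>\<in>ball 0 1 - {0}. h \<zeta> = \<zeta> * g \<zeta> $ j)) \<and>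
     (\<forall>\<zeta>\<in>sphere 0 1. \<forall>X\<in>tangent_space M (f \<zeta>). Re (pairing (g \<zeta>) X) = 0)"

definition nonzero_lift ::
  "(complex ^ 'n) set \<Rightarrow> (complex \<Rightarrow> complex ^ 'n) \<Rightarrow> (complex \<Rightarrow> complex ^ 'n) \<Rightarrow> bool" where
  "nonzero_lift M f g \<longleftrightarrow> is_lift M f g \<and> (\<exists>\<zeta>\<in>cball 0 1 - {0}. g \<zeta> \<noteq> 0)"

definition stationary_disc :: "(complex ^ 'n) set \<Rightarrow> (complex \<Rightarrow> complex ^ 'n) \<Rightarrow> bool" where
  "stationary_disc M f \<longleftrightarrow> attached_disc M f \<and> (\<exists>g. nonzero_lift M f g)"

definition supporting_lift ::
  "(complex ^ 'n) set \<Rightarrow> (complex \<Rightarrow> complex ^ 'n) \<Rightarrow> (complex \<Rightarrow> complex ^ 'n) \<Rightarrow> bool" where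
  "supporting_lift M f g \<longleftrightarrow> nonzero_lift M f g \<and>
     (\<forall>\<zeta>\<in>sphere 0 1. \<forall>q\<in>M. 0 \<le> Re (pairing (g \<zeta>) (q - f \<zeta>)))"


section \<open>Holomorphic extension by polynomial approximation\<close>

definition holo_polynomial :: "(complex ^ 'n \<Rightarrow> complex) \<Rightarrow> bool" where
  "holo_polynomial P \<longleftrightarrow> (\<exists>(A :: ('n \<Rightarrow> nat) set) a. finite A \<and>
     (\<forall>z. P z = (\<Sum>m\<in>A. a m * (\<Prod>j\<in>UNIV. (z $ j) ^ m j))))"

definition holo_polynomial_map :: "(complex ^ 'n \<Rightarrow> complex ^ 'm) \<Rightarrow> bool" where
  "holo_polynomial_map P \<longleftrightarrow> (\<forall>i. holo_polynomial (\<lambda>z. P z $ i))"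

definition polynomial_limit :: "(complex ^ 'n) set \<Rightarrow> (complex ^ 'n \<Rightarrow> complex ^ 'm) \<Rightarrow> bool" where
  "polynomial_limit S F \<longleftrightarrow>
     (\<exists>P. (\<forall>n. holo_polynomial_map (P n)) \<and> uniform_limit S P F sequentially)"

definition disc_hull :: "(complex ^ 'n) set \<Rightarrow> (complex ^ 'n) set" where
  "disc_hull S = (\<Union>g\<in>{g. attached_disc S g}. g ` cball 0 1)"

text \<open>\<open>F\<^sub>1\<close> is the extension of \<open>F\<close> from \<open>S\<close> to \<open>disc_hull S\<close> obtained as the limit of
  polynomial maps converging to \<open>F\<close> uniformly on \<open>S\<close>. By the maximum principle it does not depend
  on the sequence; its values off \<open>disc_hull S\<close> are irrelevant.\<close>

definition disc_extension ::
  "(complex ^ 'n) set \<Rightarrow> (complex ^ 'n \<Rightarrow> complex ^ 'm) \<Rightarrow> (complex ^ 'n \<Rightarrow> complex ^ 'm) \<Rightarrow> bool"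
where
  "disc_extension S F F\<^sub>1 \<longleftrightarrow> (\<exists>P. (\<forall>n. holo_polynomial_map (P n)) \<and>
     uniform_limit S P F sequentially \<and> uniform_limit (disc_hull S) P F\<^sub>1 sequentially)"

text \<open>Entries \<open>\<partial>F\<^sub>i/\<partial>z\<^sub>j\<close>.\<close>

definition complex_jacobian :: "(complex ^ 'n \<Rightarrow> complex ^ 'm) \<Rightarrow> complex ^ 'n \<Rightarrow> complex ^ 'n ^ 'm" where
  "complex_jacobian F z = (\<chi> i j. deriv (\<lambda>w. F (z + axis j w) $ i) 0)"

end

theory Submission
  imports Defs
begin

text \<open>
  Put \<open>f\<^sub>2 = F\<^sub>1 \<circ> f\<^sub>1\<close> and \<open>f\<^sub>2\<^sup>* = f\<^sub>1\<^sup>* (F\<^sub>1' \<circ> f\<^sub>1)\<^sup>-\<^sup>1 = f\<^sub>1\<^sup>* (F\<^sub>2' \<circ> f\<^sub>2)\<close>, where \<open>F\<^sub>2\<close> extends \<open>F\<^sup>-\<^sup>1\<close>.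
  If \<open>g\<^sub>t = f\<^sub>2 + t \<phi> + o(t)\<close> is a family of discs attached to \<open>M\<^sub>2\<close>, then \<open>F\<^sub>2 \<circ> g\<^sub>t\<close> is attached to \<open>M\<^sub>1\<close>
  and the support property says that \<open>\<langle>f\<^sub>1\<^sup>*, F\<^sub>2 \<circ> g\<^sub>t - f\<^sub>1\<rangle>\<close> has nonnegative real part on the circle.
  By the maximum principle this persists inside the disc once the pole at 0 is compensated by an
  imaginary boundary term; dividing by \<open>t \<rightarrow> 0\<close> from both sides gives
  \<open>\<langle>f\<^sub>2\<^sup>*, \<phi>\<rangle> = c / \<zeta> + i b - cnj c \<zeta>\<close> with \<open>b\<close> real. Thus \<open>\<langle>f\<^sub>2\<^sup>*, \<phi>\<rangle>\<close> extends to the circle and is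
  imaginary there, although \<open>F\<^sub>1'\<close> itself need not extend.

  The Bishop equation, solved by contraction in Hoelder spaces, provides such families with \<open>\<phi>\<close>
  uniformly close to any prescribed constant vector tangent to \<open>M\<^sub>2\<close> at \<open>F p\<close>. These \<open>\<phi>\<close> span the
  space over the complex numbers and span the real tangent spaces of \<open>M\<^sub>2\<close> along the boundary of
  \<open>f\<^sub>2\<close>, so \<open>f\<^sub>2\<^sup>*\<close> extends continuously to the circle and is conormal to \<open>M\<^sub>2\<close>.
\<close>

section \<open>Hoelder bounds\<close>

text \<open>The obstacle is regularity. \<open>F\<close> is only Hoelder on
  \<open>M\<^sub>1\<close>, so on the circle \<open>f\<^sub>2\<close> is merely Hoelder with
  exponent \<gamma> = \<alpha>\<beta>, and no derivative of \<open>F\<^sub>1\<close> is available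
  there. Variations are therefore built in the Hoelder class of exponent \<gamma>, and
  \<open>F\<^sub>2\<close> is differentiated only at interior points; information from the circle
  enters through inequalities, which survive limits. These are one-sided, so equality requires
  variations in two opposite directions with the same first-order term. Contraction alone does not
  make solutions of the Bishop equation differentiable in the parameter: compactness gives limits of
  difference quotients along a subsequence, and uniqueness for the linearized equation identifies
  the limits for the two signs. Finally, the tangent spaces at the moving boundary points are
  compared with the one at \<open>q = F p\<close>; they are close when the disc is small, which is
  what fixes \<eta>, \<delta> and \<epsilon>.\<close>

definition holder_bound :: "real \<Rightarrow> 'a::metric_space set \<Rightarrow> real \<Rightarrow> ('a \<Rightarrow> 'b::real_normed_vector) \<Rightarrow> bool" where
  "holder_bound \<gamma> X K u \<longleftrightarrow> (\<forall>x\<in>X. norm (u x) \<le> K) \<and>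
     (\<forall>x\<in>X. \<forall>y\<in>X. norm (u x - u y) \<le> K * dist x y powr \<gamma>)"

lemma holder_boundI:
  assumes "\<And>x. x \<in> X \<Longrightarrow> norm (u x) \<le> K"
    and "\<And>x y. x \<in> X \<Longrightarrow> y \<in> X \<Longrightarrow> norm (u x - u y) \<le> K * dist x y powr \<gamma>"
  shows "holder_bound \<gamma> X K u"
  using assms by (auto simp: holder_bound_def)

lemma holder_bound_norm: "holder_bound \<gamma> X K u \<Longrightarrow> x \<in> X \<Longrightarrow> norm (u x) \<le> K"
  by (auto simp: holder_bound_def)

lemma holder_bound_diff:
  "holder_bound \<gamma> X K u \<Longrightarrow> x \<in> X \<Longrightarrow> y \<in> X \<Longrightarrow> norm (u x - u y) \<le> K * dist x y powr \<gamma>"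
  by (auto simp: holder_bound_def)

lemma holder_bound_cong:
  assumes "\<And>x. x \<in> X \<Longrightarrow> u x = v x"
  shows "holder_bound \<gamma> X K u \<longleftrightarrow> holder_bound \<gamma> X K v"
  using assms by (simp add: holder_bound_def)

lemma holder_bound_mono:
  assumes "holder_bound \<gamma> X K u" "K \<le> L"
  shows "holder_bound \<gamma> X L u"
  using assms unfolding holder_bound_def
  by (meson mult_right_mono order_trans powr_ge_zero)

lemma holder_bound_subset:
  "holder_bound \<gamma> X K u \<Longrightarrow> Y \<subseteq> X \<Longrightarrow> holder_bound \<gamma> Y K u"
  unfolding holder_bound_def by blast

lemma holder_bound_add:
  assumes "holder_bound \<gamma> X K u" "holder_bound \<gamma> X L v"
  shows "holder_bound \<gamma> X (K + L) (\<lambda>x. u x + v x)"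
proof (rule holder_boundI)
  fix x assume "x \<in> X"
  then show "norm (u x + v x) \<le> K + L"
    using assms by (meson add_mono holder_bound_norm norm_triangle_le)
next
  fix x y assume "x \<in> X" "y \<in> X"
  then have "norm (u x - u y) \<le> K * dist x y powr \<gamma>" "norm (v x - v y) \<le> L * dist x y powr \<gamma>"
    using assms by (auto simp: holder_bound_def)
  moreover have "norm (u x + v x - (u y + v y)) \<le> norm (u x - u y) + norm (v x - v y)"
    by (metis add_diff_add norm_triangle_ineq)
  ultimately show "norm (u x + v x - (u y + v y)) \<le> (K + L) * dist x y powr \<gamma>"
    by (simp add: algebra_simps)
qed

lemma holder_bound_minus:
  "holder_bound \<gamma> X K (\<lambda>x. - u x) \<longleftrightarrow> holder_bound \<gamma> X K u"
proof -
  have "norm (- u x - - u y) = norm (u x - u y)" for x y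
    by (metis minus_diff_minus norm_minus_cancel)
  then show ?thesis
    unfolding holder_bound_def by simp
qed

lemma holder_bound_sub:
  assumes "holder_bound \<gamma> X K u" "holder_bound \<gamma> X L v"
  shows "holder_bound \<gamma> X (K + L) (\<lambda>x. u x - v x)"
  using holder_bound_add[OF assms(1), of L "\<lambda>x. - v x"] assms(2)
  by (simp add: holder_bound_minus)

lemma holder_bound_swap:
  "holder_bound \<gamma> X K (\<lambda>x. u x - v x) \<longleftrightarrow> holder_bound \<gamma> X K (\<lambda>x. v x - u x)"
  using holder_bound_minus[of \<gamma> X K "\<lambda>x. u x - v x"] by simp

lemma holder_bound_linear:
  assumes "holder_bound \<gamma> X K u" "bounded_linear h" "\<And>x. norm (h x) \<le> c * norm x" "0 \<le> c"
  shows "holder_bound \<gamma> X (c * K) (\<lambda>x. h (u x))"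
proof (rule holder_boundI)
  fix x assume "x \<in> X"
  then show "norm (h (u x)) \<le> c * K"
    using assms by (meson holder_bound_norm mult_left_mono order_trans)
next
  interpret bounded_linear h by fact
  fix x y assume "x \<in> X" "y \<in> X"
  then have "norm (h (u x - u y)) \<le> c * (K * dist x y powr \<gamma>)"
    using assms by (meson holder_bound_diff mult_left_mono order_trans)
  then show "norm (h (u x) - h (u y)) \<le> c * K * dist x y powr \<gamma>"
    by (simp add: diff mult.assoc)
qed

lemma holder_bound_sum:
  assumes "finite I" "\<And>i. i \<in> I \<Longrightarrow> holder_bound \<gamma> X (K i) (u i)"
  shows "holder_bound \<gamma> X (\<Sum>i\<in>I. K i) (\<lambda>x. \<Sum>i\<in>I. u i x)"
  using assms
proof (induction I rule: finite_induct)
  case empty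
  then show ?case by (simp add: holder_bound_def)
next
  case (insert i I)
  then show ?case by (simp add: holder_bound_add)
qed

lemma holder_bound_const: "norm c \<le> K \<Longrightarrow> holder_bound \<gamma> X K (\<lambda>_. c)"
  using order_trans[OF norm_ge_zero, of c K] by (auto simp: holder_bound_def)

text \<open>This is the gain from a relation with an explicit constant instead of a norm: each
  inequality involves at most two points, so pointwise convergence preserves it, with the same
  constant.\<close>

lemma holder_bound_lim:
  assumes "\<And>n. holder_bound \<gamma> X K (u n)" "\<And>x. x \<in> X \<Longrightarrow> (\<lambda>n. u n x) \<longlonglongrightarrow> v x"
  shows "holder_bound \<gamma> X K v"
proof (rule holder_boundI)
  fix x assume x: "x \<in> X"
  show "norm (v x) \<le> K"
    by (rule Lim_norm_ubound[OF _ assms(2)[OF x]]) (use assms(1) x in \<open>auto simp: holder_bound_def\<close>)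
next
  fix x y assume xy: "x \<in> X" "y \<in> X"
  show "norm (v x - v y) \<le> K * dist x y powr \<gamma>"
    by (rule Lim_norm_ubound[OF _ tendsto_diff[OF assms(2)[OF xy(1)] assms(2)[OF xy(2)]]])
       (use assms(1) xy in \<open>auto simp: holder_bound_def\<close>)
qed

lemma holder_bound_uniformly_continuous:
  assumes "holder_bound \<gamma> X K u" "0 < \<gamma>"
  shows "uniformly_continuous_on X u"
  unfolding uniformly_continuous_on_def
proof (intro allI impI)
  fix e :: real assume e: "0 < e"
  define d where "d = (e / (\<bar>K\<bar> + 1)) powr (1 / \<gamma>)"
  have "0 < e / (\<bar>K\<bar> + 1)" using e by simp
  moreover from this have "d powr \<gamma> = e / (\<bar>K\<bar> + 1)"
    using assms e by (simp add: d_def powr_powr)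
  moreover have "0 < d" using calculation(1) unfolding d_def by (metis less_irrefl powr_gt_zero)
  ultimately have d: "0 < d" "d powr \<gamma> = e / (\<bar>K\<bar> + 1)" by auto
  have "dist (u y) (u x) < e" if "x \<in> X" "y \<in> X" "dist y x < d" for x y
  proof -
    have "norm (u y - u x) \<le> K * dist y x powr \<gamma>"
      using assms that by (auto simp: holder_bound_def)
    also have "\<dots> \<le> \<bar>K\<bar> * d powr \<gamma>"
      using that assms by (intro mult_mono powr_mono2) auto
    also have "\<dots> < e"
      using e by (simp add: d field_simps)
    finally show ?thesis by (simp add: dist_norm)
  qed
  then show "\<exists>d>0. \<forall>x\<in>X. \<forall>x'\<in>X. dist x' x < d \<longrightarrow> dist (u x') (u x) < e"
    using d by blast
qed

lemma holder_bound_continuous: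
  "holder_bound \<gamma> X K u \<Longrightarrow> 0 < \<gamma> \<Longrightarrow> continuous_on X u"
  by (simp add: holder_bound_uniformly_continuous uniformly_continuous_imp_continuous)

text \<open>Banach's fixed point theorem in a closed Hoelder ball. Contraction is stated for every
  bound \<open>K\<close> of the difference, since no norm of \<open>u - v\<close> is at hand. A
  first step of size \<delta>/2 keeps the iterates in the ball because \<delta>/2 + \<delta>/4 + ...
  = \<delta>.\<close>

lemma holder_bound_fixpoint:
  fixes \<Phi> :: "('a::metric_space \<Rightarrow> 'b::banach) \<Rightarrow> 'a \<Rightarrow> 'b"
  assumes contr: "\<And>u v K. holder_bound \<gamma> X \<delta> u \<Longrightarrow> holder_bound \<gamma> X \<delta> v \<Longrightarrow>
      holder_bound \<gamma> X K (\<lambda>x. u x - v x) \<Longrightarrow> holder_bound \<gamma> X (K / 2) (\<lambda>x. \<Phi> u x - \<Phi> v x)"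
    and start: "holder_bound \<gamma> X (\<delta> / 2) (\<Phi> (\<lambda>_. 0))" and "0 \<le> \<delta>"
  shows "\<exists>u. holder_bound \<gamma> X \<delta> u \<and> (\<forall>x\<in>X. \<Phi> u x = u x)"
proof -
  define u where "u n = (\<Phi> ^^ n) (\<lambda>_. 0)" for n
  have u0: "u 0 = (\<lambda>_. 0)" and uS: "u (Suc n) = \<Phi> (u n)" for n
    by (simp_all add: u_def)
  define c :: "nat \<Rightarrow> real" where "c n = \<delta> * (1 / 2) ^ n" for n
  have cS: "c (Suc n) = c n / 2" for n by (simp add: c_def)
  have c0: "0 \<le> c n" for n using \<open>0 \<le> \<delta>\<close> by (simp add: c_def)
  \<comment> \<open>The first n steps add up to \<delta>(1/2 + ... + 1/2^n) =
    \<open>\<delta> - c n\<close>. Step size and position have to be carried together, as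
    \<open>contr\<close> applies only inside the ball.\<close>
  have both: "holder_bound \<gamma> X (c (Suc n)) (\<lambda>x. u (Suc n) x - u n x) \<and>
        holder_bound \<gamma> X (\<delta> - c n) (u n)" for n
  proof (induction n)
    case 0
    then show ?case using start by (simp add: uS u0 c_def holder_bound_def)
  next
    case (Suc n)
    have 1: "holder_bound \<gamma> X (c (Suc n) + (\<delta> - c n)) (\<lambda>x. (u (Suc n) x - u n x) + u n x)"
      using Suc by (intro holder_bound_add) auto
    then have 2: "holder_bound \<gamma> X (\<delta> - c (Suc n)) (u (Suc n))"
      by (simp add: cS field_simps)
    have "holder_bound \<gamma> X \<delta> (u n)" "holder_bound \<gamma> X \<delta> (u (Suc n))"
      using Suc 2 c0[of n] c0[of "Suc n"] by (auto elim: holder_bound_mono)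
    then have "holder_bound \<gamma> X (c (Suc n) / 2) (\<lambda>x. \<Phi> (u (Suc n)) x - \<Phi> (u n) x)"
      using Suc by (intro contr) auto
    with 2 show ?case by (simp add: uS[symmetric] cS)
  qed
  have bd: "holder_bound \<gamma> X \<delta> (u n)" for n
    using both[of n] c0[of n] by (auto elim: holder_bound_mono)
  have diff: "holder_bound \<gamma> X (c n - c (n + m)) (\<lambda>x. u (n + m) x - u n x)" for n m
  proof (induction m)
    case 0
    then show ?case by (simp add: holder_bound_def)
  next
    case (Suc m)
    have "holder_bound \<gamma> X (c (Suc (n + m)) + (c n - c (n + m)))
       (\<lambda>x. (u (Suc (n + m)) x - u (n + m) x) + (u (n + m) x - u n x))"
      using both[of "n + m"] Suc by (intro holder_bound_add) auto
    then show ?case by (simp add: cS field_simps)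
  qed
  have diff': "holder_bound \<gamma> X (c n) (\<lambda>x. u (n + m) x - u n x)" for n m
    using diff[of n m] c0[of "n + m"] by (auto elim: holder_bound_mono)
  have clim: "c \<longlonglongrightarrow> 0"
    unfolding c_def by (intro tendsto_mult_right_zero LIMSEQ_power_zero) simp
  have "\<exists>l. (\<lambda>n. u n x) \<longlonglongrightarrow> l" if x: "x \<in> X" for x
  proof -
    have "Cauchy (\<lambda>n. u n x)"
    proof (rule CauchyI')
      fix e :: real assume "0 < e"
      then obtain N where N: "\<And>n. n \<ge> N \<Longrightarrow> norm (c n - 0) < e"
        using clim LIMSEQ_iff by metis
      have "norm (u n x - u (n + m) x) < e" if "n \<ge> N" for n m
        using N[OF that] c0[of n] holder_bound_norm[OF diff' x, of n m] by (simp add: norm_minus_commute)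
      then show "\<exists>M. \<forall>m\<ge>M. \<forall>n>m. dist (u m x) (u n x) < e"
        by (metis dist_norm le_add_diff_inverse less_imp_le_nat)
    qed
    then show ?thesis by (simp add: convergent_def Cauchy_convergent_iff)
  qed
  then obtain w where w: "\<And>x. x \<in> X \<Longrightarrow> (\<lambda>n. u n x) \<longlonglongrightarrow> w x"
    by metis
  have wb: "holder_bound \<gamma> X \<delta> w"
    by (rule holder_bound_lim[OF bd w])
  have wd: "holder_bound \<gamma> X (c n) (\<lambda>x. w x - u n x)" for n
  proof (rule holder_bound_lim[of _ _ _ "\<lambda>m x. u (n + m) x - u n x"])
    show "holder_bound \<gamma> X (c n) (\<lambda>x. u (n + m) x - u n x)" for m by (rule diff')
    show "(\<lambda>m. u (n + m) x - u n x) \<longlonglongrightarrow> w x - u n x" if "x \<in> X" for x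
      using LIMSEQ_ignore_initial_segment[OF w[OF that], of n]
      by (intro tendsto_diff) (auto simp: add.commute)
  qed
  \<comment> \<open>Both sides are within \<open>c n / 2\<close> of \<open>u (Suc n) x\<close>: the
    left one by contraction from \<open>u n\<close>, the right one by the rate of
    convergence.\<close>
  have "\<Phi> w x = w x" if x: "x \<in> X" for x
  proof -
    have "norm (\<Phi> w x - w x) \<le> c n" for n
    proof -
      have "norm (\<Phi> w x - u (Suc n) x) \<le> c n / 2"
        using holder_bound_norm[OF contr[OF wb bd wd] x, of n] by (simp add: uS)
      moreover have "norm (w x - u (Suc n) x) \<le> c n / 2"
        using holder_bound_norm[OF wd x, of "Suc n"] by (simp add: cS)
      ultimately show ?thesis
        by (metis dist_norm dist_triangle_half_r dist_commute dist_triangle_le[of _ "u (Suc n) x"] add_mono field_sum_of_halves)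
    qed
    then have "norm (\<Phi> w x - w x) \<le> 0"
      by (intro LIMSEQ_le_const[OF clim]) auto
    then show ?thesis by simp
  qed
  with wb show ?thesis by blast
qed

section \<open>The Schwarz integral\<close>

definition circle_mean :: "(complex \<Rightarrow> complex) \<Rightarrow> complex" where
  "circle_mean g = integral {0..1} (\<lambda>t. g (cis (2 * pi * t)))"

lemma circle_mean_integrable:
  fixes g :: "complex \<Rightarrow> complex"
  assumes "continuous_on (sphere 0 1) g"
  shows "(\<lambda>t. g (cis (2 * pi * t))) integrable_on {0..1}"
proof (rule integrable_continuous_real)
  show "continuous_on {0..1} (\<lambda>t. g (cis (2 * pi * t)))"
    by (rule continuous_on_compose2[OF assms]) (auto intro!: continuous_intros)
qed

text \<open>On the unit circle d\<tau>/\<tau> = 2\<pi>i dt. The contour form gives access to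
  Cauchy's theorems, while the real integral is the form in which norms and real parts can be
  compared.\<close>

lemma circle_mean_has_contour_integral:
  assumes "continuous_on (sphere 0 1) g"
  shows "((\<lambda>\<tau>. g \<tau> / \<tau>) has_contour_integral (2 * pi * \<i> * circle_mean g)) (circlepath 0 1)"
proof -
  have "((\<lambda>t. (2 * pi * \<i>) * g (cis (2 * pi * t))) has_integral (2 * pi * \<i>) * circle_mean g) {0..1}"
    unfolding circle_mean_def
    by (intro has_integral_mult_right integrable_integral circle_mean_integrable assms)
  then show ?thesis
    unfolding has_contour_integral
  proof (rule has_integral_eq[rotated])
    fix t :: real assume "t \<in> {0..1}"
    have e: "circlepath 0 1 t = cis (2 * pi * t)"
      by (simp add: circlepath cis_conv_exp mult_ac)
    have "vector_derivative (circlepath 0 1) (at t) = 2 * pi * \<i> * cis (2 * pi * t)"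
      unfolding vector_derivative_circlepath by (simp add: cis_conv_exp mult_ac)
    then show "(2 * pi * \<i>) * g (cis (2 * pi * t)) =
        g (circlepath 0 1 t) / circlepath 0 1 t * vector_derivative (circlepath 0 1) (at t)"
      unfolding e by simp
  qed
qed

lemma circle_mean_unique:
  assumes "continuous_on (sphere 0 1) g" "((\<lambda>\<tau>. g \<tau> / \<tau>) has_contour_integral (2 * pi * \<i> * c)) (circlepath 0 1)"
  shows "circle_mean g = c"
  using contour_integral_unique[OF circle_mean_has_contour_integral[OF assms(1)]]
    contour_integral_unique[OF assms(2)] by simp

lemma circle_mean_cong:
  assumes "\<And>\<tau>. \<tau> \<in> sphere 0 1 \<Longrightarrow> f \<tau> = g \<tau>"
  shows "circle_mean f = circle_mean g"
  unfolding circle_mean_def by (intro integral_cong assms) auto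

lemma circle_mean_add:
  assumes "continuous_on (sphere 0 1) f" "continuous_on (sphere 0 1) g"
  shows "circle_mean (\<lambda>\<tau>. f \<tau> + g \<tau>) = circle_mean f + circle_mean g"
  unfolding circle_mean_def by (intro integral_add circle_mean_integrable assms)

lemma circle_mean_diff:
  assumes "continuous_on (sphere 0 1) f" "continuous_on (sphere 0 1) g"
  shows "circle_mean (\<lambda>\<tau>. f \<tau> - g \<tau>) = circle_mean f - circle_mean g"
  unfolding circle_mean_def by (intro integral_diff circle_mean_integrable assms)

lemma circle_mean_mult: "circle_mean (\<lambda>\<tau>. c * f \<tau>) = c * circle_mean f"
  unfolding circle_mean_def by simp

lemma Re_circle_mean:
  assumes "continuous_on (sphere 0 1) f"
  shows "Re (circle_mean f) = Re (circle_mean (\<lambda>\<tau>. Re (f \<tau>)))"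
proof -
  have "integral {0..1} (\<lambda>t. Re (f (cis (2 * pi * t)))) = Re (circle_mean f)"
    unfolding circle_mean_def
    using integral_linear[OF circle_mean_integrable[OF assms] bounded_linear_Re] by (simp add: o_def)
  moreover have "circle_mean (\<lambda>\<tau>. Re (f \<tau>)) = of_real (integral {0..1} (\<lambda>t. Re (f (cis (2 * pi * t)))))"
  proof -
    have "(\<lambda>t. Re (f (cis (2 * pi * t)))) integrable_on {0..1}"
      using integrable_linear[OF circle_mean_integrable[OF assms] bounded_linear_Re] by (simp add: o_def)
    from integral_linear[OF this bounded_linear_of_real]
    show ?thesis unfolding circle_mean_def by (simp add: o_def)
  qed
  ultimately show ?thesis by simp
qed

text \<open>The majorant is the real part of a complex function so that its mean can afterwards be
  evaluated exactly by \<open>circle_mean_poisson\<close>.\<close>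

lemma norm_circle_mean_le:
  assumes "continuous_on (sphere 0 1) f" "continuous_on (sphere 0 1) g"
    and "\<And>\<tau>. \<tau> \<in> sphere 0 1 \<Longrightarrow> norm (f \<tau>) \<le> Re (g \<tau>)"
  shows "norm (circle_mean f) \<le> Re (circle_mean g)"
proof -
  have "norm (circle_mean f) \<le> integral {0..1} (\<lambda>t. Re (g (cis (2 * pi * t))))"
    unfolding circle_mean_def
    using integrable_linear[OF circle_mean_integrable[OF assms(2)] bounded_linear_Re]
    by (intro integral_norm_bound_integral circle_mean_integrable[OF assms(1)]) (auto simp: o_def assms(3))
  also have "\<dots> = Re (circle_mean g)"
    unfolding circle_mean_def
    using integral_linear[OF circle_mean_integrable[OF assms(2)] bounded_linear_Re] by (simp add: o_def)
  finally show ?thesis .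
qed

lemma circle_mean_cauchy:
  assumes "continuous_on (cball 0 1) H" "H holomorphic_on ball 0 1" "norm \<zeta> < 1"
  shows "circle_mean (\<lambda>\<tau>. H \<tau> * \<tau> / (\<tau> - \<zeta>)) = H \<zeta>"
proof (rule circle_mean_unique)
  have "continuous_on (sphere 0 1) H"
    using assms(1) by (rule continuous_on_subset) auto
  then show "continuous_on (sphere 0 1) (\<lambda>\<tau>. H \<tau> * \<tau> / (\<tau> - \<zeta>))"
    using assms(3) by (intro continuous_intros) auto
  have "((\<lambda>\<tau>. H \<tau> / (\<tau> - \<zeta>)) has_contour_integral 2 * pi * \<i> * H \<zeta>) (circlepath 0 1)"
    using Cauchy_integral_circlepath[of 0 1 H \<zeta>] assms by simp
  then show "((\<lambda>\<tau>. H \<tau> * \<tau> / (\<tau> - \<zeta>) / \<tau>) has_contour_integral 2 * pi * \<i> * H \<zeta>) (circlepath 0 1)"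
    by (rule has_contour_integral_eq) (auto simp: divide_simps)
qed

text \<open>The first form shows positivity and the link with 1/\<bar>\<tau> - \<zeta>\<bar>^2. The
  second, valid on the circle, is the Cauchy kernel plus a function of \<tau> that is holomorphic in
  the disc and vanishes at 0.\<close>

lemma poisson_kernel_eq:
  assumes "norm \<tau> = 1" "norm \<zeta> < 1"
  shows "Re ((\<tau> + \<zeta>) / (\<tau> - \<zeta>)) = (1 - (norm \<zeta>)\<^sup>2) / (norm (\<tau> - \<zeta>))\<^sup>2"
    and "of_real (Re ((\<tau> + \<zeta>) / (\<tau> - \<zeta>))) = \<tau> / (\<tau> - \<zeta>) + cnj \<zeta> * \<tau> / (1 - cnj \<zeta> * \<tau>)"
proof -
  have ne: "\<tau> \<noteq> \<zeta>" "\<tau> \<noteq> 0" "cnj \<tau> \<noteq> cnj \<zeta>" using assms by auto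
  have t: "\<tau> * cnj \<tau> = 1" using assms(1) by (simp add: complex_norm_square[symmetric])
  have "(\<tau> + \<zeta>) / (\<tau> - \<zeta>) = (\<tau> + \<zeta>) * cnj (\<tau> - \<zeta>) / of_real ((norm (\<tau> - \<zeta>))\<^sup>2)"
    using ne by (subst complex_norm_square) (simp add: divide_simps)
  then have "Re ((\<tau> + \<zeta>) / (\<tau> - \<zeta>)) = Re ((\<tau> + \<zeta>) * cnj (\<tau> - \<zeta>)) / (norm (\<tau> - \<zeta>))\<^sup>2"
    by simp
  also have "Re ((\<tau> + \<zeta>) * cnj (\<tau> - \<zeta>)) = (norm \<tau>)\<^sup>2 - (norm \<zeta>)\<^sup>2"
    unfolding cmod_power2 by (simp add: power2_eq_square algebra_simps)
  finally show "Re ((\<tau> + \<zeta>) / (\<tau> - \<zeta>)) = (1 - (norm \<zeta>)\<^sup>2) / (norm (\<tau> - \<zeta>))\<^sup>2"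
    using assms by simp
  have ne2: "1 - cnj \<zeta> * \<tau> \<noteq> 0"
  proof
    assume "1 - cnj \<zeta> * \<tau> = 0"
    then have "norm (cnj \<zeta> * \<tau>) = 1" by (metis eq_iff_diff_eq_0 norm_one)
    then show False using assms by (simp add: norm_mult)
  qed
  have e: "(1 - cnj \<zeta> * \<tau>) = \<tau> * cnj (\<tau> - \<zeta>)"
    using t by (simp add: algebra_simps)
  have 1: "of_real (Re ((\<tau> + \<zeta>) / (\<tau> - \<zeta>))) = ((\<tau> + \<zeta>) / (\<tau> - \<zeta>) + cnj ((\<tau> + \<zeta>) / (\<tau> - \<zeta>))) / 2"
    by (simp only: complex_add_cnj) simp
  have 2: "cnj ((\<tau> + \<zeta>) / (\<tau> - \<zeta>)) = 1 + 2 * cnj \<zeta> / cnj (\<tau> - \<zeta>)"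
    using ne by (simp add: field_simps)
  have 3: "2 * cnj \<zeta> / cnj (\<tau> - \<zeta>) = 2 * (cnj \<zeta> * \<tau> / (1 - cnj \<zeta> * \<tau>))"
    unfolding e using ne by simp
  have 4: "(\<tau> + \<zeta>) / (\<tau> - \<zeta>) = 2 * (\<tau> / (\<tau> - \<zeta>)) - 1"
    using ne by (simp add: field_simps)
  show "of_real (Re ((\<tau> + \<zeta>) / (\<tau> - \<zeta>))) = \<tau> / (\<tau> - \<zeta>) + cnj \<zeta> * \<tau> / (1 - cnj \<zeta> * \<tau>)"
    unfolding 1 unfolding 2 3 unfolding 4 by (simp add: mult.commute)
qed

text \<open>In the second form of the kernel the Cauchy part reproduces \<open>H \<zeta>\<close>;
  the remaining part times \<open>H\<close> is holomorphic and zero at 0, so its mean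
  vanishes.\<close>

lemma circle_mean_poisson:
  assumes H: "continuous_on (cball 0 1) H" "H holomorphic_on ball 0 1" and \<zeta>: "norm \<zeta> < 1"
  shows "circle_mean (\<lambda>\<tau>. H \<tau> * of_real (Re ((\<tau> + \<zeta>) / (\<tau> - \<zeta>)))) = H \<zeta>"
proof -
  have Hs: "continuous_on (sphere 0 1) H"
    using H(1) by (rule continuous_on_subset) auto
  have nz: "1 - cnj \<zeta> * \<tau> \<noteq> 0" if "norm \<tau> \<le> 1" for \<tau>
  proof
    assume "1 - cnj \<zeta> * \<tau> = 0"
    then have "norm (cnj \<zeta> * \<tau>) = 1" by (metis eq_iff_diff_eq_0 norm_one)
    moreover have "norm (cnj \<zeta> * \<tau>) < 1"
      using \<zeta> that mult_left_le[of "norm \<tau>" "norm \<zeta>"] by (simp add: norm_mult)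
    ultimately show False by simp
  qed
  define H' where "H' = (\<lambda>\<tau>. H \<tau> * (cnj \<zeta> * \<tau> / (1 - cnj \<zeta> * \<tau>)))"
  have H': "continuous_on (cball 0 1) H'" "H' holomorphic_on ball 0 1"
    unfolding H'_def using H nz by (auto intro!: continuous_intros holomorphic_intros)
  have H's: "continuous_on (sphere 0 1) H'"
    using H'(1) by (rule continuous_on_subset) auto
  have "circle_mean (\<lambda>\<tau>. H' \<tau> * \<tau> / (\<tau> - 0)) = H' 0"
    by (rule circle_mean_cauchy[OF H']) simp
  also have "circle_mean (\<lambda>\<tau>. H' \<tau> * \<tau> / (\<tau> - 0)) = circle_mean H'"
    by (rule circle_mean_cong) auto
  finally have 1: "circle_mean H' = 0" by (simp add: H'_def)
  have "circle_mean (\<lambda>\<tau>. H \<tau> * of_real (Re ((\<tau> + \<zeta>) / (\<tau> - \<zeta>)))) =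
      circle_mean (\<lambda>\<tau>. H \<tau> * \<tau> / (\<tau> - \<zeta>) + H' \<tau>)"
    by (rule circle_mean_cong, subst poisson_kernel_eq(2)) (use \<zeta> in \<open>auto simp: H'_def algebra_simps\<close>)
  also have "\<dots> = H \<zeta> + circle_mean H'"
    using \<zeta> by (subst circle_mean_add) (auto intro!: continuous_intros Hs H's simp: circle_mean_cauchy[OF H \<zeta>])
  finally show ?thesis using 1 by simp
qed

text \<open>Since (\<tau> + \<zeta>)/(\<tau> - \<zeta>) = 2\<tau>/(\<tau> - \<zeta>) - 1, the
  Schwarz integral is twice a Cauchy integral minus a constant, and a Cauchy integral of continuous
  data may be differentiated under the integral sign.\<close>

lemma schwarz_integral_derivative:
  assumes u: "continuous_on (sphere 0 1) u" and "norm \<zeta> < 1"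
  shows "((\<lambda>\<zeta>. circle_mean (\<lambda>\<tau>. u \<tau> * ((\<tau> + \<zeta>) / (\<tau> - \<zeta>)))) has_field_derivative
     circle_mean (\<lambda>\<tau>. u \<tau> * (2 * \<tau> / (\<tau> - \<zeta>)\<^sup>2))) (at \<zeta>)"
proof -
  \<comment> \<open>The unnormalized Cauchy integral of \<open>u\<close>: the factor \<tau> cancels
    the one in d\<tau>/\<tau>.\<close>
  define c where "c w = 2 * pi * \<i> * circle_mean (\<lambda>\<tau>. u \<tau> * \<tau> / (\<tau> - w))" for w
  have int: "((\<lambda>\<tau>. u \<tau> / (\<tau> - w) ^ 1) has_contour_integral c w) (circlepath 0 1)" if "w \<in> ball 0 1" for w
    unfolding c_def
  proof (rule has_contour_integral_eq[OF circle_mean_has_contour_integral])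
    show "continuous_on (sphere 0 1) (\<lambda>\<tau>. u \<tau> * \<tau> / (\<tau> - w))"
      using that by (intro continuous_intros u) auto
  qed auto
  have d: "(c has_field_derivative (1 * contour_integral (circlepath 0 1) (\<lambda>\<tau>. u \<tau> / (\<tau> - \<zeta>) ^ Suc 1))) (at \<zeta>)"
    using Cauchy_next_derivative_circlepath(2)[of 0 1 u 1 c \<zeta>] u int assms(2) by simp
  have "((\<lambda>\<tau>. u \<tau> / (\<tau> - \<zeta>) ^ Suc 1) has_contour_integral 2 * pi * \<i> * circle_mean (\<lambda>\<tau>. u \<tau> * \<tau> / (\<tau> - \<zeta>)\<^sup>2)) (circlepath 0 1)"
  proof (rule has_contour_integral_eq[OF circle_mean_has_contour_integral])
    show "continuous_on (sphere 0 1) (\<lambda>\<tau>. u \<tau> * \<tau> / (\<tau> - \<zeta>)\<^sup>2)"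
      using assms by (intro continuous_intros) auto
  qed (auto simp: power2_eq_square)
  with d have d': "(c has_field_derivative 2 * pi * \<i> * circle_mean (\<lambda>\<tau>. u \<tau> * \<tau> / (\<tau> - \<zeta>)\<^sup>2)) (at \<zeta>)"
    by (simp add: contour_integral_unique)
  have "((\<lambda>w. c w / (pi * \<i>) - circle_mean u) has_field_derivative
      2 * circle_mean (\<lambda>\<tau>. u \<tau> * \<tau> / (\<tau> - \<zeta>)\<^sup>2)) (at \<zeta>)"
  proof -
    have "2 * pi * \<i> * x / (pi * \<i>) - 0 = 2 * x" for x
      by simp
    then show ?thesis
      using DERIV_diff[OF DERIV_cdivide[OF d', of "pi * \<i>"] DERIV_const[of "circle_mean u"]] by (simp only:)
  qed
  also have "2 * circle_mean (\<lambda>\<tau>. u \<tau> * \<tau> / (\<tau> - \<zeta>)\<^sup>2) = circle_mean (\<lambda>\<tau>. u \<tau> * (2 * \<tau> / (\<tau> - \<zeta>)\<^sup>2))"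
    unfolding circle_mean_mult[symmetric] by (rule circle_mean_cong) simp
  finally show ?thesis
  proof (rule has_field_derivative_transform_within_open[of _ _ _ "ball 0 1"])
    fix w :: complex assume w: "w \<in> ball 0 1"
    have "c w / (pi * \<i>) - circle_mean u = circle_mean (\<lambda>\<tau>. 2 * (u \<tau> * \<tau> / (\<tau> - w))) - circle_mean u"
    proof -
      have "2 * pi * \<i> * x / (pi * \<i>) = 2 * x" for x
        by simp
      then show ?thesis unfolding c_def circle_mean_mult by (simp only:)
    qed
    also have "\<dots> = circle_mean (\<lambda>\<tau>. 2 * (u \<tau> * \<tau> / (\<tau> - w)) - u \<tau>)"
      using w by (subst circle_mean_diff) (auto intro!: continuous_intros u)
    also have "\<dots> = circle_mean (\<lambda>\<tau>. u \<tau> * ((\<tau> + w) / (\<tau> - w)))"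
    proof (rule circle_mean_cong)
      fix \<tau> :: complex assume "\<tau> \<in> sphere 0 1"
      then have "\<tau> - w \<noteq> 0" using w by auto
      then show "2 * (u \<tau> * \<tau> / (\<tau> - w)) - u \<tau> = u \<tau> * ((\<tau> + w) / (\<tau> - w))"
        by (simp add: divide_simps) (simp add: algebra_simps)
    qed
    finally show "c w / (pi * \<i>) - circle_mean u = circle_mean (\<lambda>\<tau>. u \<tau> * ((\<tau> + w) / (\<tau> - w)))" .
  qed (use assms in auto)
qed

text \<open>Integrate the derivative along a detour: pull both points towards 0 by the factor 1 -
  \<delta>, with \<delta> the distance of the points, and cross there. Each radial piece costs the
  integral of \<open>A * (1 - t) powr (\<gamma> - 1)\<close>, that is A \<delta>^\<gamma>/\<gamma>.
  The crossing has length at most \<delta> in a region where the derivative is at most A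
  \<delta>^(\<gamma> - 1). Together this is the factor 1 + 2/\<gamma>.\<close>

lemma hardy_littlewood:
  fixes s :: "complex \<Rightarrow> complex"
  assumes s: "s holomorphic_on ball 0 1" and "0 < \<gamma>" "\<gamma> < 1" "0 \<le> A"
    and bd: "\<And>z. norm z < 1 \<Longrightarrow> norm (deriv s z) \<le> A * (1 - norm z) powr (\<gamma> - 1)"
    and a: "norm a < 1" and b: "norm b < 1"
  shows "norm (s a - s b) \<le> A * (1 + 2 / \<gamma>) * dist a b powr \<gamma>"
proof -
  have der: "(s has_field_derivative deriv s z) (at z)" if "norm z < 1" for z
    using s that by (intro holomorphic_derivI[of _ "ball 0 1"]) auto
  have radial: "norm (s z - s (of_real (1 - \<delta>) * z)) \<le> A / \<gamma> * \<delta> powr \<gamma>"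
    if z: "norm z < 1" and \<delta>: "0 < \<delta>" "\<delta> \<le> 1" for z :: complex and \<delta> :: real
  proof -
    have less: "norm (t * z) < 1" if "t \<in> {0..1}" for t :: real
    proof -
      have "norm (t * z) = t * norm z" using that by (simp add: norm_mult)
      also have "\<dots> \<le> norm z" using that by (intro mult_left_le_one_le) auto
      finally show ?thesis using z by simp
    qed
    have "norm (s (of_real 1 * z) - s (of_real (1 - \<delta>) * z)) \<le>
        - (A / \<gamma>) * (1 - 1) powr \<gamma> - (- (A / \<gamma>) * (1 - (1 - \<delta>)) powr \<gamma>)"
    proof (rule differentiable_bound_general[of "1 - \<delta>" 1 _ _ "\<lambda>t. z * deriv s (of_real t * z)"
          "\<lambda>t. A * (1 - t) powr (\<gamma> - 1)"])
      show "1 - \<delta> < 1" using \<delta> by simp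
      have "continuous_on (ball 0 1) s"
        using s by (rule holomorphic_on_imp_continuous_on)
      then show "continuous_on {1 - \<delta>..1} (\<lambda>t. s (of_real t * z))"
        by (rule continuous_on_compose2) (use less \<delta> in \<open>auto intro!: continuous_intros\<close>)
      show "continuous_on {1 - \<delta>..1} (\<lambda>t. - (A / \<gamma>) * (1 - t) powr \<gamma>)"
        using \<open>0 < \<gamma>\<close> by (intro continuous_intros continuous_on_powr') auto
      fix t :: real assume t: "1 - \<delta> < t" "t < 1"
      have t1: "norm (t * z) < 1" using t \<delta> less[of t] by simp
      have "((\<lambda>t. of_real t * z) has_vector_derivative z) (at t)"
        by (auto intro!: derivative_eq_intros)
      from field_vector_diff_chain_at[OF this der[OF t1]]
      show "((\<lambda>t. s (of_real t * z)) has_vector_derivative z * deriv s (of_real t * z)) (at t)"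
        by (simp add: o_def)
      have "((\<lambda>t. - (A / \<gamma>) * (1 - t) powr \<gamma>) has_real_derivative
          - (A / \<gamma>) * (\<gamma> * (1 - t) powr (\<gamma> - 1) * (- 1))) (at t)"
        using t by (auto intro!: derivative_eq_intros)
      then show "((\<lambda>t. - (A / \<gamma>) * (1 - t) powr \<gamma>) has_vector_derivative A * (1 - t) powr (\<gamma> - 1)) (at t)"
        using \<open>0 < \<gamma>\<close> by (simp add: has_real_derivative_iff_has_vector_derivative)
      have n: "norm (of_real t * z) \<le> t"
        using t \<delta> z by (simp add: norm_mult mult_left_le)
      have "norm (z * deriv s (of_real t * z)) \<le> 1 * norm (deriv s (of_real t * z))"
        unfolding norm_mult using z by (intro mult_right_mono) auto
      also have "\<dots> \<le> A * (1 - norm (of_real t * z)) powr (\<gamma> - 1)"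
        using bd[OF t1] by simp
      also have "\<dots> \<le> A * (1 - t) powr (\<gamma> - 1)"
        using n t \<open>\<gamma> < 1\<close> \<open>0 \<le> A\<close> by (intro mult_left_mono powr_mono2') auto
      finally show "norm (z * deriv s (of_real t * z)) \<le> A * (1 - t) powr (\<gamma> - 1)" .
    qed
    then show ?thesis using \<open>0 < \<gamma>\<close> by simp
  qed
  show ?thesis
  proof (cases "a = b")
    case False
    \<comment> \<open>Truncation at 1 keeps the scaling factor nonnegative; for \<delta> = 1 both
      scaled points are 0 and the crossing costs nothing.\<close>
    define \<delta> where "\<delta> = min 1 (dist a b)"
    have \<delta>: "0 < \<delta>" "\<delta> \<le> 1" using False by (auto simp: \<delta>_def)
    define \<kappa> where "\<kappa> = 1 - \<delta>"
    have \<kappa>: "0 \<le> \<kappa>" "\<kappa> \<le> 1" using \<delta> by (auto simp: \<kappa>_def)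
    have scale: "norm (of_real \<kappa> * z) \<le> \<kappa>" if "norm z < 1" for z :: complex
      using \<kappa> that by (simp add: norm_mult mult_left_le)
    have p: "\<delta> powr \<gamma> \<le> dist a b powr \<gamma>"
      using \<delta> \<open>0 < \<gamma>\<close> by (intro powr_mono2) (auto simp: \<delta>_def)
    have mid: "norm (s (of_real \<kappa> * a) - s (of_real \<kappa> * b)) \<le> A * \<delta> powr \<gamma>"
    proof (cases "\<delta> = 1")
      case True
      then show ?thesis using \<open>0 \<le> A\<close> by (simp add: \<kappa>_def)
    next
      case False
      have "norm (s (of_real \<kappa> * a) - s (of_real \<kappa> * b)) \<le> (A * \<delta> powr (\<gamma> - 1)) * norm (of_real \<kappa> * a - of_real \<kappa> * b)"
      proof (rule field_differentiable_bound[of "cball 0 (1 - \<delta>)"])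
        fix z :: complex assume z: "z \<in> cball 0 (1 - \<delta>)"
        then have z1: "norm z < 1" using \<delta> by simp
        show "(s has_field_derivative deriv s z) (at z within cball 0 (1 - \<delta>))"
          by (rule DERIV_subset[OF der[OF z1]]) simp
        have "norm (deriv s z) \<le> A * (1 - norm z) powr (\<gamma> - 1)"
          by (rule bd[OF z1])
        also have "\<dots> \<le> A * \<delta> powr (\<gamma> - 1)"
          using \<open>0 \<le> A\<close> \<open>\<gamma> < 1\<close> z \<delta> by (intro mult_left_mono powr_mono2') auto
        finally show "norm (deriv s z) \<le> A * \<delta> powr (\<gamma> - 1)" .
      qed (use scale[OF a] scale[OF b] in \<open>auto simp: \<kappa>_def\<close>)
      also have "norm (of_real \<kappa> * a - of_real \<kappa> * b) = \<kappa> * dist a b"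
        unfolding right_diff_distrib[symmetric] norm_mult dist_norm using \<kappa> by simp
      also have "A * \<delta> powr (\<gamma> - 1) * (\<kappa> * dist a b) \<le> A * \<delta> powr (\<gamma> - 1) * (1 * dist a b)"
        using \<kappa> \<open>0 \<le> A\<close> by (intro mult_left_mono mult_right_mono) auto
      also have "1 * dist a b = \<delta>"
        using False by (auto simp: \<delta>_def min_def split: if_splits)
      also have "A * \<delta> powr (\<gamma> - 1) * \<delta> = A * \<delta> powr \<gamma>"
        using \<delta> by (simp add: powr_diff)
      finally show ?thesis .
    qed
    have "norm (s a - s b) \<le> norm (s a - s (of_real \<kappa> * a)) + norm (s (of_real \<kappa> * a) - s (of_real \<kappa> * b))
       + norm (s b - s (of_real \<kappa> * b))"
      using norm_triangle_ineq[of "s a - s (of_real \<kappa> * a)" "s (of_real \<kappa> * a) - s (of_real \<kappa> * b)"]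
        norm_triangle_ineq[of "s a - s (of_real \<kappa> * b)" "s (of_real \<kappa> * b) - s b"]
        norm_minus_commute[of "s b"] by simp
    also have "\<dots> \<le> A / \<gamma> * \<delta> powr \<gamma> + A * \<delta> powr \<gamma> + A / \<gamma> * \<delta> powr \<gamma>"
      using radial[OF a \<delta>] radial[OF b \<delta>] mid unfolding \<kappa>_def by (intro add_mono)
    also have "\<dots> = A * (1 + 2 / \<gamma>) * \<delta> powr \<gamma>"
      by (simp add: algebra_simps)
    also have "\<dots> \<le> A * (1 + 2 / \<gamma>) * dist a b powr \<gamma>"
      using p \<open>0 \<le> A\<close> \<open>0 < \<gamma>\<close> by (intro mult_left_mono) auto
    finally show ?thesis .
  qed simp
qed

section \<open>Comparison with real parts of powers, and the Hoelder estimate\<close>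

lemma cos_half_angle_pos:
  fixes \<gamma> :: real
  assumes "0 < \<gamma>" "\<gamma> < 1"
  shows "0 < cos (\<gamma> * pi / 2)"
proof -
  have "0 < \<gamma> * pi" "\<gamma> * pi < pi" using assms by simp_all
  then show ?thesis by (intro cos_gt_zero_pi) linarith+
qed

text \<open>In the closed right half plane the argument is at most \<pi>/2 in absolute value, so
  that of the power is at most \<gamma>\<pi>/2, which is less than \<pi>/2.\<close>

lemma Re_powr_lower_bound:
  fixes w :: complex and \<gamma> :: real
  assumes "0 \<le> Re w" "0 < \<gamma>" "\<gamma> < 1"
  shows "cos (\<gamma> * pi / 2) * norm w powr \<gamma> \<le> Re (w powr \<gamma>)"
proof (cases "w = 0")
  case False
  have "\<bar>Im (Ln w)\<bar> \<le> pi / 2"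
    using Re_Ln_pos_le[OF False] assms by simp
  then have *: "\<bar>\<gamma> * Im (Ln w)\<bar> \<le> \<gamma> * pi / 2"
    using assms by (simp add: abs_mult)
  have "cos (\<gamma> * pi / 2) \<le> cos \<bar>\<gamma> * Im (Ln w)\<bar>"
    using assms * mult_right_mono[of \<gamma> 1 pi] by (intro cos_monotone_0_pi_le) auto
  moreover have "Re (w powr \<gamma>) = norm w powr \<gamma> * cos (\<gamma> * Im (Ln w))"
    using False by (simp add: powr_def Re_exp)
  ultimately show ?thesis
    by (simp add: mult.commute mult_left_mono)
qed simp


lemma circle_mean_const: "circle_mean (\<lambda>_. c) = c"
  by (simp add: circle_mean_def)

text \<open>The Schwarz integral of the constant 1 is constant, and this mean is its derivative. It
  allows a constant to be subtracted from the data in the formula for the derivative.\<close>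

lemma circle_mean_double_pole:
  assumes "norm \<zeta> < 1"
  shows "circle_mean (\<lambda>\<tau>. 2 * \<tau> / (\<tau> - \<zeta>)\<^sup>2) = 0"
proof -
  have one: "circle_mean (\<lambda>\<tau>. 1 * ((\<tau> + w) / (\<tau> - w))) = 1" if w: "norm w < 1" for w
  proof -
    have "circle_mean (\<lambda>\<tau>. 1 * ((\<tau> + w) / (\<tau> - w))) = circle_mean (\<lambda>\<tau>. 2 * (1 * \<tau> / (\<tau> - w)) - 1)"
    proof (rule circle_mean_cong)
      fix \<tau> :: complex assume "\<tau> \<in> sphere 0 1"
      then have "\<tau> - w \<noteq> 0" using w by auto
      then show "1 * ((\<tau> + w) / (\<tau> - w)) = 2 * (1 * \<tau> / (\<tau> - w)) - 1"
        by (simp add: divide_simps)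
    qed
    also have "\<dots> = 2 * circle_mean (\<lambda>\<tau>. 1 * \<tau> / (\<tau> - w)) - circle_mean (\<lambda>_. 1)"
      unfolding circle_mean_mult[symmetric] using w by (intro circle_mean_diff) (auto intro!: continuous_intros)
    also have "circle_mean (\<lambda>\<tau>. 1 * \<tau> / (\<tau> - w)) = 1"
      using w by (intro circle_mean_cauchy) auto
    finally show ?thesis by (simp add: circle_mean_const)
  qed
  have "((\<lambda>w. circle_mean (\<lambda>\<tau>. 1 * ((\<tau> + w) / (\<tau> - w)))) has_field_derivative
     circle_mean (\<lambda>\<tau>. 1 * (2 * \<tau> / (\<tau> - \<zeta>)\<^sup>2))) (at \<zeta>)"
    by (rule schwarz_integral_derivative[OF _ assms]) auto
  then have "((\<lambda>w. 1) has_field_derivative circle_mean (\<lambda>\<tau>. 1 * (2 * \<tau> / (\<tau> - \<zeta>)\<^sup>2))) (at \<zeta>)"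
    by (rule has_field_derivative_transform_within_open[of _ _ _ "ball 0 1"]) (use assms one in auto)
  then show ?thesis
    by (simp add: DERIV_const DERIV_unique)
qed

text \<open>
  On the circle \<open>\<bar>\<tau> - \<omega>\<bar> powr \<gamma>\<close> is dominated by a multiple of the harmonic function
  \<open>Re ((1 - cnj \<omega> * \<tau>) powr \<gamma>)\<close>, whose Poisson integral is known; no estimate of singular integrals
  is needed.
\<close>

lemma schwarz_integral_holder:
  fixes u :: "complex \<Rightarrow> real"
  assumes "0 < \<gamma>" "\<gamma> < 1" and u: "holder_bound \<gamma> (sphere 0 1) K u"
  defines "c \<equiv> cos (\<gamma> * pi / 2)"
    and "S \<equiv> (\<lambda>\<zeta>. circle_mean (\<lambda>\<tau>. u \<tau> * ((\<tau> + \<zeta>) / (\<tau> - \<zeta>))))"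
  shows "norm \<zeta> < 1 \<Longrightarrow> norm (deriv S \<zeta>) \<le> 2 * K / c * (1 - norm \<zeta>) powr (\<gamma> - 1)"
    and "norm \<omega> = 1 \<Longrightarrow> 0 \<le> r \<Longrightarrow> r < 1 \<Longrightarrow> \<bar>Re (S (of_real r * \<omega>)) - u \<omega>\<bar> \<le> K / c * (1 - r) powr \<gamma>"
proof -
  have c: "0 < c"
    unfolding c_def using assms(1,2) by (rule cos_half_angle_pos)
  have K: "0 \<le> K"
    using holder_bound_norm[OF u, of 1] norm_ge_zero[of "u 1"] by simp
  have cu: "continuous_on (sphere 0 1) (\<lambda>\<tau>. complex_of_real (u \<tau>))"
    using holder_bound_continuous[OF u] \<open>0 < \<gamma>\<close> by (intro continuous_intros) auto
  \<comment> \<open>The base has nonnegative real part on the closed disc, so the principal power is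
    continuous there and holomorphic inside. At the radial point r\<omega> it equals (1 -
    r)^\<gamma>, which is how the distance to the boundary enters the estimates.\<close>
  define q where "q \<omega> \<tau> = (1 - cnj \<omega> * \<tau>) powr complex_of_real \<gamma>" for \<omega> \<tau> :: complex
  have Re_nonneg: "0 \<le> Re (1 - cnj \<omega> * \<tau>)" if "norm \<omega> = 1" "norm \<tau> \<le> 1" for \<omega> \<tau>
    using that complex_Re_le_cmod[of "cnj \<omega> * \<tau>"] by (simp add: norm_mult)
  have Re_pos: "0 < Re (1 - cnj \<omega> * \<tau>)" if "norm \<omega> = 1" "norm \<tau> < 1" for \<omega> \<tau>
    using that complex_Re_le_cmod[of "cnj \<omega> * \<tau>"] by (simp add: norm_mult)
  have q1: "continuous_on (cball 0 1) (q \<omega>)" if "norm \<omega> = 1" for \<omega>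
    unfolding q_def using Re_nonneg[OF that] \<open>0 < \<gamma>\<close>
    by (intro continuous_intros) auto
  have q2: "q \<omega> holomorphic_on ball 0 1" if "norm \<omega> = 1" for \<omega>
    unfolding q_def using Re_pos[OF that]
    by (intro holomorphic_intros) (force simp: complex_nonpos_Reals_iff)+
  have qs: "continuous_on (sphere 0 1) (q \<omega>)" if "norm \<omega> = 1" for \<omega>
    using q1[OF that] by (rule continuous_on_subset) auto
  have qr: "q \<omega> (of_real r * \<omega>) = of_real ((1 - r) powr \<gamma>)" if "norm \<omega> = 1" "0 \<le> r" "r < 1" for \<omega> r
  proof -
    have "1 - cnj \<omega> * (of_real r * \<omega>) = of_real (1 - r)"
      using that(1) complex_norm_square[of \<omega>] by (simp add: mult_ac)
    then show ?thesis
      unfolding q_def using that by (simp only: powr_of_real)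
  qed
  have cmp: "\<bar>u \<tau> - u \<omega>\<bar> \<le> K / c * Re (q \<omega> \<tau>)" if w: "norm \<omega> = 1" "norm \<tau> = 1" for \<omega> \<tau>
  proof -
    have "norm (1 - cnj \<omega> * \<tau>) = norm (\<omega> * (1 - cnj \<omega> * \<tau>))"
      using w by (simp add: norm_mult)
    also have "\<omega> * (1 - cnj \<omega> * \<tau>) = \<omega> - \<tau>"
      using w complex_norm_square[of \<omega>] by (simp add: right_diff_distrib mult.assoc[symmetric])
    finally have e: "norm (1 - cnj \<omega> * \<tau>) = dist \<tau> \<omega>" by (simp add: dist_norm norm_minus_commute)
    have "\<bar>u \<tau> - u \<omega>\<bar> \<le> K * dist \<tau> \<omega> powr \<gamma>"
      using holder_bound_diff[OF u, of \<tau> \<omega>] w by simp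
    also have "\<dots> = K / c * (c * norm (1 - cnj \<omega> * \<tau>) powr \<gamma>)"
      using c by (simp add: e)
    also have "\<dots> \<le> K / c * Re (q \<omega> \<tau>)"
      unfolding q_def c_def using K c assms Re_nonneg[OF w(1)] w
      by (intro mult_left_mono Re_powr_lower_bound) (auto simp: c_def)
    finally show ?thesis .
  qed
  have polar: "\<exists>r \<omega>. \<zeta> = of_real r * \<omega> \<and> norm \<omega> = 1 \<and> r = norm \<zeta>" for \<zeta> :: complex
    by (metis norm_cis rcis_cmod_Arg rcis_def)
  show "norm (deriv S \<zeta>) \<le> 2 * K / c * (1 - norm \<zeta>) powr (\<gamma> - 1)" if \<zeta>: "norm \<zeta> < 1" for \<zeta>
  proof -
    obtain r \<omega> where r: "\<zeta> = of_real r * \<omega>" and w: "norm \<omega> = 1" and rn: "r = norm \<zeta>"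
      using polar by blast
    have r01: "0 \<le> r" "r < 1" using rn \<zeta> by auto
    have ne: "\<tau> - \<zeta> \<noteq> 0" if "norm \<tau> = 1" for \<tau> using that \<zeta> by auto
    \<comment> \<open>Subtracting \<open>u \<omega>\<close>, where \<omega> is a unit vector in the
      direction of \<zeta>, leaves only the oscillation of the data around \<omega>, which
      \<open>cmp\<close> controls.\<close>
    have "deriv S \<zeta> = circle_mean (\<lambda>\<tau>. u \<tau> * (2 * \<tau> / (\<tau> - \<zeta>)\<^sup>2)) - u \<omega> * circle_mean (\<lambda>\<tau>. 2 * \<tau> / (\<tau> - \<zeta>)\<^sup>2)"
      using DERIV_imp_deriv[OF schwarz_integral_derivative[OF cu \<zeta>]]
      by (simp add: S_def circle_mean_double_pole[OF \<zeta>])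
    also have "\<dots> = circle_mean (\<lambda>\<tau>. (u \<tau> - u \<omega>) * (2 * \<tau> / (\<tau> - \<zeta>)\<^sup>2))"
      unfolding circle_mean_mult[symmetric] using ne
      by (subst circle_mean_diff[symmetric]) (auto intro!: continuous_intros cu simp: algebra_simps diff_divide_distrib)
    finally have d: "deriv S \<zeta> = circle_mean (\<lambda>\<tau>. (u \<tau> - u \<omega>) * (2 * \<tau> / (\<tau> - \<zeta>)\<^sup>2))" .
    \<comment> \<open>On the circle 2/\<bar>\<tau> - \<zeta>\<bar>^2 is the Poisson kernel times
      2/(1 - r^2); \<open>k\<close> is this factor times the constant K/c of
      \<open>cmp\<close>.\<close>
    define k where "k = 2 * K / c / (1 - r\<^sup>2)"
    have r2: "0 < 1 - r\<^sup>2" using r01 by (simp add: power_less_one_iff abs_square_less_1)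
    have "norm (deriv S \<zeta>) \<le> Re (circle_mean (\<lambda>\<tau>. of_real k * (q \<omega> \<tau> * of_real (Re ((\<tau> + \<zeta>) / (\<tau> - \<zeta>))))))"
      unfolding d
    proof (rule norm_circle_mean_le)
      show "continuous_on (sphere 0 1) (\<lambda>\<tau>. complex_of_real (u \<tau> - u \<omega>) * (2 * \<tau> / (\<tau> - \<zeta>)\<^sup>2))"
        using ne cu by (auto intro!: continuous_intros)
      show "continuous_on (sphere 0 1) (\<lambda>\<tau>. complex_of_real k * (q \<omega> \<tau> * complex_of_real (Re ((\<tau> + \<zeta>) / (\<tau> - \<zeta>)))))"
        using ne by (intro continuous_intros qs[OF w]) auto
      fix \<tau> :: complex assume "\<tau> \<in> sphere 0 1"
      then have t: "norm \<tau> = 1" by simp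
      have "norm (complex_of_real (u \<tau> - u \<omega>) * (2 * \<tau> / (\<tau> - \<zeta>)\<^sup>2)) = \<bar>u \<tau> - u \<omega>\<bar> * (2 / (norm (\<tau> - \<zeta>))\<^sup>2)"
        by (simp add: norm_mult norm_divide norm_power t del: of_real_diff)
      also have "\<dots> \<le> (K / c * Re (q \<omega> \<tau>)) * (2 / (norm (\<tau> - \<zeta>))\<^sup>2)"
        by (intro mult_right_mono cmp w t) auto
      also have "\<dots> = k * (Re (q \<omega> \<tau>) * Re ((\<tau> + \<zeta>) / (\<tau> - \<zeta>)))"
        unfolding poisson_kernel_eq(1)[OF t \<zeta>] k_def using r2 by (simp add: rn)
      finally show "norm (complex_of_real (u \<tau> - u \<omega>) * (2 * \<tau> / (\<tau> - \<zeta>)\<^sup>2)) \<le>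
          Re (complex_of_real k * (q \<omega> \<tau> * complex_of_real (Re ((\<tau> + \<zeta>) / (\<tau> - \<zeta>)))))"
        by simp
    qed
    also have "\<dots> = k * (1 - r) powr \<gamma>"
      unfolding circle_mean_mult circle_mean_poisson[OF q1[OF w] q2[OF w] \<zeta>]
      using qr[OF w r01] by (simp add: r)
    also have "\<dots> = 2 * K / c * ((1 - r) powr \<gamma> / (1 - r\<^sup>2))"
      by (simp add: k_def)
    also have "\<dots> \<le> 2 * K / c * ((1 - r) powr \<gamma> / (1 - r))"
      using K c r01 r2 power_decreasing[of 1 2 r] by (intro mult_left_mono divide_left_mono) auto
    also have "(1 - r) powr \<gamma> / (1 - r) = (1 - r) powr (\<gamma> - 1)"
      using r01 by (simp add: powr_diff)
    finally show ?thesis using rn by simp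
  qed
  show "\<bar>Re (S (of_real r * \<omega>)) - u \<omega>\<bar> \<le> K / c * (1 - r) powr \<gamma>" if w: "norm \<omega> = 1" and r01: "0 \<le> r" "r < 1" for r \<omega>
  proof -
    define \<zeta> where "\<zeta> = of_real r * \<omega>"
    have \<zeta>: "norm \<zeta> < 1" using w r01 by (simp add: \<zeta>_def norm_mult)
    have ne: "\<tau> - \<zeta> \<noteq> 0" if "norm \<tau> = 1" for \<tau> using that \<zeta> by auto
    define P where "P \<tau> = complex_of_real (Re ((\<tau> + \<zeta>) / (\<tau> - \<zeta>)))" for \<tau>
    have cP: "continuous_on (sphere 0 1) P"
      unfolding P_def using ne by (intro continuous_intros) auto
    have P1: "circle_mean P = 1"
      using circle_mean_poisson[of "\<lambda>_. 1", OF _ _ \<zeta>] by (simp add: P_def[abs_def])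
    have "Re (S \<zeta>) = Re (circle_mean (\<lambda>\<tau>. u \<tau> * P \<tau>))"
      unfolding S_def P_def using ne 
      by (subst Re_circle_mean) (auto intro!: continuous_intros cu simp del: times_divide_eq_right)
    then have "Re (S \<zeta>) - u \<omega> = Re (circle_mean (\<lambda>\<tau>. u \<tau> * P \<tau>) - u \<omega> * circle_mean P)"
      by (simp add: P1)
    also have "circle_mean (\<lambda>\<tau>. u \<tau> * P \<tau>) - u \<omega> * circle_mean P = circle_mean (\<lambda>\<tau>. (u \<tau> - u \<omega>) * P \<tau>)"
      unfolding circle_mean_mult[symmetric]
      by (subst circle_mean_diff[symmetric]) (auto intro!: continuous_intros cu cP simp: algebra_simps)
    finally have "\<bar>Re (S \<zeta>) - u \<omega>\<bar> \<le> norm (circle_mean (\<lambda>\<tau>. (u \<tau> - u \<omega>) * P \<tau>))"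
      using abs_Re_le_cmod by simp
    also have "\<dots> \<le> Re (circle_mean (\<lambda>\<tau>. of_real (K / c) * (q \<omega> \<tau> * P \<tau>)))"
    proof (rule norm_circle_mean_le)
      show "continuous_on (sphere 0 1) (\<lambda>\<tau>. complex_of_real (u \<tau> - u \<omega>) * P \<tau>)"
        using cu cP by (auto intro!: continuous_intros)
      show "continuous_on (sphere 0 1) (\<lambda>\<tau>. complex_of_real (K / c) * (q \<omega> \<tau> * P \<tau>))"
        by (intro continuous_intros qs[OF w] cP)
      fix \<tau> :: complex assume "\<tau> \<in> sphere 0 1"
      then have t: "norm \<tau> = 1" by simp
      have P0: "0 \<le> Re ((\<tau> + \<zeta>) / (\<tau> - \<zeta>))"
        unfolding poisson_kernel_eq(1)[OF t \<zeta>] using \<zeta> by (simp add: abs_square_le_1)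
      have "norm (complex_of_real (u \<tau> - u \<omega>) * P \<tau>) = \<bar>u \<tau> - u \<omega>\<bar> * Re ((\<tau> + \<zeta>) / (\<tau> - \<zeta>))"
        using P0 by (simp add: P_def norm_mult del: of_real_diff)
      also have "\<dots> \<le> (K / c * Re (q \<omega> \<tau>)) * Re ((\<tau> + \<zeta>) / (\<tau> - \<zeta>))"
        by (intro mult_right_mono cmp w t P0)
      finally show "norm (complex_of_real (u \<tau> - u \<omega>) * P \<tau>) \<le> Re (complex_of_real (K / c) * (q \<omega> \<tau> * P \<tau>))"
        by (simp add: P_def)
    qed
    also have "\<dots> = K / c * (1 - r) powr \<gamma>"
      unfolding circle_mean_mult P_def circle_mean_poisson[OF q1[OF w] q2[OF w] \<zeta>]
      using qr[OF w r01] by (simp add: \<zeta>_def)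
    finally show ?thesis by (simp add: \<zeta>_def)
  qed
qed


text \<open>Privalov's theorem: passing to the conjugate harmonic function is bounded on Hoelder
  classes, with \<open>C\<close> depending on \<gamma> only. The derivative bound of the Schwarz
  integral and \<open>hardy_littlewood\<close> give a uniform Hoelder bound in the open disc, hence
  a continuous extension; its real part is identified along radii.\<close>

lemma schwarz_holder:
  fixes \<gamma> :: real
  assumes \<gamma>: "0 < \<gamma>" "\<gamma> < 1"
  obtains C where "0 < C" "\<And>K u. holder_bound \<gamma> (sphere 0 1) K (u :: complex \<Rightarrow> real) \<Longrightarrow>
    \<exists>s. continuous_on (cball 0 1) s \<and> s holomorphic_on ball 0 1 \<and> (\<forall>\<tau>\<in>sphere 0 1. Re (s \<tau>) = u \<tau>) \<and>
      Im (s 0) = 0 \<and> holder_bound \<gamma> (cball 0 1) (C * K) s"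
proof -
  define c where "c = cos (\<gamma> * pi / 2)"
  have c: "0 < c"
    unfolding c_def using \<gamma> by (rule cos_half_angle_pos)
  \<comment> \<open>The 1 pays for the value at 0, a mean of \<open>u\<close>; the rest is the
    derivative constant 2/c times the factor of \<open>hardy_littlewood\<close>.\<close>
  define C where "C = 1 + 2 / c * (1 + 2 / \<gamma>)"
  have "0 < C" using c \<gamma> by (simp add: C_def add_pos_pos)
  moreover have "\<exists>s. continuous_on (cball 0 1) s \<and> s holomorphic_on ball 0 1 \<and> (\<forall>\<tau>\<in>sphere 0 1. Re (s \<tau>) = u \<tau>) \<and>
      Im (s 0) = 0 \<and> holder_bound \<gamma> (cball 0 1) (C * K) s"
    if u: "holder_bound \<gamma> (sphere 0 1) K (u :: complex \<Rightarrow> real)" for K u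
  proof -
    define S where "S = (\<lambda>\<zeta>. circle_mean (\<lambda>\<tau>. u \<tau> * ((\<tau> + \<zeta>) / (\<tau> - \<zeta>))))"
    note S1 = schwarz_integral_holder(1)[OF \<gamma> u, folded c_def S_def]
    have S2: "\<bar>Re (S (of_real r * \<omega>)) - u \<omega>\<bar> \<le> K / c * (1 - r) powr \<gamma>"
      if "norm \<omega> = 1" "0 \<le> r" "r < 1" for r \<omega>
      using schwarz_integral_holder(2)[OF \<gamma> u that] unfolding S_def c_def .
    have K: "0 \<le> K"
      using holder_bound_norm[OF u, of 1] norm_ge_zero[of "u 1"] by simp
    have cu: "continuous_on (sphere 0 1) (\<lambda>\<tau>. complex_of_real (u \<tau>))"
      using holder_bound_continuous[OF u] \<gamma> by (intro continuous_intros) auto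
    have hol: "S holomorphic_on ball 0 1"
      unfolding holomorphic_on_def field_differentiable_def S_def
    proof
      fix x :: complex assume "x \<in> ball 0 1"
      then have "norm x < 1" by simp
      from has_field_derivative_at_within[OF schwarz_integral_derivative[OF cu this]]
      show "\<exists>f'. ((\<lambda>\<zeta>. circle_mean (\<lambda>\<tau>. u \<tau> * ((\<tau> + \<zeta>) / (\<tau> - \<zeta>)))) has_field_derivative f') (at x within ball 0 1)"
        by (rule exI)
    qed
    define A where "A = 2 * K / c * (1 + 2 / \<gamma>)"
    have A: "0 \<le> A" using K c \<gamma> by (simp add: A_def)
    have hoel: "norm (S a - S b) \<le> A * dist a b powr \<gamma>" if "norm a < 1" "norm b < 1" for a b
      unfolding A_def using K c by (intro hardy_littlewood[OF hol \<gamma> _ S1] that) auto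
    have "holder_bound \<gamma> (ball 0 1) (norm (S 0) + A) S"
    proof (rule holder_boundI)
      fix z :: complex assume z: "z \<in> ball 0 1"
      have "norm (S z) \<le> norm (S 0) + norm (S z - S 0)"
        by (rule norm_triangle_sub)
      also have "norm (S z - S 0) \<le> A * dist z 0 powr \<gamma>"
        using z by (intro hoel) auto
      also have "\<dots> \<le> A * 1"
        using z A \<gamma> by (intro mult_left_mono powr_le1) auto
      finally show "norm (S z) \<le> norm (S 0) + A" by simp
    next
      fix x y :: complex assume "x \<in> ball 0 1" "y \<in> ball 0 1"
      then have "norm (S x - S y) \<le> A * dist x y powr \<gamma>"
        by (intro hoel) auto
      also have "\<dots> \<le> (norm (S 0) + A) * dist x y powr \<gamma>"
        by (intro mult_right_mono) auto
      finally show "norm (S x - S y) \<le> (norm (S 0) + A) * dist x y powr \<gamma>" .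
    qed
    moreover have S0: "S 0 = circle_mean (\<lambda>\<tau>. complex_of_real (u \<tau>))"
      unfolding S_def by (rule circle_mean_cong) auto
    moreover have "norm (S 0) \<le> Re (circle_mean (\<lambda>_. complex_of_real K))"
      unfolding S0 using holder_bound_norm[OF u] by (intro norm_circle_mean_le cu) auto
    ultimately have hb: "holder_bound \<gamma> (ball 0 1) (C * K) S"
    proof (elim holder_bound_mono)
      assume "norm (S 0) \<le> Re (circle_mean (\<lambda>_. complex_of_real K))"
      moreover have "C * K = K + A"
        using c \<gamma> by (simp add: A_def C_def field_simps)
      ultimately show "norm (S 0) + A \<le> C * K"
        by (simp add: circle_mean_const)
    qed
    have Im0: "Im (S 0) = 0"
    proof -
      have "(\<lambda>t. u (cis (2 * pi * t))) integrable_on {0..1}"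
        using integrable_linear[OF circle_mean_integrable[OF cu] bounded_linear_Re] by (simp add: o_def)
      from integral_linear[OF this bounded_linear_of_real]
      have "S 0 = of_real (integral {0..1} (\<lambda>t. u (cis (2 * pi * t))))"
        unfolding S0 circle_mean_def by (simp add: o_def)
      then show ?thesis by simp
    qed
    obtain s where s: "uniformly_continuous_on (closure (ball 0 1)) s" "\<And>x. x \<in> ball 0 1 \<Longrightarrow> S x = s x"
      using uniformly_continuous_on_extension_on_closure[OF holder_bound_uniformly_continuous[OF hb \<gamma>(1)]] by metis
    have cont: "continuous_on (cball 0 1) s"
      using s(1) by (simp add: uniformly_continuous_imp_continuous)
    \<comment> \<open>Dilations by radii tending to 1 map the closed disc into the open one, where
      the bound is known, and do not increase distances; \<open>holder_bound_lim\<close> then gives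
      the bound up to the circle.\<close>
    define a where "a n = 1 - 1 / real (Suc n)" for n
    have a: "0 \<le> a n" "a n < 1" for n by (simp_all add: a_def)
    have a1: "(\<lambda>n. 1 - a n) \<longlonglongrightarrow> 0"
      unfolding a_def using LIMSEQ_Suc[OF lim_1_over_n] by simp
    have bl: "of_real (a n) * x \<in> ball 0 1" if x: "x \<in> cball 0 1" for x :: complex and n
    proof -
      have "norm (of_real (a n) * x) = a n * norm x"
        using a[of n] by (simp add: norm_mult)
      also have "\<dots> \<le> a n * 1"
        using x a by (intro mult_left_mono) auto
      finally show ?thesis using a[of n] by simp
    qed
    have lim: "(\<lambda>n. s (of_real (a n) * x)) \<longlonglongrightarrow> s x" if x: "x \<in> cball 0 1" for x
    proof (rule continuous_on_tendsto_compose[OF cont _ x])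
      have "(\<lambda>n. of_real (1 - (1 - a n)) * x) \<longlonglongrightarrow> of_real (1 - 0) * x"
        by (intro tendsto_intros a1)
      then show "(\<lambda>n. of_real (a n) * x) \<longlonglongrightarrow> x"
        by simp
      show "\<forall>\<^sub>F n in sequentially. of_real (a n) * x \<in> cball 0 1"
        using bl[OF x] by (auto simp: less_imp_le)
    qed
    have "holder_bound \<gamma> (cball 0 1) (C * K) s"
    proof (rule holder_bound_lim[OF _ lim])
      fix n
      show "holder_bound \<gamma> (cball 0 1) (C * K) (\<lambda>x. s (of_real (a n) * x))"
      proof (rule holder_boundI)
        fix x :: complex assume "x \<in> cball 0 1"
        from bl[OF this] show "norm (s (of_real (a n) * x)) \<le> C * K"
          using holder_bound_norm[OF hb] s(2) by metis
      next
        fix x y :: complex assume xy: "x \<in> cball 0 1" "y \<in> cball 0 1"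
        have "norm (s (of_real (a n) * x) - s (of_real (a n) * y)) \<le> C * K * dist (of_real (a n) * x) (of_real (a n) * y) powr \<gamma>"
          using holder_bound_diff[OF hb bl[OF xy(1)] bl[OF xy(2)], of n n] s(2)[OF bl[OF xy(1)], of n] s(2)[OF bl[OF xy(2)], of n] by simp
        also have "\<dots> \<le> C * K * dist x y powr \<gamma>"
        proof (intro mult_left_mono powr_mono2)
          show "dist (of_real (a n) * x) (of_real (a n) * y) \<le> dist x y"
            unfolding dist_norm right_diff_distrib[symmetric] norm_mult norm_of_real
            using a[of n] by (intro mult_left_le_one_le) auto
        qed (use K \<open>0 < C\<close> \<gamma> in auto)
        finally show "norm (s (of_real (a n) * x) - s (of_real (a n) * y)) \<le> C * K * dist x y powr \<gamma>" .
      qed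
    qed
    moreover have "s holomorphic_on ball 0 1"
      using hol s(2) by (subst holomorphic_cong[of _ _ _ S]) auto
    moreover have "Im (s 0) = 0"
      using Im0 s(2)[of 0] by simp
    moreover have "Re (s \<omega>) = u \<omega>" if w: "\<omega> \<in> sphere 0 1" for \<omega>
    proof -
      have "(\<lambda>n. Re (s (of_real (a n) * \<omega>)) - u \<omega>) \<longlonglongrightarrow> 0"
      proof (rule Lim_null_comparison)
        have "norm (Re (s (of_real (a n) * \<omega>)) - u \<omega>) \<le> K / c * (1 - a n) powr \<gamma>" for n
          using S2[of \<omega> "a n"] w a s(2)[OF bl[of \<omega> n]] by simp
        then show "\<forall>\<^sub>F n in sequentially. norm (Re (s (of_real (a n) * \<omega>)) - u \<omega>) \<le> K / c * (1 - a n) powr \<gamma>"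
          by simp
        have "(\<lambda>n. (1 - a n) powr \<gamma>) \<longlonglongrightarrow> 0"
          using a1 \<gamma> a by (intro tendsto_zero_powrI[where b = \<gamma>] always_eventually) (auto simp: less_imp_le)
        then show "(\<lambda>n. K / c * (1 - a n) powr \<gamma>) \<longlonglongrightarrow> 0"
          by (rule tendsto_mult_right_zero)
      qed
      moreover have "(\<lambda>n. Re (s (of_real (a n) * \<omega>)) - u \<omega>) \<longlonglongrightarrow> Re (s \<omega>) - u \<omega>"
        using w by (intro tendsto_intros lim) auto
      ultimately have "Re (s \<omega>) - u \<omega> = 0"
        by (rule LIMSEQ_unique[rotated])
      then show ?thesis by simp
    qed
    ultimately show ?thesis using cont by blast
  qed
  ultimately show ?thesis by (rule that)
qed

section \<open>Uniform limits of holomorphic polynomials\<close>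

text \<open>Holomorphy in several variables is encoded by a complex linear derivative together with
  holomorphy along all holomorphic curves. These conditions are stable under sums and products, so
  they reach polynomials by induction, and the last one survives locally uniform limits.\<close>

definition holo_derivative ::
  "(complex ^ 'n \<Rightarrow> complex) \<Rightarrow> (complex ^ 'n \<Rightarrow> complex ^ 'n \<Rightarrow> complex) \<Rightarrow> bool" where
  "holo_derivative P D \<longleftrightarrow> (\<forall>z. (P has_derivative D z) (at z)) \<and> (\<forall>z c v. D z (c *s v) = c * D z v) \<and>
     (\<forall>S f. open S \<longrightarrow> (\<forall>j. (\<lambda>\<zeta>. f \<zeta> $ j) holomorphic_on S) \<longrightarrow>
        (\<lambda>\<zeta>. P (f \<zeta>)) holomorphic_on S \<and> (\<forall>v. (\<lambda>\<zeta>. D (f \<zeta>) v) holomorphic_on S))"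

lemma holo_derivative_const: "holo_derivative (\<lambda>_. c) (\<lambda>_ _. 0)"
  by (auto simp: holo_derivative_def)

lemma holo_derivative_nth: "holo_derivative (\<lambda>z. z $ j) (\<lambda>_ v. v $ j)"
  by (auto simp: holo_derivative_def intro!: bounded_linear_imp_has_derivative bounded_linear_vec_nth)

lemma holo_derivative_add:
  assumes "holo_derivative P D" "holo_derivative Q E"
  shows "holo_derivative (\<lambda>z. P z + Q z) (\<lambda>z v. D z v + E z v)"
  using assms unfolding holo_derivative_def
  by (auto intro!: has_derivative_add holomorphic_intros simp: algebra_simps)

lemma holo_derivative_mult:
  assumes "holo_derivative P D" "holo_derivative Q E"
  shows "holo_derivative (\<lambda>z. P z * Q z) (\<lambda>z v. P z * E z v + D z v * Q z)"
  unfolding holo_derivative_def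
proof (intro conjI allI impI)
  show "((\<lambda>z. P z * Q z) has_derivative (\<lambda>v. P z * E z v + D z v * Q z)) (at z)" for z
    using assms by (intro has_derivative_mult) (auto simp: holo_derivative_def)
  show "P z * E z (c *s v) + D z (c *s v) * Q z = c * (P z * E z v + D z v * Q z)" for z c v
    using assms by (simp add: holo_derivative_def algebra_simps)
qed (use assms in \<open>auto simp: holo_derivative_def intro!: holomorphic_intros\<close>)

lemma holo_derivative_power: "\<exists>D. holo_derivative (\<lambda>z. (z $ j) ^ k) D"
proof (induction k)
  case 0
  then show ?case using holo_derivative_const[of 1] by auto
next
  case (Suc k)
  then show ?case using holo_derivative_mult[OF holo_derivative_nth[of j]] by fastforce
qed

lemma holo_derivative_prod:
  assumes "finite I" "\<And>i. i \<in> I \<Longrightarrow> \<exists>D. holo_derivative (P i) D"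
  shows "\<exists>D. holo_derivative (\<lambda>z. \<Prod>i\<in>I. P i z) D"
  using assms
proof (induction I rule: finite_induct)
  case empty
  then show ?case using holo_derivative_const[of 1] by auto
next
  case (insert i I)
  obtain D where "holo_derivative (P i) D" using insert.prems by blast
  moreover obtain E where "holo_derivative (\<lambda>z. \<Prod>i\<in>I. P i z) E"
    using insert.prems insert.IH by blast
  ultimately have *: "holo_derivative (P i) D" "holo_derivative (\<lambda>z. \<Prod>i\<in>I. P i z) E"
    by auto
  from holo_derivative_mult[OF *] insert.hyps show ?case by auto
qed

lemma holo_derivative_sum:
  assumes "finite I" "\<And>i. i \<in> I \<Longrightarrow> \<exists>D. holo_derivative (P i) D"
  shows "\<exists>D. holo_derivative (\<lambda>z. \<Sum>i\<in>I. P i z) D"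
  using assms
proof (induction I rule: finite_induct)
  case empty
  then show ?case using holo_derivative_const[of 0] by auto
next
  case (insert i I)
  obtain D where "holo_derivative (P i) D" using insert.prems by blast
  moreover obtain E where "holo_derivative (\<lambda>z. \<Sum>i\<in>I. P i z) E"
    using insert.prems insert.IH by blast
  ultimately have *: "holo_derivative (P i) D" "holo_derivative (\<lambda>z. \<Sum>i\<in>I. P i z) E"
    by auto
  from holo_derivative_add[OF *] insert.hyps show ?case by auto
qed

lemma holo_polynomial_derivative:
  assumes "holo_polynomial P"
  obtains D where "holo_derivative P D"
proof -
  obtain A a where A: "finite (A :: ('a \<Rightarrow> nat) set)"
    and P: "P = (\<lambda>z. \<Sum>m\<in>A. a m * (\<Prod>j\<in>UNIV. (z $ j) ^ m j))"
    using assms unfolding holo_polynomial_def by blast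
  have "\<exists>D. holo_derivative (\<lambda>z. a m * (\<Prod>j\<in>UNIV. (z $ j) ^ m j)) D" for m
  proof -
    obtain D where "holo_derivative (\<lambda>z. \<Prod>j\<in>UNIV. (z $ j) ^ m j) D"
      using holo_derivative_prod[of UNIV "\<lambda>j z. (z $ j) ^ m j"] holo_derivative_power by auto
    from holo_derivative_mult[OF holo_derivative_const[of "a m"] this] show ?thesis by blast
  qed
  then show ?thesis
    using holo_derivative_sum[OF A, of "\<lambda>m z. a m * (\<Prod>j\<in>UNIV. (z $ j) ^ m j)"] P that by auto
qed

section \<open>Cauchy estimates on complex lines and passage to the limit\<close>

lemma norm_vec_scale: "norm (c *s v) = norm c * norm (v :: complex ^ 'n)"
  by (simp add: norm_vec_def norm_mult L2_set_right_distrib)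

lemma norm_vec_le_sum: "norm (x :: 'a::real_normed_vector ^ 'n) \<le> (\<Sum>i\<in>UNIV. norm (x $ i))"
  by (simp add: norm_vec_def L2_set_le_sum)

lemma holo_derivative_line:
  assumes "holo_derivative P D"
  shows "((\<lambda>w. P (z + w *s v)) has_field_derivative D (z + w *s v) v) (at w)"
proof -
  have "bounded_linear (\<lambda>w. w *s v)"
    by (intro bounded_linear_intro[of _ "norm v"])
       (auto simp: vec_eq_iff algebra_simps norm_vec_scale)
  then have "((\<lambda>w. z + w *s v) has_derivative (\<lambda>w. w *s v)) (at w)"
    by (auto intro!: derivative_eq_intros bounded_linear_imp_has_derivative)
  moreover have "(P has_derivative D (z + w *s v)) (at (z + w *s v))"
    using assms by (auto simp: holo_derivative_def)
  ultimately have "((\<lambda>w. P (z + w *s v)) has_derivative (\<lambda>h. D (z + w *s v) (h *s v))) (at w)"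
    by (rule has_derivative_compose)
  then show ?thesis
    using assms by (simp add: has_field_derivative_def holo_derivative_def mult.commute[of _ "D _ v"] fun_eq_iff)
qed

text \<open>Cauchy's inequality for the restriction of \<open>P\<close> to the complex line through
  z in direction v. The parameter radius r/\<bar>v\<bar> is the one for which the circle stays in
  the ball of radius r.\<close>

lemma holo_derivative_bound:
  assumes D: "holo_derivative P D" and "0 < r" and B: "\<And>y. y \<in> cball z r \<Longrightarrow> norm (P y) \<le> B"
  shows "norm (D z v) \<le> B / r * norm v"
proof (cases "v = 0")
  case True
  have "D z (0 *s v) = 0 * D z v" using D unfolding holo_derivative_def by blast
  moreover have "0 *s v = v" using True by (simp add: vec_eq_iff)
  ultimately show ?thesis using True by simp
next
  case False
  define g where "g w = P (z + w *s v)" for w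
  have g: "(g has_field_derivative D (z + w *s v) v) (at w)" for w
    unfolding g_def by (rule holo_derivative_line[OF D])
  then have "g holomorphic_on UNIV"
    by (auto simp: holomorphic_on_def field_differentiable_def)
  define \<rho> where "\<rho> = r / norm v"
  have \<rho>: "0 < \<rho>" using False \<open>0 < r\<close> by (simp add: \<rho>_def)
  have "norm ((deriv ^^ 1) g 0) \<le> fact 1 * B / \<rho> ^ 1"
  proof (rule Cauchy_inequality)
    show "g holomorphic_on ball 0 \<rho>"
      by (rule holomorphic_on_subset[OF \<open>g holomorphic_on UNIV\<close>]) auto
    show "continuous_on (cball 0 \<rho>) g"
      by (meson \<open>g holomorphic_on UNIV\<close> continuous_on_subset holomorphic_on_imp_continuous_on top_greatest)
    fix w :: complex assume "norm (0 - w) = \<rho>"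
    then have "z + w *s v \<in> cball z r"
      using False by (simp add: dist_norm norm_vec_scale \<rho>_def)
    then show "norm (g w) \<le> B" unfolding g_def by (rule B)
  qed (fact \<rho>)
  moreover have "deriv g 0 = D z v"
    using DERIV_imp_deriv[OF g[of 0]] by (simp add: vec_eq_iff)
  ultimately show ?thesis by (simp add: \<rho>_def)
qed

lemma holo_derivative_diff:
  assumes "holo_derivative P D" "holo_derivative Q E"
  shows "holo_derivative (\<lambda>z. P z - Q z) (\<lambda>z v. D z v - E z v)"
  using assms unfolding holo_derivative_def
  by (auto intro!: has_derivative_diff holomorphic_intros simp: algebra_simps)

text \<open>The limit is differentiated by Cauchy's estimate on complex lines.\<close>

lemma holo_polynomial_uniform_limit:
  fixes P :: "nat \<Rightarrow> complex ^ 'n \<Rightarrow> complex"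
  assumes P: "\<And>n. holo_polynomial (P n)" and "open \<Omega>" and lim: "uniform_limit \<Omega> P F sequentially"
  shows "\<exists>D. (\<forall>z\<in>\<Omega>. (F has_derivative D z) (at z)) \<and> (\<forall>z\<in>\<Omega>. \<forall>c v. D z (c *s v) = c * D z v) \<and>
     (\<forall>S f v. open S \<longrightarrow> (\<forall>j. (\<lambda>\<zeta>. f \<zeta> $ j) holomorphic_on S) \<longrightarrow> f ` S \<subseteq> \<Omega> \<longrightarrow>
        (\<lambda>\<zeta>. D (f \<zeta>) v) holomorphic_on S)"
proof -
  have "\<forall>n. \<exists>D. holo_derivative (P n) D" using P holo_polynomial_derivative by metis
  then obtain E where E: "\<And>n. holo_derivative (P n) (E n)" by metis
  have unif: "uniformly_Cauchy_on \<Omega> P"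
    using lim uniformly_convergent_Cauchy by (auto simp: uniformly_convergent_on_def)
  \<comment> \<open>The radius \<open>2 * r\<close> leaves room for a ball of radius r around every
    point of \<open>ball z r\<close>. Differences below \<open>e * r\<close> there give derivatives
    below e, uniformly in the centre and linearly in v.\<close>
  have est: "\<exists>N. \<forall>n\<ge>N. \<forall>m\<ge>N. \<forall>x\<in>ball z r. \<forall>v. norm (E n x v - E m x v) \<le> e * norm v"
    if r: "0 < r" "cball z (2 * r) \<subseteq> \<Omega>" and "0 < e" for z r e
  proof -
    obtain N where N: "\<And>x m n. x \<in> \<Omega> \<Longrightarrow> m \<ge> N \<Longrightarrow> n \<ge> N \<Longrightarrow> dist (P m x) (P n x) < e * r"
      using unif r(1) \<open>0 < e\<close> unfolding uniformly_Cauchy_on_def by (meson mult_pos_pos)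
    have "norm (E n x v - E m x v) \<le> e * norm v" if "n \<ge> N" "m \<ge> N" "x \<in> ball z r" for n m x v
    proof -
      have "norm (E n x v - E m x v) \<le> (e * r) / r * norm v"
      proof (rule holo_derivative_bound[OF holo_derivative_diff[OF E E] r(1)])
        fix y assume "y \<in> cball x r"
        then have "y \<in> cball z (2 * r)"
          using that(3) dist_triangle[of z y x] by simp
        then show "norm (P n y - P m y) \<le> e * r"
          using N[of y n m] r(2) that by (auto simp: dist_norm)
      qed
      then show ?thesis using r by simp
    qed
    then show ?thesis by blast
  qed
  have nbhd: "\<exists>r>0. cball z (2 * r) \<subseteq> \<Omega>" if z: "z \<in> \<Omega>" for z
  proof -
    obtain r where "0 < r" "cball z r \<subseteq> \<Omega>" using \<open>open \<Omega>\<close> z open_contains_cball by blast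
    then show ?thesis by (intro exI[of _ "r / 2"]) auto
  qed
  \<comment> \<open>Only points of \<Omega> matter; elsewhere \<open>lim\<close> may be an arbitrary
    value.\<close>
  define D where "D z v = lim (\<lambda>n. E n z v)" for z v
  have conv: "(\<lambda>n. E n z v) \<longlonglongrightarrow> D z v" if z: "z \<in> \<Omega>" for z v
  proof -
    obtain r where r: "r > 0" "cball z (2 * r) \<subseteq> \<Omega>" using nbhd[OF z] by blast
    have "Cauchy (\<lambda>n. E n z v)"
    proof (rule metric_CauchyI)
      fix e :: real assume "0 < e"
      then have "0 < e / (norm v + 1)" by (simp add: add_nonneg_pos)
      from est[OF r this] obtain N where N: "\<And>n m. n \<ge> N \<Longrightarrow> m \<ge> N \<Longrightarrow> norm (E n z v - E m z v) \<le> e / (norm v + 1) * norm v"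
        using centre_in_ball[of z r] r(1) by blast
      have "e / (norm v + 1) * norm v < e"
        using \<open>0 < e\<close> by (simp add: divide_simps add_nonneg_pos)
      then show "\<exists>M. \<forall>m\<ge>M. \<forall>n\<ge>M. dist (E m z v) (E n z v) < e"
        unfolding dist_norm using N by (meson order_le_less_trans)
    qed
    then show ?thesis unfolding D_def by (simp add: Cauchy_convergent convergent_LIMSEQ_iff[symmetric])
  qed
  have est2: "\<exists>N. \<forall>n\<ge>N. \<forall>x\<in>ball z r. \<forall>v. norm (E n x v - D x v) \<le> e * norm v"
    if r: "0 < r" "cball z (2 * r) \<subseteq> \<Omega>" and "0 < e" for z r e
  proof -
    obtain N where N: "\<forall>n\<ge>N. \<forall>m\<ge>N. \<forall>x\<in>ball z r. \<forall>v. norm (E n x v - E m x v) \<le> e * norm v"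
      using est[OF r \<open>0 < e\<close>] by blast
    have "norm (E n x v - D x v) \<le> e * norm v" if "n \<ge> N" "x \<in> ball z r" for n x v
    proof -
      have "x \<in> \<Omega>" using that r by auto
      then have lim: "(\<lambda>m. E n x v - E m x v) \<longlonglongrightarrow> E n x v - D x v"
        by (intro tendsto_intros conv)
      show ?thesis
        by (rule Lim_norm_ubound[OF trivial_limit_sequentially lim]) (use N that in \<open>auto intro!: eventually_sequentiallyI[of N]\<close>)
    qed
    then show ?thesis by blast
  qed
  have "(F has_derivative D z) (at z)" if z: "z \<in> \<Omega>" for z
  proof -
    obtain r where r: "r > 0" "cball z (2 * r) \<subseteq> \<Omega>" using nbhd[OF z] by blast
    have PF: "(\<lambda>n. P n x) \<longlonglongrightarrow> F x" if "x \<in> \<Omega>" for x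
      using lim that by (rule tendsto_uniform_limitI)
    have "\<exists>g. \<forall>x\<in>ball z r. (\<lambda>n. P n x) \<longlonglongrightarrow> g x \<and> (g has_derivative D x) (at x within ball z r)"
    proof (rule has_derivative_sequence)
      show "(P n has_derivative E n x) (at x within ball z r)" for n x
        using E by (auto simp: holo_derivative_def intro: has_derivative_at_withinI)
      show "\<forall>\<^sub>F n in sequentially. \<forall>x\<in>ball z r. \<forall>h. norm (E n x h - D x h) \<le> e * norm h" if "0 < e" for e
        using est2[OF r that] by (simp add: eventually_sequentially)
      show "z \<in> ball z r" "(\<lambda>n. P n z) \<longlonglongrightarrow> F z" using r z PF by auto
    qed simp
    then obtain g where g: "\<And>x. x \<in> ball z r \<Longrightarrow> (\<lambda>n. P n x) \<longlonglongrightarrow> g x"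
      "(g has_derivative D z) (at z within ball z r)" using centre_in_ball[of z r] r(1) by blast
    have eq: "g x = F x" if "x \<in> ball z r" for x
    proof (rule LIMSEQ_unique[OF g(1)[OF that] PF])
      show "x \<in> \<Omega>" using that r by auto
    qed
    have "(F has_derivative D z) (at z within ball z r)"
      by (rule has_derivative_transform[OF _ _ g(2)]) (use r eq in auto)
    then show ?thesis using r by (simp add: at_within_open[of z "ball z r"])
  qed
  moreover have "D z (c *s v) = c * D z v" if "z \<in> \<Omega>" for z c v
  proof -
    have "(\<lambda>n. c * E n z v) \<longlonglongrightarrow> c * D z v"
      by (intro tendsto_intros conv that)
    moreover have "(\<lambda>n. E n z (c *s v)) \<longlonglongrightarrow> D z (c *s v)"
      by (intro conv that)
    ultimately show ?thesis
      using E LIMSEQ_unique by (auto simp: holo_derivative_def)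
  qed
  moreover have "(\<lambda>\<zeta>. D (f \<zeta>) v) holomorphic_on S"
    if S: "open S" "\<And>j. (\<lambda>\<zeta>. f \<zeta> $ j) holomorphic_on S" "f ` S \<subseteq> \<Omega>"
    for S and f :: "complex \<Rightarrow> complex ^ 'n" and v
  proof (rule holomorphic_uniform_sequence[OF S(1)])
    show "(\<lambda>\<zeta>. E n (f \<zeta>) v) holomorphic_on S" for n
      using E S by (auto simp: holo_derivative_def)
    fix \<zeta> assume \<zeta>: "\<zeta> \<in> S"
    have cf: "continuous_on S f"
    proof -
      have "continuous_on S (\<lambda>\<zeta>. \<chi> j. f \<zeta> $ j)"
        by (intro continuous_intros holomorphic_on_imp_continuous_on S)
      then show ?thesis by simp
    qed
    obtain r where r: "r > 0" "cball (f \<zeta>) (2 * r) \<subseteq> \<Omega>" using nbhd \<zeta> S(3) by blast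
    obtain d1 where d1: "d1 > 0" "cball \<zeta> d1 \<subseteq> S" using S(1) \<zeta> open_contains_cball by blast
    obtain d2 where d2: "d2 > 0" "\<And>y. y \<in> S \<Longrightarrow> dist y \<zeta> < d2 \<Longrightarrow> dist (f y) (f \<zeta>) < r"
      using cf \<zeta> r(1) unfolding continuous_on_iff by meson
    define d where "d = min d1 (d2 / 2)"
    have d: "0 < d" "cball \<zeta> d \<subseteq> S" using d1 d2(1) by (auto simp: d_def)
    have inb: "f y \<in> ball (f \<zeta>) r" if "y \<in> cball \<zeta> d" for y
      using d2(2)[of y] d2(1) that d by (auto simp: d_def dist_commute subset_iff)
    have "uniform_limit (cball \<zeta> d) (\<lambda>n \<zeta>. E n (f \<zeta>) v) (\<lambda>\<zeta>. D (f \<zeta>) v) sequentially"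
      unfolding uniform_limit_iff eventually_sequentially
    proof (intro allI impI)
      fix e :: real assume "0 < e"
      then have "0 < e / (norm v + 1)" by (simp add: add_nonneg_pos)
      from est2[OF r this] obtain N where N: "\<forall>n\<ge>N. \<forall>x\<in>ball (f \<zeta>) r. \<forall>v'. norm (E n x v' - D x v') \<le> e / (norm v + 1) * norm v'"
        by blast
      have "e / (norm v + 1) * norm v < e"
        using \<open>0 < e\<close> by (simp add: divide_simps add_nonneg_pos)
      then show "\<exists>N. \<forall>n\<ge>N. \<forall>x\<in>cball \<zeta> d. dist (E n (f x) v) (D (f x) v) < e"
        unfolding dist_norm using N inb by (meson order_le_less_trans)
    qed
    then show "\<exists>d>0. cball \<zeta> d \<subseteq> S \<and> uniform_limit (cball \<zeta> d) (\<lambda>n \<zeta>. E n (f \<zeta>) v) (\<lambda>\<zeta>. D (f \<zeta>) v) sequentially"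
      using d by blast
  qed
  ultimately show ?thesis by (intro exI[of _ D]) blast
qed

section \<open>Superposition operators on Hoelder classes\<close>

text \<open>The direction may vary with n, because the perturbations of a disc agree with t \<phi>
  only to first order. Convergent directions are bounded, so the remainder is still o(t); steps of
  either sign are allowed.\<close>

lemma directional_difference_quotient:
  fixes h :: "'a::real_normed_vector \<Rightarrow> 'b::real_normed_vector"
  assumes h: "(h has_derivative h') (at x)" and t: "t \<longlonglongrightarrow> (0::real)" "\<And>n. t n \<noteq> 0" and w: "w \<longlonglongrightarrow> v"
  shows "(\<lambda>n. (1 / t n) *\<^sub>R (h (x + t n *\<^sub>R w n) - h x)) \<longlonglongrightarrow> h' v"
proof -
  interpret bounded_linear h' using h by (rule has_derivative_bounded_linear)
  obtain M where M: "M > 0" "\<And>n. norm (w n) \<le> M"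
    using convergent_imp_Bseq[of w] w by (auto simp: convergent_def Bseq_def)
  have "(\<lambda>n. (1 / t n) *\<^sub>R (h (x + t n *\<^sub>R w n) - h x) - h' (w n)) \<longlonglongrightarrow> 0"
  proof (rule LIMSEQ_I)
    fix e :: real assume "0 < e"
    then have "0 < e / (2 * M)" using M by simp
    then obtain d where d: "d > 0"
      "\<And>y. norm (y - x) < d \<Longrightarrow> norm (h y - h x - h' (y - x)) \<le> e / (2 * M) * norm (y - x)"
      using h unfolding has_derivative_at_alt by blast
    have "(\<lambda>n. t n *\<^sub>R w n) \<longlonglongrightarrow> 0 *\<^sub>R v"
      by (intro tendsto_intros t w)
    then obtain N where N: "\<And>n. n \<ge> N \<Longrightarrow> norm (t n *\<^sub>R w n) < d"
      using d(1) LIMSEQ_D by fastforce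
    have "norm ((1 / t n) *\<^sub>R (h (x + t n *\<^sub>R w n) - h x) - h' (w n) - 0) < e" if "n \<ge> N" for n
    proof -
      have "(1 / t n) *\<^sub>R (h (x + t n *\<^sub>R w n) - h x) - h' (w n) =
          (1 / t n) *\<^sub>R (h (x + t n *\<^sub>R w n) - h x - h' (t n *\<^sub>R w n))"
        using t(2)[of n] by (simp add: scaleR algebra_simps)
      then have "norm ((1 / t n) *\<^sub>R (h (x + t n *\<^sub>R w n) - h x) - h' (w n)) =
          norm (h (x + t n *\<^sub>R w n) - h x - h' (t n *\<^sub>R w n)) / \<bar>t n\<bar>"
        by simp
      also have "\<dots> \<le> (e / (2 * M) * norm (t n *\<^sub>R w n)) / \<bar>t n\<bar>"
        using d(2)[of "x + t n *\<^sub>R w n"] N[OF that] by (intro divide_right_mono) auto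
      also have "\<dots> = e / (2 * M) * norm (w n)"
        using t(2)[of n] by simp
      also have "\<dots> \<le> e / (2 * M) * M"
        using M \<open>0 < e\<close> by (intro mult_left_mono) auto
      also have "\<dots> < e" using M \<open>0 < e\<close> by simp
      finally show ?thesis by simp
    qed
    then show "\<exists>N. \<forall>n\<ge>N. norm ((1 / t n) *\<^sub>R (h (x + t n *\<^sub>R w n) - h x) - h' (w n) - 0) < e"
      by blast
  qed
  moreover have "(\<lambda>n. h' (w n)) \<longlonglongrightarrow> h' v"
    by (rule tendsto[OF w])
  ultimately show ?thesis
    using tendsto_add by fastforce
qed

text \<open>Move s along the segments from b to a and from d to c simultaneously and apply the mean
  value inequality to the difference of the values of \<open>R\<close>. Its derivative splits into
  \<open>DR\<close> at one point applied to (a - b) - (c - d), and a difference of \<open>DR\<close>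
  at two points applied to c - d. The first part is small because \<open>DR\<close> vanishes at
  q.\<close>

lemma second_difference_bound:
  fixes R :: "'a::real_normed_vector \<Rightarrow> 'b::real_normed_vector"
  assumes R: "\<And>x. x \<in> cball q \<rho> \<Longrightarrow> (R has_derivative DR x) (at x)"
    and L: "\<And>x y v. x \<in> cball q \<rho> \<Longrightarrow> y \<in> cball q \<rho> \<Longrightarrow> norm (DR x v - DR y v) \<le> L * norm (x - y) * norm v"
    and q: "\<And>v. DR q v = 0" and "0 \<le> L" "0 \<le> \<rho>"
    and pts: "a \<in> cball q \<rho>" "b \<in> cball q \<rho>" "c \<in> cball q \<rho>" "d \<in> cball q \<rho>"
  shows "norm (R a - R b - (R c - R d)) \<le>
    L * \<rho> * norm ((a - b) - (c - d)) + L * (norm (a - c) + norm (b - d)) * norm (c - d)" (is "_ \<le> ?M")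
proof -
  have seg: "y + s *\<^sub>R (x - y) \<in> cball q \<rho>" if "x \<in> cball q \<rho>" "y \<in> cball q \<rho>" "0 \<le> s" "s \<le> 1" for x y s
  proof -
    have "y + s *\<^sub>R (x - y) = (1 - s) *\<^sub>R y + s *\<^sub>R x" by (simp add: algebra_simps)
    then show ?thesis using convexD[OF convex_cball that(2,1), of "1 - s" s] that by simp
  qed
  have der: "((\<lambda>s. R (y + s *\<^sub>R (x - y))) has_vector_derivative DR (y + s *\<^sub>R (x - y)) (x - y)) (at s)"
    if "x \<in> cball q \<rho>" "y \<in> cball q \<rho>" "0 \<le> s" "s \<le> 1" for x y s
  proof -
    have "((\<lambda>s. y + s *\<^sub>R (x - y)) has_derivative (\<lambda>h. h *\<^sub>R (x - y))) (at s)"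
      by (auto intro!: derivative_eq_intros)
    from has_derivative_compose[OF this R[OF seg[OF that]]]
    show ?thesis
      using linear_scale[OF bounded_linear.linear[OF has_derivative_bounded_linear[OF R[OF seg[OF that]]]]]
      by (simp add: has_vector_derivative_def)
  qed
  define \<theta> where "\<theta> s = R (b + s *\<^sub>R (a - b)) - R (d + s *\<^sub>R (c - d))" for s
  have d\<theta>: "(\<theta> has_vector_derivative DR (b + s *\<^sub>R (a - b)) (a - b) - DR (d + s *\<^sub>R (c - d)) (c - d)) (at s)"
    if "0 \<le> s" "s \<le> 1" for s
    unfolding \<theta>_def[abs_def] using pts that by (intro has_vector_derivative_diff der)
  have "norm (\<theta> 1 - \<theta> 0) \<le> ?M * 1 - ?M * 0"
  proof (rule differentiable_bound_general[of 0 1])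
    show "continuous_on {0..1} \<theta>"
      using d\<theta> by (intro continuous_at_imp_continuous_on) (auto intro!: has_vector_derivative_continuous)
    show "continuous_on {0..1} ((*) ?M)" by (intro continuous_intros)
    fix s :: real assume s: "0 < s" "s < 1"
    show "(\<theta> has_vector_derivative DR (b + s *\<^sub>R (a - b)) (a - b) - DR (d + s *\<^sub>R (c - d)) (c - d)) (at s)"
      using s by (intro d\<theta>) auto
    show "((*) ?M has_vector_derivative ?M) (at s)"
      using has_vector_derivative_mult_right[OF has_vector_derivative_id, of ?M] by simp
    let ?x = "b + s *\<^sub>R (a - b)" and ?y = "d + s *\<^sub>R (c - d)"
    have x: "?x \<in> cball q \<rho>" and y: "?y \<in> cball q \<rho>" using s pts by (auto intro!: seg simp del: mem_cball)
    have eq: "DR ?x (a - b) - DR ?y (c - d) = DR ?x ((a - b) - (c - d)) + (DR ?x (c - d) - DR ?y (c - d))"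
      using linear_diff[OF bounded_linear.linear[OF has_derivative_bounded_linear[OF R[OF x]]]] by simp
    have "norm (DR ?x (a - b) - DR ?y (c - d)) \<le>
        norm (DR ?x ((a - b) - (c - d))) + norm (DR ?x (c - d) - DR ?y (c - d))"
      unfolding eq by (rule norm_triangle_ineq)
    also have "norm (DR ?x ((a - b) - (c - d))) \<le> L * norm (?x - q) * norm ((a - b) - (c - d))"
      using L[OF x, of q "(a - b) - (c - d)"] \<open>0 \<le> \<rho>\<close> by (simp add: q)
    also have "\<dots> \<le> L * \<rho> * norm ((a - b) - (c - d))"
      using x \<open>0 \<le> L\<close> by (intro mult_right_mono mult_left_mono) (auto simp: dist_norm norm_minus_commute)
    also have "norm (DR ?x (c - d) - DR ?y (c - d)) \<le> L * norm (?x - ?y) * norm (c - d)"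
      by (rule L[OF x y])
    also have "norm (?x - ?y) \<le> norm (a - c) + norm (b - d)"
    proof -
      have "?x - ?y = s *\<^sub>R (a - c) + (1 - s) *\<^sub>R (b - d)" by (simp add: algebra_simps)
      then have "norm (?x - ?y) \<le> s * norm (a - c) + (1 - s) * norm (b - d)"
        using s norm_triangle_ineq[of "s *\<^sub>R (a - c)" "(1 - s) *\<^sub>R (b - d)"] by simp
      also have "\<dots> \<le> 1 * norm (a - c) + 1 * norm (b - d)"
        using s by (intro add_mono mult_right_mono) auto
      finally show ?thesis by simp
    qed
    finally show "norm (DR ?x (a - b) - DR ?y (c - d)) \<le> ?M"
      using \<open>0 \<le> L\<close> by (simp add: mult_left_mono mult_right_mono)
  qed simp
  then show ?thesis by (simp add: \<theta>_def algebra_simps)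
qed

text \<open>The Hoelder quotient of a difference of superpositions is a second difference of
  \<open>R\<close>. With radius 2\<delta>, \<open>second_difference_bound\<close> gives 2L\<delta>K
  + 4L\<delta>K. The factor \<delta>, due to the vanishing of the derivative at q, is what makes the
  Bishop operator a contraction.\<close>

lemma holder_bound_nemytskii:
  fixes R :: "'a::real_normed_vector \<Rightarrow> 'b::real_normed_vector" and f u v :: "'c::metric_space \<Rightarrow> 'a"
  assumes R: "\<And>x. x \<in> cball q (2 * \<delta>) \<Longrightarrow> (R has_derivative DR x) (at x)"
    and L: "\<And>x y v. x \<in> cball q (2 * \<delta>) \<Longrightarrow> y \<in> cball q (2 * \<delta>) \<Longrightarrow> norm (DR x v - DR y v) \<le> L * norm (x - y) * norm v"
    and q: "\<And>v. DR q v = 0" and "0 \<le> L" "0 \<le> \<delta>"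
    and f: "holder_bound \<gamma> X \<delta> (\<lambda>x. f x - q)" and u: "holder_bound \<gamma> X \<delta> u" and v: "holder_bound \<gamma> X \<delta> v"
    and uv: "holder_bound \<gamma> X K (\<lambda>x. u x - v x)"
  shows "holder_bound \<gamma> X (6 * L * \<delta> * K) (\<lambda>x. R (f x + u x) - R (f x + v x))"
proof -
  have mem: "f x + w x \<in> cball q (2 * \<delta>)" if "holder_bound \<gamma> X \<delta> w" "x \<in> X" for w x
  proof -
    have "norm (f x - q + w x) \<le> \<delta> + \<delta>"
      using holder_bound_norm[OF holder_bound_add[OF f that(1)] that(2)] by simp
    then show ?thesis by (simp add: dist_norm norm_minus_commute algebra_simps)
  qed
  have K: "0 \<le> K" if "x \<in> X" for x
    using holder_bound_norm[OF uv that] norm_ge_zero order_trans by blast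
  note sd = second_difference_bound[OF R L q \<open>0 \<le> L\<close>]
  show ?thesis
  proof (rule holder_boundI)
    fix x assume x: "x \<in> X"
    \<comment> \<open>The supremum bound is the same inequality with both comparison points equal to
      q.\<close>
    have "norm (R (f x + u x) - R (f x + v x) - (R q - R q)) \<le>
       L * (2 * \<delta>) * norm ((f x + u x) - (f x + v x) - (q - q)) + L * (norm (f x + u x - q) + norm (f x + v x - q)) * norm (q - q)"
      using mem[OF u x] mem[OF v x] \<open>0 \<le> \<delta>\<close> by (intro sd) auto
    also have "\<dots> \<le> L * (2 * \<delta>) * K"
      using holder_bound_norm[OF uv x] \<open>0 \<le> L\<close> \<open>0 \<le> \<delta>\<close> by (simp add: mult_left_mono)
    also have "\<dots> \<le> 6 * L * \<delta> * K"
      using K[OF x] \<open>0 \<le> L\<close> \<open>0 \<le> \<delta>\<close> by (simp add: mult_ac)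
    finally show "norm (R (f x + u x) - R (f x + v x)) \<le> 6 * L * \<delta> * K" by simp
  next
    fix x y assume xy: "x \<in> X" "y \<in> X"
    let ?d = "dist x y powr \<gamma>"
    have 1: "norm (f x + w x - (f y + w y)) \<le> 2 * \<delta> * ?d" if "holder_bound \<gamma> X \<delta> w" for w
      using holder_bound_diff[OF holder_bound_add[OF f that] xy] by (simp add: algebra_simps)
    have "norm (R (f x + u x) - R (f x + v x) - (R (f y + u y) - R (f y + v y))) \<le>
       L * (2 * \<delta>) * norm ((f x + u x) - (f x + v x) - ((f y + u y) - (f y + v y))) +
       L * (norm (f x + u x - (f y + u y)) + norm (f x + v x - (f y + v y))) * norm ((f y + u y) - (f y + v y))"
      using mem[OF u xy(1)] mem[OF v xy(1)] mem[OF u xy(2)] mem[OF v xy(2)] \<open>0 \<le> \<delta>\<close> by (intro sd) auto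
    also have "\<dots> \<le> L * (2 * \<delta>) * (K * ?d) + L * (2 * \<delta> * ?d + 2 * \<delta> * ?d) * K"
      using 1[OF u] 1[OF v] holder_bound_diff[OF uv xy] holder_bound_norm[OF uv xy(2)] \<open>0 \<le> L\<close> \<open>0 \<le> \<delta>\<close> K[OF xy(1)]
      by (intro add_mono mult_mono mult_left_mono) (auto simp: algebra_simps)
    also have "\<dots> = 6 * L * \<delta> * K * ?d" by (simp add: algebra_simps)
    finally show "norm (R (f x + u x) - R (f x + v x) - (R (f y + u y) - R (f y + v y))) \<le> 6 * L * \<delta> * K * ?d" .
  qed
qed

text \<open>The linearized counterpart of \<open>holder_bound_nemytskii\<close>, used for
  uniqueness. One L\<delta> is the size of the operator, the other its variation along
  \<open>f\<close>.\<close>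

lemma holder_bound_derivative:
  fixes R :: "'a::real_normed_vector \<Rightarrow> 'b::real_normed_vector" and f u :: "'c::metric_space \<Rightarrow> 'a"
  assumes R: "\<And>x. x \<in> cball q \<delta> \<Longrightarrow> (R has_derivative DR x) (at x)"
    and L: "\<And>x y v. x \<in> cball q \<delta> \<Longrightarrow> y \<in> cball q \<delta> \<Longrightarrow> norm (DR x v - DR y v) \<le> L * norm (x - y) * norm v"
    and q: "\<And>v. DR q v = 0" and "0 \<le> L" "0 \<le> \<delta>"
    and f: "holder_bound \<gamma> X \<delta> (\<lambda>x. f x - q)" and u: "holder_bound \<gamma> X K u"
  shows "holder_bound \<gamma> X (2 * L * \<delta> * K) (\<lambda>x. DR (f x) (u x))"
proof -
  have mem: "f x \<in> cball q \<delta>" if "x \<in> X" for x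
    using holder_bound_norm[OF f that] by (simp add: dist_norm norm_minus_commute)
  have K: "0 \<le> K" if "x \<in> X" for x
    using holder_bound_norm[OF u that] norm_ge_zero order_trans by blast
  have 1: "norm (DR (f x) v) \<le> L * \<delta> * norm v" if "x \<in> X" for x v
  proof -
    have "norm (DR (f x) v) \<le> L * norm (f x - q) * norm v"
      using L[OF mem[OF that], of q v] \<open>0 \<le> \<delta>\<close> by (simp add: q)
    also have "\<dots> \<le> L * \<delta> * norm v"
      using holder_bound_norm[OF f that] \<open>0 \<le> L\<close> by (intro mult_right_mono mult_left_mono) auto
    finally show ?thesis .
  qed
  show ?thesis
  proof (rule holder_boundI)
    fix x assume x: "x \<in> X"
    have "norm (DR (f x) (u x)) \<le> L * \<delta> * norm (u x)" by (rule 1[OF x])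
    also have "\<dots> \<le> L * \<delta> * K"
      using holder_bound_norm[OF u x] \<open>0 \<le> L\<close> \<open>0 \<le> \<delta>\<close> by (intro mult_left_mono) auto
    also have "\<dots> \<le> 2 * L * \<delta> * K"
      using K[OF x] \<open>0 \<le> L\<close> \<open>0 \<le> \<delta>\<close> by simp
    finally show "norm (DR (f x) (u x)) \<le> 2 * L * \<delta> * K" .
  next
    fix x y assume xy: "x \<in> X" "y \<in> X"
    let ?d = "dist x y powr \<gamma>"
    have eq: "DR (f x) (u x) - DR (f y) (u y) = DR (f x) (u x - u y) + (DR (f x) (u y) - DR (f y) (u y))"
      using linear_diff[OF bounded_linear.linear[OF has_derivative_bounded_linear[OF R[OF mem[OF xy(1)]]]]] by simp
    have "norm (DR (f x) (u x) - DR (f y) (u y)) \<le> norm (DR (f x) (u x - u y)) + norm (DR (f x) (u y) - DR (f y) (u y))"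
      unfolding eq by (rule norm_triangle_ineq)
    also have "\<dots> \<le> L * \<delta> * norm (u x - u y) + L * norm (f x - f y) * norm (u y)"
      using 1[OF xy(1)] L[OF mem[OF xy(1)] mem[OF xy(2)]] by (intro add_mono)
    also have "\<dots> \<le> L * \<delta> * (K * ?d) + L * (\<delta> * ?d) * K"
      using holder_bound_diff[OF u xy] holder_bound_diff[OF f xy] holder_bound_norm[OF u xy(2)] K[OF xy(1)] \<open>0 \<le> L\<close> \<open>0 \<le> \<delta>\<close>
      by (intro add_mono mult_mono mult_left_mono) auto
    also have "\<dots> = 2 * L * \<delta> * K * ?d" by (simp add: algebra_simps)
    finally show "norm (DR (f x) (u x) - DR (f y) (u y)) \<le> 2 * L * \<delta> * K * ?d" .
  qed
qed

section \<open>The Schwarz problem\<close>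

lemma bounded_linear_scale_vec: "bounded_linear (\<lambda>c. c *s (v :: complex ^ 'n))"
  by (intro bounded_linear_intro[of _ "norm v"]) (auto simp: vec_eq_iff algebra_simps norm_vec_scale)

lemma bounded_linear_pairing: "bounded_linear (pairing a)"
proof -
  have "bounded_linear (\<lambda>v. \<Sum>j\<in>UNIV. a $ j * v $ j)"
    by (intro bounded_linear_sum bounded_linear_compose[OF bounded_linear_mult_right bounded_linear_vec_nth])
  then show ?thesis by (simp add: pairing_def[abs_def])
qed

lemma pairing_scale: "pairing a (c *s v) = c * pairing a v"
  by (simp add: pairing_def sum_distrib_left mult.left_commute)

text \<open>By the open mapping theorem a nonconstant image would be open, yet it lies in the
  imaginary axis.\<close>

lemma holomorphic_Re_zero_constant:
  assumes "f holomorphic_on S" "open S" "connected S" "\<And>z. z \<in> S \<Longrightarrow> Re (f z) = 0"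
  shows "f constant_on S"
proof (rule ccontr)
  assume nc: "\<not> f constant_on S"
  then have "S \<noteq> {}" by (auto simp: constant_on_def)
  have "open (f ` S)"
    using nc assms by (intro open_mapping_thm[of f S S]) auto
  then obtain z e where z: "z \<in> S" "e > 0" "ball (f z) e \<subseteq> f ` S"
    using \<open>S \<noteq> {}\<close> by (meson all_not_in_conv image_eqI openE)
  have "f z + of_real (e / 2) \<in> ball (f z) e" using z by (simp add: dist_norm)
  then have "f z + of_real (e / 2) \<in> f ` S" using z by blast
  then obtain w where "w \<in> S" "f w = f z + of_real (e / 2)" by auto
  then have "Re (f w) = Re (f z) + e / 2" by simp
  then show False using assms(4)[OF \<open>w \<in> S\<close>] assms(4)[OF z(1)] z(2) by simp
qed

text \<open>Fixing the free imaginary constant at 0 makes the solution unique on the closed disc, so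
  a bound or an additive property proved for one solution holds for any other.\<close>

definition schwarz_solution :: "(complex \<Rightarrow> real) \<Rightarrow> (complex \<Rightarrow> complex) \<Rightarrow> bool" where
  "schwarz_solution u s \<longleftrightarrow> continuous_on (cball 0 1) s \<and> s holomorphic_on ball 0 1 \<and>
     (\<forall>\<tau>\<in>sphere 0 1. Re (s \<tau>) = u \<tau>) \<and> Im (s 0) = 0"

lemma schwarz_solution_cong:
  assumes "\<And>\<tau>. \<tau> \<in> sphere 0 1 \<Longrightarrow> u \<tau> = v \<tau>"
  shows "schwarz_solution u s \<longleftrightarrow> schwarz_solution v s"
  using assms by (simp add: schwarz_solution_def)

lemma schwarz_solution_diff:
  "schwarz_solution u s \<Longrightarrow> schwarz_solution v t \<Longrightarrow> schwarz_solution (\<lambda>\<tau>. u \<tau> - v \<tau>) (\<lambda>\<tau>. s \<tau> - t \<tau>)"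
  by (auto simp: schwarz_solution_def intro!: continuous_intros holomorphic_intros)

lemma disc_Re_le:
  assumes "continuous_on (cball 0 1) s" "s holomorphic_on ball 0 1" "\<And>\<tau>. \<tau> \<in> sphere 0 1 \<Longrightarrow> Re (s \<tau>) \<le> B"
    and "z \<in> cball 0 1"
  shows "Re (s z) \<le> B"
  using maximum_real_frontier[of s "cball 0 1" B z] assms by auto

lemma schwarz_solution_unique:
  assumes "schwarz_solution u s" "schwarz_solution u t" "z \<in> cball 0 1"
  shows "s z = t z"
proof -
  have h: "schwarz_solution (\<lambda>_. 0) (\<lambda>\<tau>. s \<tau> - t \<tau>)"
    using schwarz_solution_diff[OF assms(1,2)] by simp
  define d where "d \<tau> = s \<tau> - t \<tau>" for \<tau>
  have d: "continuous_on (cball 0 1) d" "d holomorphic_on ball 0 1" "\<And>\<tau>. \<tau> \<in> sphere 0 1 \<Longrightarrow> Re (d \<tau>) = 0" "Im (d 0) = 0"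
    using h by (auto simp: schwarz_solution_def d_def[abs_def])
  have "Re (d w) = 0" if "w \<in> cball 0 1" for w
  proof -
    have "Re (d w) \<le> 0" using disc_Re_le[of d 0 w] d that by simp
    moreover have "Re (- d w) \<le> 0"
      using disc_Re_le[of "\<lambda>w. - d w" 0 w] d that by (simp add: continuous_on_minus holomorphic_on_minus)
    ultimately show ?thesis by simp
  qed
  note Re0 = this
  then have "d constant_on ball 0 1"
    using d(2) by (intro holomorphic_Re_zero_constant) auto
  then obtain c where c: "\<And>w. w \<in> ball 0 1 \<Longrightarrow> d w = c" by (auto simp: constant_on_def)
  have "d 0 = 0" using Re0[of 0] d(4) by (simp add: complex_eq_iff)
  then have "c = 0" using c[of 0] by simp
  then have "d z = 0"
    using continuous_constant_on_closure[of "ball 0 1" d, OF _ _ , of 0 z] c d(1) assms(3) by auto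
  then show ?thesis by (simp add: d_def)
qed

lemma analytic_disc_vec:
  assumes "\<And>\<zeta>. \<zeta> \<in> cball 0 1 \<Longrightarrow> f \<zeta> = x + (\<Sum>j<(k::nat). Z j \<zeta> *s b j)"
    and "\<And>j. j < k \<Longrightarrow> continuous_on (cball 0 1) (Z j)" "\<And>j. j < k \<Longrightarrow> Z j holomorphic_on ball 0 1"
  shows "analytic_disc f"
  unfolding analytic_disc_def
proof (intro conjI allI)
  have "continuous_on (cball 0 1) (\<lambda>\<zeta>. x + (\<Sum>j<k. Z j \<zeta> *s b j))"
    by (intro continuous_intros bounded_linear.continuous_on[OF bounded_linear_scale_vec] assms) auto
  then show "continuous_on (cball 0 1) f"
    using assms(1) by (subst continuous_on_cong[OF refl]) auto
  fix i
  have "(\<lambda>\<zeta>. x $ i + (\<Sum>j<k. Z j \<zeta> * b j $ i)) holomorphic_on ball 0 1"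
    by (intro holomorphic_intros assms) auto
  then show "(\<lambda>\<zeta>. f \<zeta> $ i) holomorphic_on ball 0 1"
    using assms(1) by (subst holomorphic_cong[OF refl, of _ _ "\<lambda>\<zeta>. x $ i + (\<Sum>j<k. Z j \<zeta> * b j $ i)"]) auto
qed

lemma analytic_disc_uniform_limit:
  assumes "\<And>n. analytic_disc (f n)" "uniform_limit (cball 0 1) f g sequentially"
  shows "analytic_disc g"
  unfolding analytic_disc_def
proof (intro conjI allI)
  show "continuous_on (cball 0 1) g"
    by (rule uniform_limit_theorem[OF _ assms(2)]) (use assms(1) in \<open>auto simp: analytic_disc_def\<close>)
  fix i
  have u: "uniform_limit (cball 0 1) (\<lambda>n \<zeta>. f n \<zeta> $ i) (\<lambda>\<zeta>. g \<zeta> $ i) sequentially"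
    by (rule bounded_linear.uniform_limit[OF bounded_linear_vec_nth assms(2)])
  show "(\<lambda>\<zeta>. g \<zeta> $ i) holomorphic_on ball 0 1"
  proof (rule holomorphic_uniform_sequence[of _ "\<lambda>n \<zeta>. f n \<zeta> $ i"])
    fix x :: complex assume "x \<in> ball 0 1"
    then obtain d where "d > 0" "cball x d \<subseteq> ball 0 1" using open_contains_cball open_ball by blast
    then show "\<exists>d>0. cball x d \<subseteq> ball 0 1 \<and> uniform_limit (cball x d) (\<lambda>n \<zeta>. f n \<zeta> $ i) (\<lambda>\<zeta>. g \<zeta> $ i) sequentially"
      using uniform_limit_on_subset[OF u, of "cball x d"] ball_subset_cball by blast
  qed (use assms(1) in \<open>auto simp: analytic_disc_def\<close>)
qed

section \<open>The Bishop equation\<close>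

text \<open>
  The discs \<open>f + g \<sigma> n\<close> solve the Bishop equation with parameters \<open>\<sigma> t\<^sub>n e\<close>, where \<open>\<sigma> = \<plusminus>1\<close>; their
  difference quotients at \<open>f\<close> have a common limit \<open>\<phi>\<close>. If \<open>r j\<close> is the nonlinear part of a defining
  function and \<open>e\<close> is tangent, the condition on the coefficients says that they stay attached.
\<close>

definition bishop_variation ::
  "nat \<Rightarrow> (nat \<Rightarrow> complex ^ 'n \<Rightarrow> real) \<Rightarrow> (nat \<Rightarrow> complex ^ 'n) \<Rightarrow> real \<Rightarrow> real \<Rightarrow> (complex \<Rightarrow> complex ^ 'n) \<Rightarrow>
    complex ^ 'n \<Rightarrow> (nat \<Rightarrow> real) \<Rightarrow> (complex \<Rightarrow> complex ^ 'n) \<Rightarrow> (real \<Rightarrow> nat \<Rightarrow> complex \<Rightarrow> complex ^ 'n) \<Rightarrow> bool" where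
  "bishop_variation k r b \<delta> \<eta> f e t \<phi> g \<longleftrightarrow> (\<forall>n. 0 < t n) \<and> t \<longlonglongrightarrow> 0 \<and> analytic_disc \<phi> \<and>
      (\<forall>\<zeta>\<in>cball 0 1. norm (\<phi> \<zeta> - e) \<le> \<eta> * norm e) \<and>
      (\<forall>\<sigma>\<in>{1, - 1}. (\<forall>n. analytic_disc (g \<sigma> n) \<and>
          (\<forall>\<zeta>\<in>sphere 0 1. norm (g \<sigma> n \<zeta>) \<le> \<delta> \<and>
            (\<exists>c. g \<sigma> n \<zeta> = (\<sigma> * t n) *\<^sub>R e + (\<Sum>j<k. c j *s b j) \<and>
              (\<forall>j<k. Re (c j) = r j (f \<zeta>) - r j (f \<zeta> + g \<sigma> n \<zeta>))))) \<and>
        (\<forall>\<zeta>\<in>cball 0 1. (\<lambda>n. (1 / (\<sigma> * t n)) *\<^sub>R g \<sigma> n \<zeta>) \<longlonglongrightarrow> \<phi> \<zeta>))"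

text \<open>The unknown is U = x + \<Sum> Z_j b_j with holomorphic Z_j whose real parts on the
  circle are \<open>r j (f \<zeta>) - r j (f \<zeta> + U \<zeta>)\<close> and x = \<sigma> t_n e. As
  the derivative of \<open>r j\<close> vanishes at q, solving the Schwarz problems is a contraction
  near q. The bounds are proportional to \<bar>x\<bar>, so the quotients U/(\<sigma> t_n) are
  equicontinuous and have limits along a subsequence. The difference of the limits for the two signs
  solves a homogeneous linear equation that is again contracting, so it is zero.\<close>

lemma bishop_discs:
  fixes r :: "nat \<Rightarrow> complex ^ 'n \<Rightarrow> real" and Dr :: "nat \<Rightarrow> complex ^ 'n \<Rightarrow> complex ^ 'n \<Rightarrow> real"
    and A b :: "nat \<Rightarrow> complex ^ 'n" and \<gamma> \<eta> s0 L :: real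
  assumes \<gamma>: "0 < \<gamma>" "\<gamma> < 1" and "0 < s0" "0 \<le> L" "0 < \<eta>"
    and R: "\<And>j x. j < k \<Longrightarrow> x \<in> cball q s0 \<Longrightarrow> (r j has_derivative Dr j x) (at x)"
    and L: "\<And>j x y v. j < k \<Longrightarrow> x \<in> cball q s0 \<Longrightarrow> y \<in> cball q s0 \<Longrightarrow>
        norm (Dr j x v - Dr j y v) \<le> L * norm (x - y) * norm v"
    and q: "\<And>j v. j < k \<Longrightarrow> Dr j q v = 0"
    and AB: "\<And>i j. i < k \<Longrightarrow> j < k \<Longrightarrow> pairing (A i) (b j) = (if i = j then 1 else 0)"
  shows "\<exists>\<delta>>0. 2 * \<delta> \<le> s0 \<and> (\<forall>f e. holder_bound \<gamma> (sphere 0 1) \<delta> (\<lambda>\<zeta>. f \<zeta> - q) \<longrightarrow>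
    (\<exists>t \<phi> g. bishop_variation k r b \<delta> \<eta> f e t \<phi> g))"
proof -
  obtain C where "0 < C" and C: "\<And>K u. holder_bound \<gamma> (sphere 0 1) K (u :: complex \<Rightarrow> real) \<Longrightarrow>
    \<exists>s. continuous_on (cball 0 1) s \<and> s holomorphic_on ball 0 1 \<and> (\<forall>\<tau>\<in>sphere 0 1. Re (s \<tau>) = u \<tau>) \<and>
      Im (s 0) = 0 \<and> holder_bound \<gamma> (cball 0 1) (C * K) s"
    using schwarz_holder[OF \<gamma>] by blast
  have sol_ex: "\<exists>s. schwarz_solution u s \<and> holder_bound \<gamma> (cball 0 1) (C * K) s"
    if "holder_bound \<gamma> (sphere 0 1) K u" for u :: "complex \<Rightarrow> real" and K
    using C[OF that] unfolding schwarz_solution_def by blast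
  have sol_bd: "holder_bound \<gamma> (cball 0 1) (C * K) s"
    if u: "holder_bound \<gamma> (sphere 0 1) K u" and s: "schwarz_solution u s" for u s K
  proof -
    obtain s' where s': "schwarz_solution u s'" "holder_bound \<gamma> (cball 0 1) (C * K) s'"
      using sol_ex[OF u] by blast
    then show ?thesis
      using holder_bound_cong[of "cball 0 1" s s' \<gamma> "C * K"] schwarz_solution_unique[OF s s'(1)] by blast
  qed
  define SW where "SW u = (SOME s. schwarz_solution u s)" for u
  have SW: "schwarz_solution u (SW u)" if "holder_bound \<gamma> (sphere 0 1) K u" for u K
    unfolding SW_def using sol_ex[OF that] by (metis someI)
  define Bn where "Bn = (\<Sum>j<k. norm (b j))"
  have Bn: "0 \<le> Bn" by (simp add: Bn_def sum_nonneg)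
  \<comment> \<open>\<open>M * \<delta>\<close> is the Lipschitz constant of the Bishop operator:
    \<open>C\<close> from the Schwarz problem, 6L\<delta> from the superposition, \<open>Bn\<close>
    from assembling the vector.\<close>
  define M where "M = C * 6 * L * Bn"
  have M: "0 \<le> M" using \<open>0 < C\<close> \<open>0 \<le> L\<close> Bn by (simp add: M_def)
  \<comment> \<open>The bound 1/2 makes the operator a contraction; \<eta>/2 keeps the solution,
    whose size is at most 2\<bar>x\<bar>, within \<eta>\<bar>x\<bar> of the constant x.\<close>
  define m where "m = min (1/2) (\<eta> / 2)"
  have m: "0 < m" "m \<le> 1/2" "m \<le> \<eta> / 2" using \<open>0 < \<eta>\<close> by (auto simp: m_def)
  \<comment> \<open>Half of \<open>s0\<close> keeps \<open>f + u\<close> in the ball where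
    \<open>r\<close> is controlled; the denominator \<open>M + 1\<close> also covers M = 0.\<close>
  define \<delta> where "\<delta> = min (s0 / 2) (m / (M + 1))"
  have \<delta>: "0 < \<delta>" "2 * \<delta> \<le> s0" using \<open>0 < s0\<close> m M by (auto simp: \<delta>_def)
  have "M * \<delta> \<le> M * (m / (M + 1))" using M by (intro mult_left_mono) (auto simp: \<delta>_def)
  also have "\<dots> \<le> m" using M m by (simp add: field_simps)
  finally have M\<delta>: "M * \<delta> \<le> m" .
  have sum_scale: "holder_bound \<gamma> X (K * Bn) (\<lambda>x. \<Sum>j<k. Z j x *s b j)"
    if "\<And>j. j < k \<Longrightarrow> holder_bound \<gamma> X K (Z j)" for X :: "complex set" and K Z
  proof -
    have "holder_bound \<gamma> X (\<Sum>j<k. norm (b j) * K) (\<lambda>x. \<Sum>j<k. Z j x *s b j)"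
    proof (intro holder_bound_sum)
      fix j assume "j \<in> {..<k}"
      then show "holder_bound \<gamma> X (norm (b j) * K) (\<lambda>x. Z j x *s b j)"
        using that by (intro holder_bound_linear[OF _ bounded_linear_scale_vec]) (auto simp: norm_vec_scale)
    qed simp
    then show ?thesis by (simp add: Bn_def sum_distrib_left mult.commute)
  qed
  have main: "\<exists>t \<phi> g. bishop_variation k r b \<delta> \<eta> f e t \<phi> g"
    if f: "holder_bound \<gamma> (sphere 0 1) \<delta> (\<lambda>\<zeta>. f \<zeta> - q)" for f :: "complex \<Rightarrow> complex ^ 'n" and e
  proof -
    define rhs where "rhs j u \<zeta> = r j (f \<zeta>) - r j (f \<zeta> + u \<zeta>)" for j u \<zeta>
    have R2: "(r j has_derivative Dr j x) (at x)" if "j < k" "x \<in> cball q (2 * \<delta>)" for j x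
      using R that \<delta> by auto
    have L2: "norm (Dr j x v - Dr j y v) \<le> L * norm (x - y) * norm v"
      if "j < k" "x \<in> cball q (2 * \<delta>)" "y \<in> cball q (2 * \<delta>)" for j x y v
      using L[of j x y v] that \<delta> by auto
    have rhs_diff: "holder_bound \<gamma> (sphere 0 1) (6 * L * \<delta> * K) (\<lambda>\<zeta>. rhs j u \<zeta> - rhs j v \<zeta>)"
      if "j < k" "holder_bound \<gamma> (sphere 0 1) \<delta> u" "holder_bound \<gamma> (sphere 0 1) \<delta> v"
        "holder_bound \<gamma> (sphere 0 1) K (\<lambda>\<zeta>. u \<zeta> - v \<zeta>)" for j u v K
    proof -
      have "holder_bound \<gamma> (sphere 0 1) (6 * L * \<delta> * K) (\<lambda>\<zeta>. r j (f \<zeta> + u \<zeta>) - r j (f \<zeta> + v \<zeta>))"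
        using that \<open>0 \<le> L\<close> \<delta> f by (intro holder_bound_nemytskii[OF R2 L2 q]) auto
      then show ?thesis
        by (subst (asm) holder_bound_swap) (simp add: rhs_def)
    qed
    have hb0: "holder_bound \<gamma> X K (\<lambda>_. 0 :: complex ^ 'n)" if "0 \<le> K" for X K
      using that by (intro holder_bound_const) auto
    have rhs0: "rhs j (\<lambda>_. 0) = (\<lambda>_. 0)" for j by (simp add: rhs_def fun_eq_iff)
    have rhs_bd: "holder_bound \<gamma> (sphere 0 1) (6 * L * \<delta> * \<delta>) (rhs j u)"
      if "j < k" "holder_bound \<gamma> (sphere 0 1) \<delta> u" for j u
      using rhs_diff[OF that hb0, of \<delta>] that(2) \<delta> by (simp add: rhs0)
    define \<Phi> where "\<Phi> x u \<zeta> = x + (\<Sum>j<k. SW (rhs j u) \<zeta> *s b j)" for x u \<zeta>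
    have \<Phi>_diff: "holder_bound \<gamma> (cball 0 1) (m * K) (\<lambda>\<zeta>. \<Phi> x u \<zeta> - \<Phi> x v \<zeta>)"
      if u: "holder_bound \<gamma> (sphere 0 1) \<delta> u" and v: "holder_bound \<gamma> (sphere 0 1) \<delta> v"
        and uv: "holder_bound \<gamma> (sphere 0 1) K (\<lambda>\<zeta>. u \<zeta> - v \<zeta>)" for x u v K
    proof -
      have K: "0 \<le> K"
        using order_trans[OF norm_ge_zero holder_bound_norm[OF uv, of 1]] by simp
      have "holder_bound \<gamma> (cball 0 1) (C * (6 * L * \<delta> * K)) (\<lambda>\<zeta>. SW (rhs j u) \<zeta> - SW (rhs j v) \<zeta>)" if "j < k" for j
        by (rule sol_bd[OF rhs_diff[OF that u v uv]])
           (intro schwarz_solution_diff SW[OF rhs_bd] that u v)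
      then have "holder_bound \<gamma> (cball 0 1) (C * (6 * L * \<delta> * K) * Bn) (\<lambda>\<zeta>. \<Sum>j<k. (SW (rhs j u) \<zeta> - SW (rhs j v) \<zeta>) *s b j)"
        by (rule sum_scale)
      moreover have "C * (6 * L * \<delta> * K) * Bn \<le> m * K"
      proof -
        have eq: "C * (6 * L * \<delta> * K) * Bn = (M * \<delta>) * K" by (simp add: M_def)
        show ?thesis unfolding eq by (rule mult_right_mono[OF M\<delta> K])
      qed
      ultimately have "holder_bound \<gamma> (cball 0 1) (m * K) (\<lambda>\<zeta>. \<Sum>j<k. (SW (rhs j u) \<zeta> - SW (rhs j v) \<zeta>) *s b j)"
        by (rule holder_bound_mono)
      moreover have "(\<Sum>j<k. (SW (rhs j u) \<zeta> - SW (rhs j v) \<zeta>) *s b j) = \<Phi> x u \<zeta> - \<Phi> x v \<zeta>" for \<zeta>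
        by (simp add: \<Phi>_def vector_sub_rdistrib sum_subtractf)
      ultimately show ?thesis by simp
    qed
    have \<Phi>0: "\<Phi> x (\<lambda>_. 0) \<zeta> = x" if "\<zeta> \<in> cball 0 1" for x \<zeta>
    proof -
      have "schwarz_solution (\<lambda>_. 0) (\<lambda>_. 0)" by (simp add: schwarz_solution_def)
      moreover have "schwarz_solution (\<lambda>_. 0) (SW (\<lambda>_. 0))"
        by (rule SW[of 0]) (simp add: holder_bound_def)
      ultimately have "SW (\<lambda>_. 0) \<zeta> = 0"
        using schwarz_solution_unique that by blast
      then show ?thesis by (simp add: \<Phi>_def rhs0)
    qed
    \<comment> \<open>All bounds scale with \<bar>x\<bar>: after division by t the quotients remain
      in one fixed Hoelder ball.\<close>
    define good where "good x U Z \<longleftrightarrow> (\<forall>\<zeta>\<in>cball 0 1. U \<zeta> = x + (\<Sum>j<k. Z j \<zeta> *s b j)) \<and>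
        (\<forall>j<k. schwarz_solution (rhs j U) (Z j)) \<and> holder_bound \<gamma> (cball 0 1) (2 * norm x) U \<and>
        (\<forall>\<zeta>\<in>cball 0 1. norm (U \<zeta> - x) \<le> \<eta> * norm x)" for x U Z
    have good_ex: "\<exists>U Z. good x U Z"
      if x: "2 * norm x \<le> \<delta>" for x
    proof -
      have "\<exists>u. holder_bound \<gamma> (sphere 0 1) (2 * norm x) u \<and> (\<forall>\<zeta>\<in>sphere 0 1. \<Phi> x u \<zeta> = u \<zeta>)"
      proof (rule holder_bound_fixpoint)
        fix u v :: "complex \<Rightarrow> complex ^ 'n" and K
        assume u: "holder_bound \<gamma> (sphere 0 1) (2 * norm x) u" and v: "holder_bound \<gamma> (sphere 0 1) (2 * norm x) v"
          and uv: "holder_bound \<gamma> (sphere 0 1) K (\<lambda>\<zeta>. u \<zeta> - v \<zeta>)"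
        have K: "0 \<le> K"
          using order_trans[OF norm_ge_zero holder_bound_norm[OF uv, of 1]] by simp
        have "holder_bound \<gamma> (sphere 0 1) (m * K) (\<lambda>\<zeta>. \<Phi> x u \<zeta> - \<Phi> x v \<zeta>)"
          by (rule holder_bound_subset[OF \<Phi>_diff[OF holder_bound_mono[OF u x] holder_bound_mono[OF v x] uv]]) auto
        then show "holder_bound \<gamma> (sphere 0 1) (K / 2) (\<lambda>\<zeta>. \<Phi> x u \<zeta> - \<Phi> x v \<zeta>)"
          using m(2) K mult_right_mono[of m "1/2" K] by (elim holder_bound_mono) auto
      next
        have "holder_bound \<gamma> (sphere 0 1) (2 * norm x / 2) (\<lambda>_. x)"
          by (rule holder_bound_const) simp
        then show "holder_bound \<gamma> (sphere 0 1) (2 * norm x / 2) (\<Phi> x (\<lambda>_. 0))"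
          by (rule iffD1[OF holder_bound_cong, rotated]) (simp add: \<Phi>0)
      qed simp
      then obtain u where u: "holder_bound \<gamma> (sphere 0 1) (2 * norm x) u" "\<And>\<zeta>. \<zeta> \<in> sphere 0 1 \<Longrightarrow> \<Phi> x u \<zeta> = u \<zeta>"
        by blast
      have u\<delta>: "holder_bound \<gamma> (sphere 0 1) \<delta> u" by (rule holder_bound_mono[OF u(1) x])
      have u0: "holder_bound \<gamma> (sphere 0 1) (2 * norm x) (\<lambda>\<zeta>. u \<zeta> - 0)" using u(1) by simp
      have "holder_bound \<gamma> (cball 0 1) (m * (2 * norm x)) (\<lambda>\<zeta>. \<Phi> x u \<zeta> - \<Phi> x (\<lambda>_. 0) \<zeta>)"
        using \<delta> by (intro \<Phi>_diff[OF u\<delta> hb0 u0]) auto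
      then have d: "holder_bound \<gamma> (cball 0 1) (m * (2 * norm x)) (\<lambda>\<zeta>. \<Phi> x u \<zeta> - x)"
        by (rule iffD1[OF holder_bound_cong, rotated]) (simp add: \<Phi>0)
      have "holder_bound \<gamma> (cball 0 1) (m * (2 * norm x) + norm x) (\<lambda>\<zeta>. (\<Phi> x u \<zeta> - x) + x)"
        by (intro holder_bound_add d holder_bound_const) simp
      moreover have "m * (2 * norm x) + norm x \<le> 2 * norm x"
        using m(2) mult_right_mono[of m "1/2" "2 * norm x"] by simp
      ultimately have 1: "holder_bound \<gamma> (cball 0 1) (2 * norm x) (\<Phi> x u)"
        by (auto elim: holder_bound_mono)
      have 2: "norm (\<Phi> x u \<zeta> - x) \<le> \<eta> * norm x" if "\<zeta> \<in> cball 0 1" for \<zeta>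
        using holder_bound_norm[OF d that] m(3) mult_right_mono[of m "\<eta> / 2" "2 * norm x"] by simp
      have 3: "schwarz_solution (rhs j (\<Phi> x u)) (SW (rhs j u))" if "j < k" for j
        by (rule iffD1[OF schwarz_solution_cong SW[OF rhs_bd[OF that u\<delta>]]]) (simp add: rhs_def u(2))
      show ?thesis
        by (rule exI[of _ "\<Phi> x u"], rule exI[of _ "\<lambda>j. SW (rhs j u)"]) (use 1 2 3 in \<open>auto simp: \<Phi>_def good_def\<close>)
    qed
    have "\<forall>x. \<exists>p. 2 * norm x \<le> \<delta> \<longrightarrow> good x (fst p) (snd p)"
      using good_ex by (metis fst_conv snd_conv)
    then obtain p where p: "\<And>x. 2 * norm x \<le> \<delta> \<Longrightarrow> good x (fst (p x)) (snd (p x))"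
      by metis
    define U where "U x = fst (p x)" for x
    define Z where "Z x = snd (p x)" for x
    have U: "\<And>x \<zeta>. 2 * norm x \<le> \<delta> \<Longrightarrow> \<zeta> \<in> cball 0 1 \<Longrightarrow> U x \<zeta> = x + (\<Sum>j<k. Z x j \<zeta> *s b j)"
      and Z: "\<And>x j. 2 * norm x \<le> \<delta> \<Longrightarrow> j < k \<Longrightarrow> schwarz_solution (rhs j (U x)) (Z x j)"
      and Ubd: "\<And>x. 2 * norm x \<le> \<delta> \<Longrightarrow> holder_bound \<gamma> (cball 0 1) (2 * norm x) (U x)"
      and Ux: "\<And>x \<zeta>. 2 * norm x \<le> \<delta> \<Longrightarrow> \<zeta> \<in> cball 0 1 \<Longrightarrow> norm (U x \<zeta> - x) \<le> \<eta> * norm x"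
      using p unfolding good_def U_def Z_def by blast+
    have Udisc: "analytic_disc (U x)" if "2 * norm x \<le> \<delta>" for x
      using Z[OF that] by (intro analytic_disc_vec[OF U[OF that]]) (auto simp: schwarz_solution_def)
    \<comment> \<open>Chosen so that \<plusminus>t e lies in the admissible range of parameters; the
      1 added to the norm covers e = 0.\<close>
    define t where "t n = \<delta> / (2 * (norm e + 1)) * (1 / real (Suc n))" for n
    have ne: "0 < norm e + 1" by (simp add: add_nonneg_pos)
    have t: "0 < t n" for n using \<delta> ne by (simp add: t_def)
    have tlim: "t \<longlonglongrightarrow> 0"
      unfolding t_def by (intro tendsto_mult_right_zero LIMSEQ_Suc[OF lim_1_over_n])
    have tsmall: "2 * norm ((\<sigma> * t n) *\<^sub>R e) \<le> \<delta>" if "\<sigma> \<in> {1, -1}" for \<sigma> n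
    proof -
      have "t n \<le> \<delta> / (2 * (norm e + 1)) * 1"
        unfolding t_def using \<delta> ne by (intro mult_left_mono) auto
      then have "t n * norm e \<le> \<delta> / (2 * (norm e + 1)) * (norm e + 1)"
        using t[of n] \<delta> ne by (intro mult_mono) auto
      also have "\<dots> = \<delta> / 2"
      proof -
        have "\<delta> / (2 * y) * y = \<delta> / 2" if "0 < y" for y using that by simp
        from this[OF ne] show ?thesis .
      qed
      finally show ?thesis using that t[of n] by (auto simp: abs_mult)
    qed
    define V where "V \<sigma> n \<zeta> = (1 / (\<sigma> * t n)) *\<^sub>R U ((\<sigma> * t n) *\<^sub>R e) \<zeta>" for \<sigma> n \<zeta>
    have Vbd: "holder_bound \<gamma> (cball 0 1) (2 * norm e) (V \<sigma> n)" if "\<sigma> \<in> {1, -1}" for \<sigma> n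
    proof -
      have "holder_bound \<gamma> (cball 0 1) (1 / t n * (2 * norm ((\<sigma> * t n) *\<^sub>R e))) (V \<sigma> n)"
        unfolding V_def[abs_def] using that t[of n]
        by (intro holder_bound_linear[OF Ubd[OF tsmall[OF that]] bounded_linear_scaleR_right]) auto
      moreover have "1 / t n * (2 * norm ((\<sigma> * t n) *\<^sub>R e)) = 2 * norm e"
        using that t[of n] by (auto simp: abs_mult)
      ultimately show ?thesis by simp
    qed
    have Vdisc: "analytic_disc (V \<sigma> n)" if "\<sigma> \<in> {1, -1}" for \<sigma> n
      unfolding analytic_disc_def
    proof (intro conjI allI)
      note U' = Udisc[OF tsmall[OF that, of n], unfolded analytic_disc_def]
      show "continuous_on (cball 0 1) (V \<sigma> n)"
        unfolding V_def[abs_def] using U' by (intro continuous_intros) auto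
      show "(\<lambda>\<zeta>. V \<sigma> n \<zeta> $ j) holomorphic_on ball 0 1" for j
        unfolding V_def vector_scaleR_component scaleR_conv_of_real[where 'a = complex]
        using U' by (intro holomorphic_intros) auto
    qed
    have Ve: "norm (V \<sigma> n \<zeta> - e) \<le> \<eta> * norm e" if "\<sigma> \<in> {1, -1}" "\<zeta> \<in> cball 0 1" for \<sigma> n \<zeta>
    proof -
      have "\<sigma> * t n \<noteq> 0" using that t[of n] by auto
      then have "V \<sigma> n \<zeta> - e = (1 / (\<sigma> * t n)) *\<^sub>R (U ((\<sigma> * t n) *\<^sub>R e) \<zeta> - (\<sigma> * t n) *\<^sub>R e)"
        by (simp add: V_def scaleR_diff_right)
      then have "norm (V \<sigma> n \<zeta> - e) = 1 / t n * norm (U ((\<sigma> * t n) *\<^sub>R e) \<zeta> - (\<sigma> * t n) *\<^sub>R e)"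
        using that t[of n] by auto
      also have "\<dots> \<le> 1 / t n * (\<eta> * norm ((\<sigma> * t n) *\<^sub>R e))"
        using t[of n] by (intro mult_left_mono Ux[OF tsmall[OF that(1)] that(2)]) auto
      also have "\<dots> = \<eta> * norm e"
        using that t[of n] by (auto simp: abs_mult)
      finally show ?thesis .
    qed
    \<comment> \<open>The quotients for both signs are taken as one pair-valued family, so that a
      single subsequence serves both.\<close>
    obtain G \<kappa> where G: "continuous_on (cball 0 1) G" and \<kappa>: "strict_mono (\<kappa> :: nat \<Rightarrow> nat)"
      and conv: "\<And>\<epsilon>. 0 < \<epsilon> \<Longrightarrow> \<exists>N. \<forall>n \<zeta>. n \<ge> N \<and> \<zeta> \<in> cball 0 1 \<longrightarrow> norm ((V 1 (\<kappa> n) \<zeta>, V (-1) (\<kappa> n) \<zeta>) - G \<zeta>) < \<epsilon>"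
    proof (rule Arzela_Ascoli[of "cball 0 1 :: complex set" "\<lambda>n \<zeta>. (V 1 n \<zeta>, V (-1) n \<zeta>)" "4 * norm e"])
      show "compact (cball (0 :: complex) 1)" by simp
      show "norm (V 1 n \<zeta>, V (-1) n \<zeta>) \<le> 4 * norm e" if "\<zeta> \<in> cball 0 1" for n \<zeta>
        using norm_Pair_le[of "V 1 n \<zeta>" "V (-1) n \<zeta>"] holder_bound_norm[OF Vbd that, of 1 n]
          holder_bound_norm[OF Vbd that, of "-1" n] by simp
      fix x :: complex and \<epsilon> :: real assume x: "x \<in> cball 0 1" and "0 < \<epsilon>"
      define d where "d = (\<epsilon> / (4 * norm e + 1)) powr (1 / \<gamma>)"
      have pos: "0 < 4 * norm e + 1" by (simp add: add_nonneg_pos)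
      have d0: "0 < d" unfolding d_def using \<open>0 < \<epsilon>\<close> pos by (metis divide_pos_pos less_irrefl powr_gt_zero)
      have d1: "d powr \<gamma> = \<epsilon> / (4 * norm e + 1)"
        using \<open>0 < \<epsilon>\<close> \<gamma> pos by (simp add: d_def powr_powr)
      have "norm ((V 1 n x, V (-1) n x) - (V 1 n y, V (-1) n y)) < \<epsilon>" if y: "y \<in> cball 0 1" "norm (x - y) < d" for n y
      proof -
        have "norm ((V 1 n x, V (-1) n x) - (V 1 n y, V (-1) n y)) \<le> norm (V 1 n x - V 1 n y) + norm (V (-1) n x - V (-1) n y)"
          by (simp add: norm_Pair_le)
        also have "\<dots> \<le> 2 * norm e * dist x y powr \<gamma> + 2 * norm e * dist x y powr \<gamma>"
          using x y by (intro add_mono holder_bound_diff[OF Vbd]) auto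
        also have "\<dots> = 4 * norm e * dist x y powr \<gamma>" by simp
        also have "\<dots> \<le> 4 * norm e * d powr \<gamma>"
          using y \<gamma> by (intro mult_left_mono powr_mono2) (auto simp: dist_norm)
        also have "\<dots> < \<epsilon>" using \<open>0 < \<epsilon>\<close> pos by (simp add: d1 field_simps)
        finally show ?thesis .
      qed
      then show "\<exists>d. 0 < d \<and> (\<forall>n y. y \<in> cball 0 1 \<and> norm (x - y) < d \<longrightarrow>
          norm ((V 1 n x, V (-1) n x) - (V 1 n y, V (-1) n y)) < \<epsilon>)"
        using d0 by blast
    qed blast
    define \<phi> where "\<phi> \<sigma> \<zeta> = (if \<sigma> = (1::real) then fst (G \<zeta>) else snd (G \<zeta>))" for \<sigma> \<zeta>
    have ulim: "uniform_limit (cball 0 1) (\<lambda>n. V \<sigma> (\<kappa> n)) (\<phi> \<sigma>) sequentially" if "\<sigma> \<in> {1, -1}" for \<sigma>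
      unfolding uniform_limit_iff eventually_sequentially
    proof (intro allI impI)
      fix \<epsilon> :: real assume "0 < \<epsilon>"
      then obtain N where N: "\<forall>n \<zeta>. n \<ge> N \<and> \<zeta> \<in> cball 0 1 \<longrightarrow> norm ((V 1 (\<kappa> n) \<zeta>, V (-1) (\<kappa> n) \<zeta>) - G \<zeta>) < \<epsilon>"
        using conv by blast
      have "dist (V \<sigma> (\<kappa> n) \<zeta>) (\<phi> \<sigma> \<zeta>) < \<epsilon>" if n: "n \<ge> N" and \<zeta>: "\<zeta> \<in> cball 0 1" for n \<zeta>
      proof -
        let ?p = "(V 1 (\<kappa> n) \<zeta>, V (-1) (\<kappa> n) \<zeta>) - G \<zeta>"
        have eq: "?p = (fst ?p, snd ?p)" by (rule surjective_pairing)
        have "dist (V \<sigma> (\<kappa> n) \<zeta>) (\<phi> \<sigma> \<zeta>) \<le> norm (fst ?p, snd ?p)"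
          using \<open>\<sigma> \<in> {1, -1}\<close> norm_fst_le[of "fst ?p" "snd ?p"] norm_snd_le[of "snd ?p" "fst ?p"]
          by (auto simp: dist_norm \<phi>_def)
        then show ?thesis
          unfolding eq[symmetric] using N n \<zeta> by (meson order_le_less_trans)
      qed
      then show "\<exists>N. \<forall>n\<ge>N. \<forall>\<zeta>\<in>cball 0 1. dist (V \<sigma> (\<kappa> n) \<zeta>) (\<phi> \<sigma> \<zeta>) < \<epsilon>" by blast
    qed
    have plim: "(\<lambda>n. V \<sigma> (\<kappa> n) \<zeta>) \<longlonglongrightarrow> \<phi> \<sigma> \<zeta>" if "\<sigma> \<in> {1, -1}" "\<zeta> \<in> cball 0 1" for \<sigma> \<zeta>
      using ulim[OF that(1)] that(2) by (rule tendsto_uniform_limitI)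
    have \<phi>disc: "analytic_disc (\<phi> \<sigma>)" if "\<sigma> \<in> {1, -1}" for \<sigma>
      using Vdisc[OF that] by (intro analytic_disc_uniform_limit[OF _ ulim[OF that]])
    have \<phi>e: "norm (\<phi> \<sigma> \<zeta> - e) \<le> \<eta> * norm e" if "\<sigma> \<in> {1, -1}" "\<zeta> \<in> cball 0 1" for \<sigma> \<zeta>
      by (rule Lim_norm_ubound[OF trivial_limit_sequentially tendsto_diff[OF plim[OF that] tendsto_const]])
         (use Ve[OF that] in simp)
    have t\<kappa>: "(\<lambda>n. t (\<kappa> n)) \<longlonglongrightarrow> 0"
      using LIMSEQ_subseq_LIMSEQ[OF tlim \<kappa>] by (simp add: o_def)
    have f_in: "f \<zeta> \<in> cball q \<delta>" if "\<zeta> \<in> sphere 0 1" for \<zeta>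
      using holder_bound_norm[OF f that] by (simp add: dist_norm norm_minus_commute)
    have unique: "\<phi> 1 \<zeta> = \<phi> (-1) \<zeta>" if \<zeta>: "\<zeta> \<in> cball 0 1" for \<zeta>
    proof -
      define d where "d \<zeta> = \<phi> 1 \<zeta> - \<phi> (-1) \<zeta>" for \<zeta>
      \<comment> \<open>The vector e cancels in the difference of the two quotients. The plus sign
        appears because the coefficients for \<sigma> = -1 are divided by -t.\<close>
      define W where "W n j \<zeta> = Z ((1 * t (\<kappa> n)) *\<^sub>R e) j \<zeta> / t (\<kappa> n) + Z ((-1 * t (\<kappa> n)) *\<^sub>R e) j \<zeta> / t (\<kappa> n)" for n j \<zeta>
      have VW: "V 1 (\<kappa> n) \<zeta> - V (-1) (\<kappa> n) \<zeta> = (\<Sum>j<k. W n j \<zeta> *s b j)" if "\<zeta> \<in> cball 0 1" for n \<zeta>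
      proof -
        have *: "V \<sigma> (\<kappa> n) \<zeta> = e + (\<Sum>j<k. (Z ((\<sigma> * t (\<kappa> n)) *\<^sub>R e) j \<zeta> / (\<sigma> * t (\<kappa> n))) *s b j)" if "\<sigma> \<in> {1, -1}" for \<sigma>
        proof -
          have "\<sigma> * t (\<kappa> n) \<noteq> 0" using that t[of "\<kappa> n"] by auto
          then show ?thesis
            unfolding V_def U[OF tsmall[OF that] \<open>\<zeta> \<in> cball 0 1\<close>]
            by (simp add: vec_eq_iff scaleR_right_distrib scaleR_sum_right)
               (simp add: scaleR_conv_of_real sum_distrib_left field_simps)
        qed
        show ?thesis
          unfolding *[of 1, simplified] *[of "-1", simplified]
          by (simp add: W_def vec_eq_iff sum_subtractf[symmetric] algebra_simps sum_negf[symmetric] sum.distrib[symmetric])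
      qed
      have dlim: "(\<lambda>n. V 1 (\<kappa> n) \<zeta> - V (-1) (\<kappa> n) \<zeta>) \<longlonglongrightarrow> d \<zeta>" if "\<zeta> \<in> cball 0 1" for \<zeta>
        unfolding d_def using that by (intro tendsto_intros plim) auto
      \<comment> \<open>Convergence is known for the vectors only; duality of \<open>A\<close> and
        \<open>b\<close> transfers it to the coefficients.\<close>
      have Wlim: "(\<lambda>n. W n i \<zeta>) \<longlonglongrightarrow> pairing (A i) (d \<zeta>)" if "\<zeta> \<in> cball 0 1" "i < k" for i \<zeta>
      proof -
        interpret bounded_linear "pairing (A i)" by (rule bounded_linear_pairing)
        have "pairing (A i) (\<Sum>j<k. W n j \<zeta> *s b j) = W n i \<zeta>" for n
        proof -
          have "pairing (A i) (\<Sum>j<k. W n j \<zeta> *s b j) = (\<Sum>j<k. W n j \<zeta> * pairing (A i) (b j))"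
            by (simp add: sum pairing_scale)
          also have "\<dots> = (\<Sum>j<k. if i = j then W n j \<zeta> else 0)"
            using AB[OF that(2)] by (intro sum.cong) (auto split: if_splits)
          also have "\<dots> = W n i \<zeta>" using that(2) by simp
          finally show ?thesis .
        qed
        then show ?thesis
          using tendsto[OF dlim[OF that(1)]] by (simp add: VW[OF that(1)])
      qed
      have dsum: "d \<zeta> = (\<Sum>j<k. pairing (A j) (d \<zeta>) *s b j)" if "\<zeta> \<in> cball 0 1" for \<zeta>
      proof (rule LIMSEQ_unique[OF dlim[OF that]])
        show "(\<lambda>n. V 1 (\<kappa> n) \<zeta> - V (-1) (\<kappa> n) \<zeta>) \<longlonglongrightarrow> (\<Sum>j<k. pairing (A j) (d \<zeta>) *s b j)"
          unfolding VW[OF that]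
          by (intro tendsto_sum bounded_linear.tendsto[OF bounded_linear_scale_vec] Wlim that) auto
      qed
      \<comment> \<open>The limit of the difference of the two Bishop equations. With e gone it is
        homogeneous: the coefficients of d solve a Schwarz problem whose data depend linearly on
        d.\<close>
      have dsol: "schwarz_solution (\<lambda>\<zeta>. - Dr j (f \<zeta>) (d \<zeta>)) (\<lambda>\<zeta>. pairing (A j) (d \<zeta>))" if j: "j < k" for j
        unfolding schwarz_solution_def
      proof (intro conjI ballI)
        have "continuous_on (cball 0 1) d"
          unfolding d_def using \<phi>disc by (intro continuous_intros) (auto simp: analytic_disc_def)
        then show "continuous_on (cball 0 1) (\<lambda>\<zeta>. pairing (A j) (d \<zeta>))"
          by (rule bounded_linear.continuous_on[OF bounded_linear_pairing])
        show "(\<lambda>\<zeta>. pairing (A j) (d \<zeta>)) holomorphic_on ball 0 1"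
          unfolding d_def pairing_def using \<phi>disc by (auto intro!: holomorphic_intros simp: analytic_disc_def)
        have sol: "schwarz_solution (rhs j (U ((\<sigma> * t n) *\<^sub>R e))) (Z ((\<sigma> * t n) *\<^sub>R e) j)" if "\<sigma> \<in> {1, -1}" for \<sigma> n
          by (rule Z[OF tsmall[OF that] j])
        have "Im (W n j 0) = 0" for n
          using sol[of 1 "\<kappa> n"] sol[of "-1" "\<kappa> n"] by (simp add: W_def schwarz_solution_def)
        then show "Im (pairing (A j) (d 0)) = 0"
          using tendsto_Im[OF Wlim[OF _ j, of 0]] by (simp add: LIMSEQ_const_iff)
        fix \<zeta> :: complex assume s: "\<zeta> \<in> sphere 0 1"
        then have \<zeta>: "\<zeta> \<in> cball 0 1" by simp
        have der: "(r j has_derivative Dr j (f \<zeta>)) (at (f \<zeta>))"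
          using f_in[OF s] \<delta> by (intro R j) auto
        interpret bounded_linear "Dr j (f \<zeta>)" by (rule has_derivative_bounded_linear[OF der])
        have quot: "(\<lambda>n. (1 / (\<sigma> * t (\<kappa> n))) *\<^sub>R (r j (f \<zeta> + (\<sigma> * t (\<kappa> n)) *\<^sub>R V \<sigma> (\<kappa> n) \<zeta>) - r j (f \<zeta>))) \<longlonglongrightarrow> Dr j (f \<zeta>) (\<phi> \<sigma> \<zeta>)"
          if "\<sigma> \<in> {1, -1}" for \<sigma>
        proof (rule directional_difference_quotient[OF der _ _ plim[OF that \<zeta>]])
          show "(\<lambda>n. \<sigma> * t (\<kappa> n)) \<longlonglongrightarrow> 0" by (rule tendsto_mult_right_zero[OF t\<kappa>])
          show "\<sigma> * t (\<kappa> n) \<noteq> 0" for n using that t[of "\<kappa> n"] by auto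
        qed
        have ReZ: "Re (Z ((\<sigma> * t n) *\<^sub>R e) j \<zeta>) = - (r j (f \<zeta> + (\<sigma> * t n) *\<^sub>R V \<sigma> n \<zeta>) - r j (f \<zeta>))"
          if "\<sigma> \<in> {1, -1}" for \<sigma> n
        proof -
          have "\<sigma> * t n \<noteq> 0" using that t[of n] by auto
          then show ?thesis
            using sol[OF that, of n] s by (simp add: schwarz_solution_def rhs_def V_def)
        qed
        have "Re (W n j \<zeta>) = - ((1 / (1 * t (\<kappa> n))) *\<^sub>R (r j (f \<zeta> + (1 * t (\<kappa> n)) *\<^sub>R V 1 (\<kappa> n) \<zeta>) - r j (f \<zeta>))) +
            (1 / (-1 * t (\<kappa> n))) *\<^sub>R (r j (f \<zeta> + (-1 * t (\<kappa> n)) *\<^sub>R V (-1) (\<kappa> n) \<zeta>) - r j (f \<zeta>))" for n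
          using ReZ[of 1 "\<kappa> n"] ReZ[of "-1" "\<kappa> n"] by (simp add: W_def diff_divide_distrib)
        then have "(\<lambda>n. Re (W n j \<zeta>)) \<longlonglongrightarrow> - Dr j (f \<zeta>) (\<phi> 1 \<zeta>) + Dr j (f \<zeta>) (\<phi> (-1) \<zeta>)"
          using tendsto_add[OF tendsto_minus[OF quot[of 1]] quot[of "-1"]] by simp
        then have "Re (pairing (A j) (d \<zeta>)) = - Dr j (f \<zeta>) (\<phi> 1 \<zeta>) + Dr j (f \<zeta>) (\<phi> (-1) \<zeta>)"
          using tendsto_Re[OF Wlim[OF \<zeta> j]] by (rule LIMSEQ_unique[rotated])
        then show "Re (pairing (A j) (d \<zeta>)) = - Dr j (f \<zeta>) (d \<zeta>)"
          by (simp add: d_def diff)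
      qed
      \<comment> \<open>The linear equation has Lipschitz constant \<open>M * \<delta> / 3\<close>,
        because 2L replaces the 6L in \<open>M\<close>. Any bound of d thus improves to half of it;
        starting from 4\<bar>e\<bar>, the sum of the bounds of the two limits, the iteration forces
        d = 0.\<close>
      have step: "holder_bound \<gamma> (cball 0 1) (K / 2) d" if K: "holder_bound \<gamma> (cball 0 1) K d" for K
      proof -
        have K0: "0 \<le> K"
          using order_trans[OF norm_ge_zero holder_bound_norm[OF K, of 0]] by simp
        have Ks: "holder_bound \<gamma> (sphere 0 1) K d"
          by (rule holder_bound_subset[OF K]) auto
        have "holder_bound \<gamma> (cball 0 1) (C * (2 * L * \<delta> * K)) (\<lambda>\<zeta>. pairing (A j) (d \<zeta>))" if j: "j < k" for j
        proof (rule sol_bd[OF _ dsol[OF j]])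
          have "holder_bound \<gamma> (sphere 0 1) (2 * L * \<delta> * K) (\<lambda>\<zeta>. Dr j (f \<zeta>) (d \<zeta>))"
            using \<delta> \<open>0 \<le> L\<close> by (intro holder_bound_derivative[OF R2[OF j] L2[OF j] q[OF j] _ _ f Ks]) auto
          then show "holder_bound \<gamma> (sphere 0 1) (2 * L * \<delta> * K) (\<lambda>\<zeta>. - Dr j (f \<zeta>) (d \<zeta>))"
            by (simp add: holder_bound_minus)
        qed
        then have "holder_bound \<gamma> (cball 0 1) (C * (2 * L * \<delta> * K) * Bn) (\<lambda>\<zeta>. \<Sum>j<k. pairing (A j) (d \<zeta>) *s b j)"
          by (rule sum_scale)
        then have "holder_bound \<gamma> (cball 0 1) (C * (2 * L * \<delta> * K) * Bn) d"
          by (rule iffD1[OF holder_bound_cong, rotated]) (use dsum in simp)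
        moreover have "C * (2 * L * \<delta> * K) * Bn \<le> K / 2"
        proof -
          have "C * (2 * L * \<delta> * K) * Bn = (M * \<delta>) * K / 3" by (simp add: M_def)
          also have "\<dots> \<le> (1/2) * K / 3" using M\<delta> m K0 by (intro divide_right_mono mult_right_mono) auto
          also have "\<dots> \<le> K / 2" using K0 by simp
          finally show ?thesis .
        qed
        ultimately show ?thesis by (rule holder_bound_mono)
      qed
      have "holder_bound \<gamma> (cball 0 1) (4 * norm e * (1/2) ^ n) d" for n
      proof (induction n)
        case 0
        have "holder_bound \<gamma> (cball 0 1) (2 * norm e) (\<phi> \<sigma>)" if "\<sigma> \<in> {1, -1}" for \<sigma>
          by (rule holder_bound_lim[OF Vbd[OF that] plim[OF that]])
        from holder_bound_sub[OF this[of 1] this[of "-1"]] show ?case by (simp add: d_def[abs_def])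
      next
        case (Suc n)
        from step[OF this] show ?case by simp
      qed
      then have "norm (d \<zeta>) \<le> 4 * norm e * (1/2) ^ n" for n
        using holder_bound_norm \<zeta> by blast
      moreover have "(\<lambda>n. 4 * norm e * (1/2) ^ n) \<longlonglongrightarrow> 0"
        by (intro tendsto_mult_right_zero LIMSEQ_power_zero) simp
      ultimately have "norm (d \<zeta>) \<le> 0"
        by (intro LIMSEQ_le_const) auto
      then show ?thesis by (simp add: d_def)
    qed
    show ?thesis
      unfolding bishop_variation_def
    proof (rule exI[of _ "\<lambda>n. t (\<kappa> n)"], rule exI[of _ "\<phi> 1"],
        rule exI[of _ "\<lambda>\<sigma> n. U ((\<sigma> * t (\<kappa> n)) *\<^sub>R e)"], intro conjI ballI allI)
      show "0 < t (\<kappa> n)" for n by (rule t)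
      show "(\<lambda>n. t (\<kappa> n)) \<longlonglongrightarrow> 0" by (rule t\<kappa>)
      show "analytic_disc (\<phi> 1)" by (rule \<phi>disc) simp
      show "norm (\<phi> 1 \<zeta> - e) \<le> \<eta> * norm e" if "\<zeta> \<in> cball 0 1" for \<zeta> using that by (intro \<phi>e) auto
      fix \<sigma> :: real assume \<sigma>: "\<sigma> \<in> {1, -1}"
      show "analytic_disc (U ((\<sigma> * t (\<kappa> n)) *\<^sub>R e))" for n by (rule Udisc[OF tsmall[OF \<sigma>]])
      show "(\<lambda>n. (1 / (\<sigma> * t (\<kappa> n))) *\<^sub>R U ((\<sigma> * t (\<kappa> n)) *\<^sub>R e) \<zeta>) \<longlonglongrightarrow> \<phi> 1 \<zeta>" if "\<zeta> \<in> cball 0 1" for \<zeta>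
        using plim[OF \<sigma> that] unique[OF that] \<sigma> by (auto simp: V_def)
      fix n and \<zeta> :: complex assume s: "\<zeta> \<in> sphere 0 1"
      then have \<zeta>: "\<zeta> \<in> cball 0 1" by simp
      show "norm (U ((\<sigma> * t (\<kappa> n)) *\<^sub>R e) \<zeta>) \<le> \<delta>"
        using holder_bound_norm[OF Ubd[OF tsmall[OF \<sigma>]] \<zeta>] tsmall[OF \<sigma>] order_trans by blast
      show "\<exists>c. U ((\<sigma> * t (\<kappa> n)) *\<^sub>R e) \<zeta> = (\<sigma> * t (\<kappa> n)) *\<^sub>R e + (\<Sum>j<k. c j *s b j) \<and>
          (\<forall>j<k. Re (c j) = r j (f \<zeta>) - r j (f \<zeta> + U ((\<sigma> * t (\<kappa> n)) *\<^sub>R e) \<zeta>))"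
        using U[OF tsmall[OF \<sigma>] \<zeta>] Z[OF tsmall[OF \<sigma>]] s
        by (intro exI[of _ "\<lambda>j. Z ((\<sigma> * t (\<kappa> n)) *\<^sub>R e) j \<zeta>"]) (simp add: schwarz_solution_def rhs_def)
    qed
  qed
  show ?thesis
    using \<delta> main by blast
qed

section \<open>Local defining functions\<close>

lemma norm_pairing_le: "norm (pairing a v) \<le> norm a * norm v"
proof -
  have "norm (pairing a v) \<le> (\<Sum>j\<in>UNIV. norm (a $ j) * norm (v $ j))"
    unfolding pairing_def by (rule order_trans[OF norm_sum]) (simp add: norm_mult)
  also have "\<dots> = (\<Sum>j\<in>UNIV. \<bar>norm (a $ j)\<bar> * \<bar>norm (v $ j)\<bar>)" by simp
  also have "\<dots> \<le> norm a * norm v"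
    unfolding norm_vec_def by (rule L2_set_mult_ineq)
  finally show ?thesis .
qed

lemma pairing_commute: "pairing a v = pairing v a"
  by (simp add: pairing_def mult.commute)

lemma pairing_axis: "pairing a (axis j c) = a $ j * c"
proof -
  have "pairing a (axis j c) = (\<Sum>i\<in>UNIV. if i = j then a $ j * c else 0)"
    unfolding pairing_def by (rule sum.cong) (auto simp: axis_def)
  then show ?thesis by simp
qed

text \<open>Independence allows linear functionals to be prescribed on the A_i. The vector b_j
  serves as the direction that corrects the j-th defining equation to first order without disturbing
  the others.\<close>

lemma dual_family:
  fixes A :: "nat \<Rightarrow> complex ^ 'n"
  assumes A: "\<And>c. (\<Sum>j<k. c j *s A j) = 0 \<Longrightarrow> \<forall>j<k. c j = (0::complex)"
  obtains b where "\<And>i j. i < k \<Longrightarrow> j < k \<Longrightarrow> pairing (A i) (b j) = (if i = j then 1 else 0)"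
proof -
  have inj: "inj_on A {..<k}"
  proof (rule inj_onI, rule ccontr)
    fix i j assume ij: "i \<in> {..<k}" "j \<in> {..<k}" "A i = A j" "i \<noteq> j"
    have "(\<Sum>l<k. (if l = i then 1 else if l = j then - 1 else 0) *s A l) =
        (\<Sum>l<k. (if l = i then A i else 0) - (if l = j then A i else 0))"
      using ij by (intro sum.cong) auto
    also have "\<dots> = 0" using ij by (simp add: sum_subtractf)
    finally show False using A ij by fastforce
  qed
  have ind: "vec.independent (A ` {..<k})"
  proof (rule vec.independent_if_scalars_zero)
    fix f x assume f: "(\<Sum>x\<in>A ` {..<k}. f x *s x) = 0" and "x \<in> A ` {..<k}"
    then obtain i where i: "i < k" "x = A i" by auto
    have "(\<Sum>j<k. f (A j) *s A j) = 0" using f by (simp add: sum.reindex[OF inj])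
    from A[OF this] i show "f x = 0" by auto
  qed simp
  have "\<exists>b. \<forall>i<k. pairing (A i) b = (if i = j then 1 else 0)" for j
  proof -
    \<comment> \<open>Any index will do: the extended map takes values along one coordinate axis,
      and the corresponding row of its matrix represents the functional.\<close>
    define m :: 'n where "m = undefined"
    obtain g where g: "Vector_Spaces.linear (*s) (*s) g"
      "\<forall>x\<in>A ` {..<k}. g x = (if x = A j \<and> j < k then axis m (1 :: complex) else 0)"
      using vec.linear_independent_extend[OF ind, of "\<lambda>x. if x = A j \<and> j < k then axis m 1 else 0"] by blast
    have "pairing (A i) (matrix g $ m) = (if i = j then 1 else 0)" if "i < k" for i
    proof -
      have "pairing (A i) (matrix g $ m) = (matrix g *v A i) $ m"
        by (simp add: pairing_def matrix_vector_mult_def mult.commute)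
      also have "\<dots> = g (A i) $ m" using matrix_works[OF g(1)] by simp
      also have "g (A i) = (if i = j then axis m 1 else 0)"
        using g(2) that inj by (auto simp: inj_on_def)
      finally show ?thesis by (simp add: axis_def)
    qed
    then show ?thesis by blast
  qed
  then show ?thesis using that by metis
qed

text \<open>Second derivatives are continuous, hence bounded on the compact ball.
  \<open>Ck_on\<close> provides them one pair of directions at a time, so both slots are expanded in
  the basis to obtain one constant.\<close>

lemma smooth_lipschitz_derivative:
  fixes \<rho> :: "'a::euclidean_space \<Rightarrow> real"
  assumes sm: "smooth_on U \<rho>" and sub: "cball q s \<subseteq> U"
  shows "\<exists>L\<ge>0. \<forall>x\<in>cball q s. \<forall>y\<in>cball q s. \<forall>v.
    norm (frechet_derivative \<rho> (at x) v - frechet_derivative \<rho> (at y) v) \<le> L * norm (x - y) * norm v"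
proof -
  define D where "D v x = frechet_derivative \<rho> (at x) v" for v x
  have "Ck_on (Suc (Suc 0)) U \<rho>" using sm unfolding smooth_on_def by blast
  then have diff: "\<And>x. x \<in> U \<Longrightarrow> \<rho> differentiable (at x)"
    and D1: "\<And>v x. x \<in> U \<Longrightarrow> D v differentiable (at x)"
    and D2: "\<And>v w. continuous_on U (\<lambda>x. frechet_derivative (D v) (at x) w)"
    by (auto simp: D_def[abs_def])
  have "\<exists>B. \<forall>x\<in>cball q s. norm (frechet_derivative (D v) (at x) w) \<le> B" for v w
  proof -
    have "compact ((\<lambda>x. frechet_derivative (D v) (at x) w) ` cball q s)"
      by (intro compact_continuous_image continuous_on_subset[OF D2 sub]) simp
    then show ?thesis by (auto dest!: compact_imp_bounded simp: bounded_iff)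
  qed
  then obtain B where B: "\<And>v w x. x \<in> cball q s \<Longrightarrow> norm (frechet_derivative (D v) (at x) w) \<le> B v w"
    by metis
  have lip: "norm (D v x - D v y) \<le> (\<Sum>w\<in>Basis. \<bar>B v w\<bar>) * norm (x - y)"
    if "x \<in> cball q s" "y \<in> cball q s" for v x y
  proof (rule differentiable_bound[OF convex_cball _ _ that])
    fix z assume z: "z \<in> cball q s"
    then have h: "(D v has_derivative frechet_derivative (D v) (at z)) (at z)"
      using D1 sub frechet_derivative_works by blast
    then show "(D v has_derivative frechet_derivative (D v) (at z)) (at z within cball q s)"
      by (rule has_derivative_at_withinI)
    interpret bounded_linear "frechet_derivative (D v) (at z)" by (rule has_derivative_bounded_linear[OF h])
    show "onorm (frechet_derivative (D v) (at z)) \<le> (\<Sum>w\<in>Basis. \<bar>B v w\<bar>)"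
    proof (rule onorm_le)
      fix w :: 'a
      have "frechet_derivative (D v) (at z) w = frechet_derivative (D v) (at z) (\<Sum>u\<in>Basis. (w \<bullet> u) *\<^sub>R u)"
        by (simp add: euclidean_representation)
      also have "\<dots> = (\<Sum>u\<in>Basis. (w \<bullet> u) *\<^sub>R frechet_derivative (D v) (at z) u)"
        by (simp add: sum scaleR)
      finally have "norm (frechet_derivative (D v) (at z) w) \<le> (\<Sum>u\<in>Basis. norm ((w \<bullet> u) *\<^sub>R frechet_derivative (D v) (at z) u))"
        by (simp only: norm_sum)
      also have "\<dots> \<le> (\<Sum>u\<in>Basis. norm w * \<bar>B v u\<bar>)"
      proof (rule sum_mono)
        fix u :: 'a assume u: "u \<in> Basis"
        have "\<bar>w \<bullet> u\<bar> \<le> norm w" using u by (rule Basis_le_norm)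
        moreover have "norm (frechet_derivative (D v) (at z) u) \<le> \<bar>B v u\<bar>"
          using B[OF z, of v u] by linarith
        ultimately show "norm ((w \<bullet> u) *\<^sub>R frechet_derivative (D v) (at z) u) \<le> norm w * \<bar>B v u\<bar>"
          by (simp add: mult_mono abs_mult)
      qed
      finally show "norm (frechet_derivative (D v) (at z) w) \<le> (\<Sum>w\<in>Basis. \<bar>B v w\<bar>) * norm w"
        by (simp add: sum_distrib_left sum_distrib_right mult.commute)
    qed
  qed
  define L where "L = (\<Sum>u\<in>Basis. \<Sum>w\<in>Basis. \<bar>B u w\<bar>)"
  have L0: "0 \<le> L" by (simp add: L_def sum_nonneg)
  have "norm (frechet_derivative \<rho> (at x) v - frechet_derivative \<rho> (at y) v) \<le> L * norm (x - y) * norm v"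
    if xy: "x \<in> cball q s" "y \<in> cball q s" for x y v
  proof -
    have rep: "frechet_derivative \<rho> (at z) v = (\<Sum>u\<in>Basis. (v \<bullet> u) *\<^sub>R D u z)" if "z \<in> cball q s" for z
    proof -
      have h: "(\<rho> has_derivative frechet_derivative \<rho> (at z)) (at z)"
        using diff sub that frechet_derivative_works by blast
      interpret bounded_linear "frechet_derivative \<rho> (at z)" by (rule has_derivative_bounded_linear[OF h])
      have "frechet_derivative \<rho> (at z) v = frechet_derivative \<rho> (at z) (\<Sum>u\<in>Basis. (v \<bullet> u) *\<^sub>R u)"
        by (simp add: euclidean_representation)
      also have "\<dots> = (\<Sum>u\<in>Basis. (v \<bullet> u) *\<^sub>R D u z)"
        by (simp add: sum scaleR D_def)
      finally show ?thesis .
    qed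
    have "frechet_derivative \<rho> (at x) v - frechet_derivative \<rho> (at y) v = (\<Sum>u\<in>Basis. (v \<bullet> u) *\<^sub>R (D u x - D u y))"
      unfolding rep[OF xy(1)] rep[OF xy(2)] by (simp only: scaleR_diff_right sum_subtractf)
    then have "norm (frechet_derivative \<rho> (at x) v - frechet_derivative \<rho> (at y) v) \<le> (\<Sum>u\<in>Basis. norm ((v \<bullet> u) *\<^sub>R (D u x - D u y)))"
      by (simp only: norm_sum)
    also have "\<dots> \<le> (\<Sum>u\<in>Basis. norm v * ((\<Sum>w\<in>Basis. \<bar>B u w\<bar>) * norm (x - y)))"
    proof (rule sum_mono)
      fix u :: 'a assume u: "u \<in> Basis"
      show "norm ((v \<bullet> u) *\<^sub>R (D u x - D u y)) \<le> norm v * ((\<Sum>w\<in>Basis. \<bar>B u w\<bar>) * norm (x - y))"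
        unfolding norm_scaleR by (intro mult_mono lip xy Basis_le_norm u) auto
    qed
    also have "\<dots> = L * norm (x - y) * norm v"
      by (simp add: L_def sum_distrib_left sum_distrib_right mult_ac)
    finally show ?thesis .
  qed
  with L0 show ?thesis by blast
qed

text \<open>For a real function the differential is the sum of the (1,0)-form and its conjugate,
  hence the factor 2.\<close>

lemma Re_pairing_del:
  assumes "(\<rho> has_derivative frechet_derivative \<rho> (at z)) (at z)"
  shows "Re (pairing (2 *s del \<rho> z) v) = frechet_derivative \<rho> (at z) v"
proof -
  interpret bounded_linear "frechet_derivative \<rho> (at z)" by (rule has_derivative_bounded_linear[OF assms])
  have "v = (\<Sum>j\<in>UNIV. Re (v $ j) *\<^sub>R axis j 1 + Im (v $ j) *\<^sub>R axis j \<i>)"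
  proof -
    have "(\<Sum>j\<in>UNIV. Re (v $ j) *\<^sub>R axis j 1 + Im (v $ j) *\<^sub>R axis j \<i>) $ i = v $ i" for i
    proof -
      have "(\<Sum>j\<in>UNIV. Re (v $ j) *\<^sub>R axis j 1 + Im (v $ j) *\<^sub>R axis j \<i>) $ i =
          (\<Sum>j\<in>UNIV. if j = i then v $ i else 0)"
        unfolding sum_component by (rule sum.cong) (auto simp: axis_def complex_eq_iff)
      then show ?thesis by simp
    qed
    then show ?thesis by (simp add: vec_eq_iff)
  qed
  then have "frechet_derivative \<rho> (at z) v =
      frechet_derivative \<rho> (at z) (\<Sum>j\<in>UNIV. Re (v $ j) *\<^sub>R axis j 1 + Im (v $ j) *\<^sub>R axis j \<i>)"
    by simp
  also have "\<dots> = (\<Sum>j\<in>UNIV. Re (v $ j) * frechet_derivative \<rho> (at z) (axis j 1) + Im (v $ j) * frechet_derivative \<rho> (at z) (axis j \<i>))"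
    by (simp add: sum add scaleR)
  also have "\<dots> = Re (pairing (2 *s del \<rho> z) v)"
    unfolding pairing_def del_def Re_sum by (rule sum.cong) (auto simp: algebra_simps)
  finally show ?thesis by simp
qed

text \<open>Genericity enters here: complex independence of the forms at q, and not merely real
  independence of the differentials, is what yields vectors b_j dual to the A_j under the complex
  pairing.\<close>

lemma generic_manifold_local:
  fixes M V :: "(complex ^ 'n) set"
  assumes "generic_manifold M" "q \<in> M" "open V" "q \<in> V"
  obtains k \<rho> s L A b where "0 < s" "0 \<le> L" "cball q s \<subseteq> V"
    "\<And>z. z \<in> cball q s \<Longrightarrow> z \<in> M \<longleftrightarrow> (\<forall>j<(k::nat). \<rho> j z = (0::real))"
    "\<And>j x. j < k \<Longrightarrow> x \<in> cball q s \<Longrightarrow> (\<rho> j has_derivative frechet_derivative (\<rho> j) (at x)) (at x)"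
    "\<And>j x y v. j < k \<Longrightarrow> x \<in> cball q s \<Longrightarrow> y \<in> cball q s \<Longrightarrow>
        norm (frechet_derivative (\<rho> j) (at x) v - frechet_derivative (\<rho> j) (at y) v) \<le> L * norm (x - y) * norm v"
    "\<And>j v. j < k \<Longrightarrow> frechet_derivative (\<rho> j) (at q) v = Re (pairing (A j) v)"
    "\<And>i j. i < k \<Longrightarrow> j < k \<Longrightarrow> pairing (A i) (b j) = (if i = j then 1 else 0)"
proof -
  obtain k U \<rho> where U: "open U" "q \<in> U" and sm: "\<forall>j<(k::nat). smooth_on U (\<rho> j)"
    and M: "M \<inter> U = {z \<in> U. \<forall>j<k. \<rho> j z = (0::real)}"
    and ind: "\<forall>z\<in>M \<inter> U. \<forall>c::nat \<Rightarrow> complex. (\<Sum>j<k. c j *s del (\<rho> j) z) = 0 \<longrightarrow> (\<forall>j<k. c j = 0)"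
    using assms(1,2) unfolding generic_manifold_def by blast
  have "open (U \<inter> V)" "q \<in> U \<inter> V" using U assms by auto
  then obtain s where s: "0 < s" "cball q s \<subseteq> U \<inter> V" using open_contains_cball by blast
  have "\<exists>L\<ge>0. \<forall>x\<in>cball q s. \<forall>y\<in>cball q s. \<forall>v.
    norm (frechet_derivative (\<rho> j) (at x) v - frechet_derivative (\<rho> j) (at y) v) \<le> L * norm (x - y) * norm v" if "j < k" for j
    using smooth_lipschitz_derivative[of U "\<rho> j" q s] sm s(2) that by blast
  then obtain L where L: "\<And>j. j < k \<Longrightarrow> 0 \<le> L j"
    "\<And>j x y v. j < k \<Longrightarrow> x \<in> cball q s \<Longrightarrow> y \<in> cball q s \<Longrightarrow>
      norm (frechet_derivative (\<rho> j) (at x) v - frechet_derivative (\<rho> j) (at y) v) \<le> L j * norm (x - y) * norm v"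
    by metis
  have der: "(\<rho> j has_derivative frechet_derivative (\<rho> j) (at x)) (at x)" if "j < k" "x \<in> cball q s" for j x
  proof -
    have "Ck_on (Suc 0) U (\<rho> j)" using sm that unfolding smooth_on_def by blast
    then have "\<rho> j differentiable (at x)" using that s by auto
    then show ?thesis using frechet_derivative_works by blast
  qed
  define A where "A j = 2 *s del (\<rho> j) q" for j
  obtain b where b: "\<And>i j. i < k \<Longrightarrow> j < k \<Longrightarrow> pairing (A i) (b j) = (if i = j then 1 else 0)"
  proof (rule dual_family[of A k])
    fix c assume "(\<Sum>j<k. c j *s A j) = 0"
    then have "(\<Sum>j<k. (c j * 2) *s del (\<rho> j) q) = 0"
      by (simp add: A_def vector_smult_assoc)
    then show "\<forall>j<k. c j = 0"
      using ind[rule_format, of q "\<lambda>j. c j * 2"] U(2) assms(2) by simp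
  qed blast
  show ?thesis
  proof (rule that[where s = s and L = "\<Sum>j<k. L j" and k = k and \<rho> = \<rho> and A = A and b = b])
    show "0 < s" by fact
    show "0 \<le> (\<Sum>j<k. L j)" using L(1) by (intro sum_nonneg) auto
    show "cball q s \<subseteq> V" using s by blast
    show "z \<in> M \<longleftrightarrow> (\<forall>j<k. \<rho> j z = 0)" if "z \<in> cball q s" for z
      using M that s(2) by blast
    show "(\<rho> j has_derivative frechet_derivative (\<rho> j) (at x)) (at x)" if "j < k" "x \<in> cball q s" for j x
      by (rule der[OF that])
    show "norm (frechet_derivative (\<rho> j) (at x) v - frechet_derivative (\<rho> j) (at y) v) \<le> (\<Sum>j<k. L j) * norm (x - y) * norm v"
      if "j < k" "x \<in> cball q s" "y \<in> cball q s" for j x y v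
    proof -
      have "L j \<le> (\<Sum>j<k. L j)" using that L(1) by (intro member_le_sum) auto
      then have "L j * norm (x - y) * norm v \<le> (\<Sum>j<k. L j) * norm (x - y) * norm v"
        by (intro mult_right_mono) auto
      with L(2)[OF that, of v] show ?thesis by (rule order_trans)
    qed
    show "frechet_derivative (\<rho> j) (at q) v = Re (pairing (A j) v)" if "j < k" for j v
      unfolding A_def using Re_pairing_del[OF der[OF that, of q], of v] s(1) by simp
    show "pairing (A i) (b j) = (if i = j then 1 else 0)" if "i < k" "j < k" for i j
      by (rule b[OF that])
  qed
qed

text \<open>Differentiate \<rho> along a curve in \<open>M\<close>. This inclusion suffices for
  conormality: a covector whose real part vanishes on the common kernel of the differentials is
  conormal.\<close>

lemma tangent_space_kernel:
  assumes X: "X \<in> tangent_space M z" and W: "open W" "z \<in> W" "\<And>w. w \<in> M \<inter> W \<Longrightarrow> \<rho> w = (0::real)"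
    and der: "(\<rho> has_derivative D) (at z)"
  shows "D X = 0"
proof -
  obtain \<gamma> e where e: "0 < e" and \<gamma>: "\<gamma> ` {-e<..<e} \<subseteq> M" "\<gamma> (0::real) = z" "(\<gamma> has_vector_derivative X) (at 0)"
    using X unfolding tangent_space_def by blast
  have "continuous (at 0) \<gamma>" using \<gamma>(3) by (rule has_vector_derivative_continuous)
  then have "\<forall>\<^sub>F t in at 0. \<gamma> t \<in> W"
    using W \<gamma>(2) by (auto simp: continuous_at topological_tendstoD)
  moreover have "\<forall>\<^sub>F t in at (0::real). t \<in> {-e<..<e}"
    using e by (intro eventually_at_in_open') auto
  ultimately have ev: "\<forall>\<^sub>F t in at 0. \<rho> (\<gamma> t) = 0"
    by eventually_elim (use W \<gamma> in blast)
  have z0: "\<rho> (\<gamma> 0) = 0"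
  proof -
    have "\<gamma> 0 \<in> M" using \<gamma>(1) e by (auto simp: image_subset_iff)
    then show ?thesis using W \<gamma>(2) by simp
  qed
  have dd: "((\<lambda>t. \<rho> (\<gamma> t)) has_derivative (\<lambda>h. D (h *\<^sub>R X))) (at 0)"
  proof (rule has_derivative_compose[of \<gamma> "\<lambda>h. h *\<^sub>R X" 0 UNIV \<rho> D])
    show "(\<gamma> has_derivative (\<lambda>h. h *\<^sub>R X)) (at 0)"
      using \<gamma>(3) by (simp add: has_vector_derivative_def)
    show "(\<rho> has_derivative D) (at (\<gamma> 0))" using der \<gamma>(2) by simp
  qed
  have "((\<lambda>t. 0) has_derivative (\<lambda>h. D (h *\<^sub>R X))) (at (0::real))"
    by (rule has_derivative_transform_eventually[OF dd ev z0 UNIV_I])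
  from fun_cong[OF has_derivative_unique[OF this has_derivative_const], of 1] show ?thesis by simp
qed

section \<open>Continuous extension of solutions of linear systems\<close>

lemma continuous_on_det:
  fixes T :: "'a::topological_space \<Rightarrow> complex ^ 'n ^ 'n"
  assumes "\<And>i j. continuous_on S (\<lambda>x. T x $ i $ j)"
  shows "continuous_on S (\<lambda>x. det (T x))"
  unfolding det_def by (intro continuous_intros assms)

text \<open>A matrix with rows near the standard basis is invertible: a kernel vector satisfies
  \<bar>x\<bar> \<le> c N \<bar>x\<bar> with N the dimension and c N < 1. Cramer's rule then solves
  the system continuously wherever the matrix and the right-hand side are continuous, beyond the set
  where \<open>g\<close> itself is controlled.\<close>

lemma pairing_system_extension:
  fixes \<Phi> :: "'n \<Rightarrow> complex \<Rightarrow> complex ^ 'n" and g :: "complex \<Rightarrow> complex ^ 'n"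
  assumes \<Phi>: "\<And>m. continuous_on S (\<Phi> m)" and near: "\<And>m \<zeta>. \<zeta> \<in> S \<Longrightarrow> norm (\<Phi> m \<zeta> - axis m 1) \<le> c"
    and c: "c * real CARD('n) < 1"
    and \<sigma>: "\<And>m. continuous_on S (\<sigma> m)" and eq: "\<And>m \<zeta>. \<zeta> \<in> S' \<Longrightarrow> pairing (\<Phi> m \<zeta>) (g \<zeta>) = \<sigma> m \<zeta>" and "S' \<subseteq> S"
  obtains G where "continuous_on S G" "\<And>\<zeta>. \<zeta> \<in> S' \<Longrightarrow> G \<zeta> = g \<zeta>"
proof -
  define T where "T \<zeta> = (\<chi> m. \<Phi> m \<zeta>)" for \<zeta>
  have T: "T \<zeta> *v x = (\<chi> m. pairing (\<Phi> m \<zeta>) x)" for \<zeta> x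
    by (simp add: T_def matrix_vector_mult_def pairing_def)
  have det: "det (T \<zeta>) \<noteq> 0" if \<zeta>: "\<zeta> \<in> S" for \<zeta>
  proof -
    have "x = 0" if x: "T \<zeta> *v x = 0" for x
    proof -
      have "norm (x $ m) \<le> c * norm x" for m
      proof -
        have "pairing (\<Phi> m \<zeta>) x = 0" using x by (simp add: T vec_eq_iff)
        then have "x $ m = - pairing (\<Phi> m \<zeta> - axis m 1) x"
          by (simp add: bounded_linear.linear[OF bounded_linear_pairing] linear_diff pairing_commute[of _ x] pairing_axis)
        then have "norm (x $ m) \<le> norm (\<Phi> m \<zeta> - axis m 1) * norm x"
          using norm_pairing_le by simp
        also have "\<dots> \<le> c * norm x" using near[OF \<zeta>] by (rule mult_right_mono) simp
        finally show ?thesis .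
      qed
      then have "(\<Sum>m\<in>UNIV. norm (x $ m)) \<le> (\<Sum>m\<in>(UNIV :: 'n set). c * norm x)" by (intro sum_mono)
      then have "norm x \<le> c * real CARD('n) * norm x"
        using norm_vec_le_sum[of x] by (simp add: mult_ac)
      then have "norm x * (1 - c * real CARD('n)) \<le> 0" by (simp add: algebra_simps)
      then show "x = 0" using c by (simp add: mult_le_0_iff)
    qed
    then have "inj ((*v) (T \<zeta>))"
      by (intro injI) (metis eq_iff_diff_eq_0 matrix_vector_mult_diff_distrib)
    then have "invertible (T \<zeta>)"
      using matrix_left_invertible_injective invertible_left_inverse by blast
    then show ?thesis by (simp add: invertible_det_nz)
  qed
  define G where "G \<zeta> = (\<chi> k. det (\<chi> i j. if j = k then \<sigma> i \<zeta> else T \<zeta> $ i $ j) / det (T \<zeta>))" for \<zeta>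
  have Tc: "continuous_on S (\<lambda>\<zeta>. T \<zeta> $ i $ j)" for i j
    unfolding T_def using \<Phi> by (simp add: continuous_on_component)
  show ?thesis
  proof (rule that[of G])
    have "continuous_on S (\<lambda>\<zeta>. (\<chi> i j. if j = k then \<sigma> i \<zeta> else T \<zeta> $ i $ j) $ i $ j)" for i j k
      using Tc \<sigma> by (cases "j = k") auto
    then show "continuous_on S G"
      unfolding G_def using det by (intro continuous_on_vec_lambda continuous_on_divide continuous_on_det Tc) auto
    show "G \<zeta> = g \<zeta>" if "\<zeta> \<in> S'" for \<zeta>
    proof -
      have "T \<zeta> *v g \<zeta> = (\<chi> i. \<sigma> i \<zeta>)" using eq[OF that] by (simp add: T)
      moreover have "det (T \<zeta>) \<noteq> 0" using det that \<open>S' \<subseteq> S\<close> by blast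
      ultimately show ?thesis by (simp add: cramer G_def cong: if_cong)
    qed
  qed
qed

section \<open>Discs, hulls and the variation of a supporting lift\<close>

text \<open>The maximum principle is applied to each component. The loss of the dimension as a
  factor is harmless, as it is used for zero bounds and for arbitrarily small ones.\<close>

lemma disc_norm_le:
  assumes "analytic_disc f" "\<And>\<zeta>. \<zeta> \<in> sphere 0 1 \<Longrightarrow> norm (f \<zeta>) \<le> B" "\<zeta> \<in> cball 0 1"
  shows "norm (f \<zeta> :: complex ^ 'n) \<le> real CARD('n) * B"
proof -
  have "norm (f \<zeta> $ i) \<le> B" for i
  proof (rule maximum_modulus_frontier[of "\<lambda>\<zeta>. f \<zeta> $ i" "cball 0 1"])
    show "(\<lambda>\<zeta>. f \<zeta> $ i) holomorphic_on interior (cball 0 1)"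
      using assms(1) by (simp add: analytic_disc_def)
    show "continuous_on (closure (cball 0 1)) (\<lambda>\<zeta>. f \<zeta> $ i)"
      using assms(1) by (simp add: analytic_disc_def continuous_on_component)
    show "norm (f z $ i) \<le> B" if "z \<in> frontier (cball 0 1)" for z
      using assms(2)[of z] that order_trans[OF Finite_Cartesian_Product.norm_nth_le] by auto
  qed (use assms(3) in auto)
  then have "(\<Sum>i\<in>UNIV. norm (f \<zeta> $ i)) \<le> (\<Sum>i\<in>(UNIV :: 'n set). B)" by (intro sum_mono)
  then show ?thesis using norm_vec_le_sum[of "f \<zeta>"] by simp
qed

lemma analytic_disc_diff:
  "analytic_disc f \<Longrightarrow> analytic_disc g \<Longrightarrow> analytic_disc (\<lambda>\<zeta>. f \<zeta> - g \<zeta>)"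
  by (auto simp: analytic_disc_def intro!: continuous_intros holomorphic_intros)

lemma analytic_disc_add:
  "analytic_disc f \<Longrightarrow> analytic_disc g \<Longrightarrow> analytic_disc (\<lambda>\<zeta>. f \<zeta> + g \<zeta>)"
  by (auto simp: analytic_disc_def intro!: continuous_intros holomorphic_intros)

lemma analytic_disc_eqI:
  fixes f g :: "complex \<Rightarrow> complex ^ 'n"
  assumes "analytic_disc f" "analytic_disc g" "\<And>\<zeta>. \<zeta> \<in> sphere 0 1 \<Longrightarrow> f \<zeta> = g \<zeta>" "\<zeta> \<in> cball 0 1"
  shows "f \<zeta> = g \<zeta>"
  using disc_norm_le[OF analytic_disc_diff[OF assms(1,2)], of 0 \<zeta>] assms(3,4) by simp

lemma holo_polynomial_map_continuous:
  fixes P :: "complex ^ 'n \<Rightarrow> complex ^ 'm"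
  assumes "holo_polynomial_map P"
  shows "continuous_on S P"
proof -
  have "continuous_on S (\<lambda>z. P z $ i)" for i
  proof -
    obtain D where "holo_derivative (\<lambda>z. P z $ i) D"
      using assms holo_polynomial_derivative unfolding holo_polynomial_map_def by metis
    then have "\<And>z. isCont (\<lambda>z. P z $ i) z"
      using has_derivative_continuous unfolding holo_derivative_def by blast
    then show ?thesis by (simp add: continuous_at_imp_continuous_on)
  qed
  then have "continuous_on S (\<lambda>z. \<chi> i. P z $ i)" by (rule continuous_on_vec_lambda)
  then show ?thesis by simp
qed

lemma holo_polynomial_map_disc:
  fixes P :: "complex ^ 'n \<Rightarrow> complex ^ 'm"
  assumes P: "holo_polynomial_map P" and f: "analytic_disc f"
  shows "analytic_disc (\<lambda>\<zeta>. P (f \<zeta>))"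
  unfolding analytic_disc_def
proof (intro conjI allI)
  show "continuous_on (cball 0 1) (\<lambda>\<zeta>. P (f \<zeta>))"
    using f by (intro continuous_on_compose2[OF holo_polynomial_map_continuous[OF P, of UNIV]]) (auto simp: analytic_disc_def)
  fix i
  obtain D where D: "holo_derivative (\<lambda>z. P z $ i) D"
    using P holo_polynomial_derivative unfolding holo_polynomial_map_def by metis
  then show "(\<lambda>\<zeta>. P (f \<zeta>) $ i) holomorphic_on ball 0 1"
    using f unfolding holo_derivative_def analytic_disc_def by blast
qed

text \<open>By the maximum principle on each attached disc, a uniform Cauchy condition on
  \<open>S\<close> spreads to the hull. This provides the extension of the inverse map, for which
  only approximation on the manifold is given.\<close>

lemma disc_extension_exists:
  fixes P :: "nat \<Rightarrow> complex ^ 'n \<Rightarrow> complex ^ 'm"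
  assumes P: "\<And>n. holo_polynomial_map (P n)" and lim: "uniform_limit S P F sequentially"
  obtains E where "uniform_limit (disc_hull S) P E sequentially"
proof -
  have "uniformly_Cauchy_on S P"
    using lim uniformly_convergent_Cauchy by (auto simp: uniformly_convergent_on_def)
  have "uniformly_Cauchy_on (disc_hull S) P"
    unfolding uniformly_Cauchy_on_def
  proof (intro allI impI)
    fix e :: real assume "0 < e"
    then have "0 < e / (2 * real CARD('m))" by simp
    then obtain N where N: "\<And>x m n. x \<in> S \<Longrightarrow> m \<ge> N \<Longrightarrow> n \<ge> N \<Longrightarrow> dist (P m x) (P n x) < e / (2 * real CARD('m))"
      using \<open>uniformly_Cauchy_on S P\<close> unfolding uniformly_Cauchy_on_def by meson
    have "dist (P m x) (P n x) < e" if x: "x \<in> disc_hull S" and mn: "m \<ge> N" "n \<ge> N" for x m n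
    proof -
      obtain g \<zeta> where g: "attached_disc S g" "\<zeta> \<in> cball 0 1" "x = g \<zeta>"
        using x by (auto simp: disc_hull_def)
      have "norm (P m (g \<zeta>) - P n (g \<zeta>)) \<le> real CARD('m) * (e / (2 * real CARD('m)))"
      proof (rule disc_norm_le[OF analytic_disc_diff[OF holo_polynomial_map_disc[OF P] holo_polynomial_map_disc[OF P]]])
        show "norm (P m (g \<tau>) - P n (g \<tau>)) \<le> e / (2 * real CARD('m))" if "\<tau> \<in> sphere 0 1" for \<tau>
        proof -
          have "g \<tau> \<in> S" using g(1) that unfolding attached_disc_def by blast
          then show ?thesis using N[of "g \<tau>" m n] mn by (simp add: dist_norm less_imp_le)
        qed
      qed (use g in \<open>auto simp: attached_disc_def\<close>)
      also have "\<dots> < e" using \<open>0 < e\<close> by simp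
      finally show ?thesis by (simp add: g dist_norm)
    qed
    then show "\<exists>M. \<forall>x\<in>disc_hull S. \<forall>m\<ge>M. \<forall>n\<ge>M. dist (P m x) (P n x) < e" by blast
  qed
  then show ?thesis
    using that Cauchy_uniformly_convergent by (auto simp: uniformly_convergent_on_def)
qed

lemma subset_disc_hull: "S \<subseteq> disc_hull S"
proof
  fix x assume "x \<in> S"
  then have "attached_disc S (\<lambda>_. x)"
    by (auto simp: attached_disc_def analytic_disc_def)
  moreover have "x \<in> (\<lambda>_. x) ` cball (0::complex) 1"
    by (rule image_eqI[of _ _ 0]) auto
  ultimately show "x \<in> disc_hull S" unfolding disc_hull_def by blast
qed

lemma disc_extension_eq:
  assumes "uniform_limit S P F sequentially" "uniform_limit (disc_hull S) P E sequentially" "x \<in> S"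
  shows "E x = F x"
  by (meson LIMSEQ_unique assms subset_disc_hull subsetD tendsto_uniform_limitI)

lemma disc_extension_disc:
  assumes "\<And>n. holo_polynomial_map (P n)" "uniform_limit (disc_hull S) P E sequentially" "attached_disc S g"
  shows "analytic_disc (\<lambda>\<zeta>. E (g \<zeta>))"
proof (rule analytic_disc_uniform_limit)
  show "analytic_disc (\<lambda>\<zeta>. P n (g \<zeta>))" for n
    using assms(3) by (intro holo_polynomial_map_disc[OF assms(1)]) (simp add: attached_disc_def)
  have "g ` cball 0 1 \<subseteq> disc_hull S" using assms(3) by (auto simp: disc_hull_def)
  then show "uniform_limit (cball 0 1) (\<lambda>n \<zeta>. P n (g \<zeta>)) (\<lambda>\<zeta>. E (g \<zeta>)) sequentially"
    using assms(2) unfolding uniform_limit_iff by (fast elim: eventually_mono)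
qed

section \<open>Compensation of the pole and the variation of a supporting lift\<close>

lemma cball_split: "cball (0::complex) 1 = cball 0 (1/2) \<union> (cball 0 1 - ball 0 (1/2))"
  by auto

text \<open>For functions with a removable singularity at 0: holomorphy gives continuity near 0, an
  explicit formula gives it away from 0.\<close>

lemma continuous_on_cball_split:
  assumes "continuous_on (cball 0 (1/2)) f" "continuous_on (cball 0 1 - {0 :: complex}) f"
  shows "continuous_on (cball 0 1) f"
proof (subst cball_split, rule continuous_on_closed_Un)
  show "closed (cball (0::complex) 1 - ball 0 (1 / 2))" by (intro closed_Diff) auto
  show "continuous_on (cball 0 1 - ball 0 (1/2)) f"
    by (rule continuous_on_subset[OF assms(2)]) auto
qed (use assms in auto)

text \<open>Subtracting m(0)/\<zeta> removes the pole of m/\<zeta>. On the circle 1/\<zeta> is the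
  conjugate of \<zeta>, so adding \<open>cnj (m 0) * \<zeta>\<close> makes the total change
  imaginary there: the boundary inequality is kept and the maximum principle applies.\<close>

lemma Re_difference_quotient_nonneg:
  assumes m: "continuous_on (cball 0 1) m" "m holomorphic_on ball 0 1"
    and pos: "\<And>\<zeta>. \<zeta> \<in> sphere 0 1 \<Longrightarrow> 0 \<le> Re (m \<zeta> / \<zeta>)" and \<zeta>: "\<zeta> \<in> ball 0 1 - {0}"
  shows "0 \<le> Re ((m \<zeta> - m 0) / \<zeta> + cnj (m 0) * \<zeta>)"
proof -
  define h where "h z = (if z = 0 then deriv m 0 else (m z - m 0) / (z - 0))" for z
  have h: "h holomorphic_on ball 0 1"
    unfolding h_def by (rule pole_lemma[OF m(2)]) simp
  have hc: "continuous_on (cball 0 1) h"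
  proof (rule continuous_on_cball_split)
    show "continuous_on (cball 0 (1/2)) h"
      by (rule continuous_on_subset[OF holomorphic_on_imp_continuous_on[OF h]]) auto
    have "continuous_on (cball 0 1 - {0}) (\<lambda>z. (m z - m 0) / (z - 0))"
      by (intro continuous_intros continuous_on_subset[OF m(1)]) auto
    then show "continuous_on (cball 0 1 - {0}) h"
      by (subst continuous_on_cong[OF refl]) (auto simp: h_def)
  qed
  define k where "k z = - h z - cnj (m 0) * z" for z
  have "Re (k \<zeta>) \<le> 0"
  proof (rule disc_Re_le[of k 0 \<zeta>])
    show "continuous_on (cball 0 1) k" unfolding k_def[abs_def] by (intro continuous_intros hc)
    show "k holomorphic_on ball 0 1" unfolding k_def[abs_def] by (intro holomorphic_intros h)
    show "\<zeta> \<in> cball 0 1" using \<zeta> by auto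
    fix z :: complex assume z: "z \<in> sphere 0 1"
    then have z0: "z \<noteq> 0" and zz: "1 / z = cnj z"
      using complex_div_cnj[of 1 z] by auto
    have "k z = - (m z / z) + m 0 * (1 / z) - cnj (m 0) * z"
      using z0 by (simp add: k_def h_def diff_divide_distrib)
    also have "\<dots> = - (m z / z) + (m 0 * cnj z - cnj (m 0 * cnj z))" by (simp add: zz)
    finally have "Re (k z) = - Re (m z / z)" by simp
    then show "Re (k z) \<le> 0" using pos[OF z] by simp
  qed
  then show ?thesis using \<zeta> by (simp add: k_def h_def)
qed

text \<open>The expression is holomorphic in the punctured disc with zero real part, hence an
  imaginary constant; multiplication by \<zeta> gives the formula.\<close>

lemma quadratic_if_Re_zero:
  assumes m: "m holomorphic_on ball 0 1"
    and Re0: "\<And>\<zeta>. \<zeta> \<in> ball 0 1 - {0} \<Longrightarrow> Re ((m \<zeta> - m 0) / \<zeta> + cnj (m 0) * \<zeta>) = 0"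
  shows "\<exists>b::real. \<forall>\<zeta>\<in>ball 0 1. m \<zeta> = m 0 + \<i> * b * \<zeta> - cnj (m 0) * \<zeta>\<^sup>2"
proof -
  define k where "k \<zeta> = (m \<zeta> - m 0) / \<zeta> + cnj (m 0) * \<zeta>" for \<zeta>
  have "k constant_on ball 0 1 - {0}"
  proof (rule holomorphic_Re_zero_constant)
    show "k holomorphic_on ball 0 1 - {0}"
      unfolding k_def by (intro holomorphic_intros holomorphic_on_subset[OF m]) auto
    show "connected (ball (0::complex) 1 - {0})" by (rule connected_punctured_ball) simp
  qed (use Re0 in \<open>auto simp: k_def\<close>)
  then obtain c where c: "\<And>\<zeta>. \<zeta> \<in> ball 0 1 - {0} \<Longrightarrow> k \<zeta> = c"
    unfolding constant_on_def by blast
  have "Re c = 0" using c[of "1/2"] Re0[of "1/2"] by (simp add: k_def)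
  then have ci: "c = \<i> * Im c" by (simp add: complex_eq_iff)
  have "m \<zeta> = m 0 + \<i> * Im c * \<zeta> - cnj (m 0) * \<zeta>\<^sup>2" if "\<zeta> \<in> ball 0 1" for \<zeta>
  proof (cases "\<zeta> = 0")
    case False
    then have "(m \<zeta> - m 0) / \<zeta> + cnj (m 0) * \<zeta> = \<i> * Im c"
      using c[of \<zeta>] that ci by (simp add: k_def)
    then have "(m \<zeta> - m 0) / \<zeta> = \<i> * Im c - cnj (m 0) * \<zeta>"
      by (simp add: algebra_simps)
    then have "m \<zeta> - m 0 = (\<i> * Im c - cnj (m 0) * \<zeta>) * \<zeta>"
      using False by (metis nonzero_divide_eq_eq)
    then show ?thesis by (simp add: algebra_simps power2_eq_square)
  qed simp
  then show ?thesis by blast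
qed

lemma pairing_holomorphic:
  fixes a v :: "complex \<Rightarrow> complex ^ 'n"
  assumes "\<And>j. (\<lambda>\<zeta>. a \<zeta> $ j) holomorphic_on S" "\<And>j. (\<lambda>\<zeta>. v \<zeta> $ j) holomorphic_on S"
  shows "(\<lambda>\<zeta>. pairing (a \<zeta>) (v \<zeta>)) holomorphic_on S"
  unfolding pairing_def by (intro holomorphic_intros assms)

lemma pairing_continuous:
  assumes "continuous_on S a" "continuous_on S v"
  shows "continuous_on S (\<lambda>\<zeta>. pairing (a \<zeta>) (v \<zeta>))"
  unfolding pairing_def by (intro continuous_intros continuous_on_component assms)

text \<open>Here \<open>A\<close> stands for \<zeta> times a supporting lift. Positivity is used on
  the circle and carried inside before the limit is taken, so convergence of the quotients is
  required in the open disc only. The two signs of \<sigma> yield opposite inequalities for the same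
  limit.\<close>

lemma lift_variation:
  fixes A f \<Psi> :: "complex \<Rightarrow> complex ^ 'n" and h :: "real \<Rightarrow> nat \<Rightarrow> complex \<Rightarrow> complex ^ 'n"
  assumes A: "analytic_disc A" and f: "analytic_disc f" and h: "\<And>\<sigma> n. \<sigma> \<in> {1, -1} \<Longrightarrow> analytic_disc (h \<sigma> n)"
    and pos: "\<And>\<sigma> n \<zeta>. \<sigma> \<in> {1, -1} \<Longrightarrow> \<zeta> \<in> sphere 0 1 \<Longrightarrow> 0 \<le> Re (pairing (A \<zeta>) (h \<sigma> n \<zeta> - f \<zeta>) / \<zeta>)"
    and t: "\<And>n. 0 < t n"
    and lim: "\<And>\<sigma> \<zeta>. \<sigma> \<in> {1, -1} \<Longrightarrow> \<zeta> \<in> ball 0 1 \<Longrightarrow> (\<lambda>n. (1 / (\<sigma> * t n)) *\<^sub>R (h \<sigma> n \<zeta> - f \<zeta>)) \<longlonglongrightarrow> \<Psi> \<zeta>"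
    and \<Psi>: "\<And>j. (\<lambda>\<zeta>. \<Psi> \<zeta> $ j) holomorphic_on ball 0 1"
  shows "\<exists>c. \<exists>b::real. \<forall>\<zeta>\<in>ball 0 1. pairing (A \<zeta>) (\<Psi> \<zeta>) = c + \<i> * b * \<zeta> - cnj c * \<zeta>\<^sup>2"
proof -
  define m where "m \<sigma> n \<zeta> = pairing (A \<zeta>) (h \<sigma> n \<zeta> - f \<zeta>)" for \<sigma> n \<zeta>
  define M where "M \<zeta> = pairing (A \<zeta>) (\<Psi> \<zeta>)" for \<zeta>
  have M: "M holomorphic_on ball 0 1"
    unfolding M_def[abs_def] using A \<Psi> by (intro pairing_holomorphic) (auto simp: analytic_disc_def)
  have mlim: "(\<lambda>n. (1 / (\<sigma> * t n)) *\<^sub>R m \<sigma> n \<zeta>) \<longlonglongrightarrow> M \<zeta>" if "\<sigma> \<in> {1, -1}" "\<zeta> \<in> ball 0 1" for \<sigma> \<zeta>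
  proof -
    interpret bounded_linear "pairing (A \<zeta>)" by (rule bounded_linear_pairing)
    show ?thesis using tendsto[OF lim[OF that]] by (simp add: m_def M_def scaleR)
  qed
  have nonneg: "0 \<le> Re ((m \<sigma> n \<zeta> - m \<sigma> n 0) / \<zeta> + cnj (m \<sigma> n 0) * \<zeta>)"
    if "\<sigma> \<in> {1, -1}" "\<zeta> \<in> ball 0 1 - {0}" for \<sigma> n \<zeta>
  proof (rule Re_difference_quotient_nonneg[OF _ _ _ that(2)])
    have d: "analytic_disc (\<lambda>\<zeta>. h \<sigma> n \<zeta> - f \<zeta>)" by (rule analytic_disc_diff[OF h[OF that(1)] f])
    show "continuous_on (cball 0 1) (m \<sigma> n)"
      unfolding m_def[abs_def] using A d by (intro pairing_continuous) (auto simp: analytic_disc_def)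
    show "m \<sigma> n holomorphic_on ball 0 1"
      unfolding m_def[abs_def] using A d by (intro pairing_holomorphic) (auto simp: analytic_disc_def)
    show "0 \<le> Re (m \<sigma> n \<zeta> / \<zeta>)" if "\<zeta> \<in> sphere 0 1" for \<zeta>
      unfolding m_def by (rule pos[OF \<open>\<sigma> \<in> {1, -1}\<close> that])
  qed
  \<comment> \<open>Jointly real linear in x and y, though not complex linear because of
    \<open>cnj y\<close>; division by the real number \<sigma> t_n therefore commutes with
    it.\<close>
  define R where "R \<zeta> x y = Re ((x - y) / \<zeta> + cnj y * \<zeta>)" for \<zeta> x y
  have Rs: "R \<zeta> (c *\<^sub>R x) (c *\<^sub>R y) = c * R \<zeta> x y" for \<zeta> c x y
  proof -
    have "(c *\<^sub>R x - c *\<^sub>R y) / \<zeta> + cnj (c *\<^sub>R y) * \<zeta> = c *\<^sub>R ((x - y) / \<zeta> + cnj y * \<zeta>)"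
      by (simp add: scaleR_conv_of_real algebra_simps diff_divide_distrib)
    then show ?thesis unfolding R_def by simp
  qed
  have Rlim: "(\<lambda>n. 1 / (\<sigma> * t n) * R \<zeta> (m \<sigma> n \<zeta>) (m \<sigma> n 0)) \<longlonglongrightarrow> R \<zeta> (M \<zeta>) (M 0)"
    if "\<sigma> \<in> {1, -1}" "\<zeta> \<in> ball 0 1 - {0}" for \<sigma> \<zeta>
  proof -
    have "(\<lambda>n. R \<zeta> ((1 / (\<sigma> * t n)) *\<^sub>R m \<sigma> n \<zeta>) ((1 / (\<sigma> * t n)) *\<^sub>R m \<sigma> n 0)) \<longlonglongrightarrow> R \<zeta> (M \<zeta>) (M 0)"
      unfolding R_def using that by (intro tendsto_intros mlim) auto
    then show ?thesis by (simp only: Rs)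
  qed
  have "R \<zeta> (M \<zeta>) (M 0) = 0" if \<zeta>: "\<zeta> \<in> ball 0 1 - {0}" for \<zeta>
  proof (rule antisym)
    have "0 \<le> 1 / (1 * t n) * R \<zeta> (m 1 n \<zeta>) (m 1 n 0)" for n
      using nonneg[of 1 \<zeta> n] \<zeta> t[of n] by (simp add: R_def)
    then show "0 \<le> R \<zeta> (M \<zeta>) (M 0)"
      using Rlim[of 1 \<zeta>] \<zeta> by (intro LIMSEQ_le_const) auto
    have "1 / (-1 * t n) * R \<zeta> (m (-1) n \<zeta>) (m (-1) n 0) \<le> 0" for n
      using nonneg[of "-1" \<zeta> n] \<zeta> t[of n] by (simp add: R_def)
    then show "R \<zeta> (M \<zeta>) (M 0) \<le> 0"
      using Rlim[of "-1" \<zeta>] \<zeta> by (intro LIMSEQ_le_const2) auto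
  qed
  then have "\<exists>b::real. \<forall>\<zeta>\<in>ball 0 1. M \<zeta> = M 0 + \<i> * b * \<zeta> - cnj (M 0) * \<zeta>\<^sup>2"
    using M by (intro quadratic_if_Re_zero) (auto simp: R_def)
  then show ?thesis unfolding M_def by blast
qed

text \<open>Multiplication by \<zeta> turns a lift into an analytic disc, whose value at 0 is the
  residue of the lift.\<close>

lemma lift_times_zeta:
  assumes "is_lift M f g"
  obtains A where "analytic_disc A" "\<And>\<zeta>. \<zeta> \<in> cball 0 1 - {0} \<Longrightarrow> A \<zeta> = \<zeta> *s g \<zeta>"
proof -
  obtain h where h: "\<And>j. h j holomorphic_on ball 0 1" "\<And>j \<zeta>. \<zeta> \<in> ball 0 1 - {0} \<Longrightarrow> h j \<zeta> = \<zeta> * g \<zeta> $ j"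
    using assms unfolding is_lift_def by metis
  define A where "A \<zeta> = (if \<zeta> = 0 then \<chi> j. h j 0 else \<zeta> *s g \<zeta>)" for \<zeta>
  have Ah: "A \<zeta> = (\<chi> j. h j \<zeta>)" if "\<zeta> \<in> ball 0 1" for \<zeta>
    using h(2)[of \<zeta>] that by (auto simp: A_def vec_eq_iff)
  show ?thesis
  proof (rule that[of A])
    show "analytic_disc A" unfolding analytic_disc_def
    proof (intro conjI allI)
      have "continuous_on (cball 0 (1/2)) (\<lambda>\<zeta>. \<chi> j. h j \<zeta>)"
        by (intro continuous_on_vec_lambda continuous_on_subset[OF holomorphic_on_imp_continuous_on[OF h(1)]]) auto
      then have 1: "continuous_on (cball 0 (1/2)) A"
        by (subst continuous_on_cong[OF refl Ah]) auto
      have "continuous_on (cball 0 1 - {0}) (\<lambda>\<zeta>. \<chi> j. \<zeta> * g \<zeta> $ j)"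
        using assms unfolding is_lift_def
        by (intro continuous_on_vec_lambda continuous_intros continuous_on_component) auto
      then have 2: "continuous_on (cball 0 1 - {0}) A"
        by (subst continuous_on_cong[OF refl, where g = "\<lambda>\<zeta>. \<chi> j. \<zeta> * g \<zeta> $ j"]) (auto simp: A_def vec_eq_iff)
      show "continuous_on (cball 0 1) A" by (rule continuous_on_cball_split[OF 1 2])
      show "(\<lambda>\<zeta>. A \<zeta> $ j) holomorphic_on ball 0 1" for j
        using h(1)[of j] by (subst holomorphic_cong[OF refl, where g = "h j"]) (auto simp: Ah)
    qed
  qed (auto simp: A_def)
qed

section \<open>Continuity and conormality of the lift on the circle\<close>

lemma punctured_disc_vanish:
  fixes d :: "complex \<Rightarrow> 'a::real_normed_vector"
  assumes d: "continuous_on (cball 0 1 - {0}) d" and zero: "\<And>z. z \<in> ball 0 1 - {0} \<Longrightarrow> d z = 0"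
    and \<zeta>: "\<zeta> \<in> sphere 0 1"
  shows "d \<zeta> = 0"
proof -
  \<comment> \<open>The radii start at 1/2, which keeps the sequence away from the excluded point
    0.\<close>
  define z where "z n = of_real (real (Suc n) / real (Suc (Suc n))) * \<zeta>" for n
  have "z \<longlonglongrightarrow> of_real 1 * \<zeta>"
    unfolding z_def by (intro tendsto_intros LIMSEQ_Suc[OF LIMSEQ_n_over_Suc_n])
  then have zlim: "z \<longlonglongrightarrow> \<zeta>" by simp
  have zn: "norm (z n) = real (Suc n) / real (Suc (Suc n))" for n
    using \<zeta> by (simp add: z_def norm_mult del: of_nat_Suc of_real_divide)
  have zb: "z n \<in> ball 0 1 - {0}" for n
  proof -
    have "norm (z n) < 1" "0 < norm (z n)" unfolding zn by simp_all
    then show ?thesis by simp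
  qed
  have "(\<lambda>n. d (z n)) \<longlonglongrightarrow> d \<zeta>"
  proof (rule continuous_on_tendsto_compose[OF d zlim])
    show "\<zeta> \<in> cball 0 1 - {0}" using \<zeta> by auto
    have "z n \<in> cball 0 1 - {0}" for n using zb[of n] by auto
    then show "\<forall>\<^sub>F n in sequentially. z n \<in> cball 0 1 - {0}" by (rule always_eventually[OF allI])
  qed
  moreover have "d (z n) = 0" for n
    by (rule zero[OF zb])
  ultimately show ?thesis by (simp add: LIMSEQ_const_iff)
qed

text \<open>Here \<phi> is almost constant, close to a vector e tangent at the centre. Such e span
  the space over the complex numbers, so the identities
  \<open>pairing (g \<zeta>) (\<phi> \<zeta>) = s \<zeta>\<close> form a linear system for
  \<open>g\<close> that remains solvable on the circle. For conormality, a vector X in the common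
  kernel at \<zeta> is approximated by a value of \<phi>, on which the real part vanishes; the error
  is again in the kernel and at most half as long, and the procedure is repeated.\<close>

lemma conormal_extension:
  fixes g :: "complex \<Rightarrow> complex ^ 'n" and A b :: "nat \<Rightarrow> complex ^ 'n" and \<eta> \<kappa> :: real
    and DR :: "nat \<Rightarrow> complex \<Rightarrow> complex ^ 'n \<Rightarrow> real"
  assumes AB: "\<And>i j. i < k \<Longrightarrow> j < k \<Longrightarrow> pairing (A i) (b j) = (if i = j then 1 else 0)"
    and DR: "\<And>j \<zeta>. j < k \<Longrightarrow> \<zeta> \<in> sphere 0 1 \<Longrightarrow> bounded_linear (DR j \<zeta>)"
    and near: "\<And>j \<zeta> X. j < k \<Longrightarrow> \<zeta> \<in> sphere 0 1 \<Longrightarrow> \<bar>DR j \<zeta> X - Re (pairing (A j) X)\<bar> \<le> \<kappa> * norm X"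
    and \<kappa>: "\<kappa> * (\<Sum>j<k. norm (b j)) \<le> 1/4"
    and \<eta>: "0 \<le> \<eta>" "4 * \<eta> * (1 + (\<Sum>j<k. norm (A j) * norm (b j))) * real CARD('n) \<le> 1"
    and var: "\<And>e. (\<And>j. j < k \<Longrightarrow> Re (pairing (A j) e) = 0) \<Longrightarrow>
      \<exists>\<phi> s. continuous_on (cball 0 1) \<phi> \<and> (\<forall>\<zeta>\<in>cball 0 1. norm (\<phi> \<zeta> - e) \<le> \<eta> * norm e) \<and>
        (\<forall>\<zeta>\<in>sphere 0 1. \<forall>j<k. DR j \<zeta> (\<phi> \<zeta>) = 0) \<and>
        continuous_on (cball 0 1 - {0}) s \<and> (\<forall>\<zeta>\<in>sphere 0 1. Re (s \<zeta>) = 0) \<and>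
        (\<forall>\<zeta>\<in>ball 0 1 - {0}. pairing (g \<zeta>) (\<phi> \<zeta>) = s \<zeta>)"
  obtains G where "continuous_on (cball 0 1 - {0}) G" "\<And>\<zeta>. \<zeta> \<in> ball 0 1 - {0} \<Longrightarrow> G \<zeta> = g \<zeta>"
    "\<And>\<zeta> X. \<zeta> \<in> sphere 0 1 \<Longrightarrow> (\<And>j. j < k \<Longrightarrow> DR j \<zeta> X = 0) \<Longrightarrow> Re (pairing (G \<zeta>) X) = 0"
proof -
  define c where "c = 1 + (\<Sum>j<k. norm (A j) * norm (b j))"
  have c: "1 \<le> c" by (simp add: c_def sum_nonneg)
  have N: "1 \<le> real CARD('n)"
    using zero_less_card_finite[where 'a = 'n] by (simp add: Suc_leI)
  have pl: "pairing a (x - y) = pairing a x - pairing a y" "pairing a (x + y) = pairing a x + pairing a y"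
    "pairing a (sum u I) = (\<Sum>i\<in>I. pairing a (u i))" "pairing a (r *\<^sub>R x) = r *\<^sub>R pairing a x"
    for a x y :: "complex ^ 'n" and u :: "nat \<Rightarrow> complex ^ 'n" and I r
  proof -
    interpret bounded_linear "pairing a" by (rule bounded_linear_pairing)
    show "pairing a (x - y) = pairing a x - pairing a y" "pairing a (x + y) = pairing a x + pairing a y"
      "pairing a (sum u I) = (\<Sum>i\<in>I. pairing a (u i))" "pairing a (r *\<^sub>R x) = r *\<^sub>R pairing a x"
      by (auto simp: diff add sum scaleR)
  qed
  \<comment> \<open>A real linear correction along the b_j. The pairings of A_i with Q X are real
    and equal to the real parts for X, so both X - Q X and i Q X are tangent at the centre.\<close>
  define Q where "Q X = (\<Sum>j<k. Re (pairing (A j) X) *\<^sub>R b j)" for X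
  have Qn: "norm (Q X) \<le> (c - 1) * norm X" for X
  proof -
    have "norm (Q X) \<le> (\<Sum>j<k. norm (Re (pairing (A j) X) *\<^sub>R b j))" unfolding Q_def by (rule norm_sum)
    also have "\<dots> \<le> (\<Sum>j<k. (norm (A j) * norm X) * norm (b j))"
    proof (rule sum_mono)
      fix j
      have "\<bar>Re (pairing (A j) X)\<bar> \<le> norm (A j) * norm X"
        using abs_Re_le_cmod norm_pairing_le order_trans by blast
      then show "norm (Re (pairing (A j) X) *\<^sub>R b j) \<le> (norm (A j) * norm X) * norm (b j)"
        by (simp add: mult_right_mono)
    qed
    also have "\<dots> = (c - 1) * norm X" by (simp add: c_def sum_distrib_left sum_distrib_right mult_ac)
    finally show ?thesis .
  qed
  have AQ: "pairing (A i) (Q X) = of_real (Re (pairing (A i) X))" if "i < k" for i X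
  proof -
    have "pairing (A i) (Q X) = (\<Sum>j<k. if i = j then of_real (Re (pairing (A i) X)) else 0)"
      unfolding Q_def pl using AB[OF that] by (intro sum.cong) (auto simp: scaleR_conv_of_real)
    then show ?thesis using that by simp
  qed
  have tangent1: "Re (pairing (A j) (X - Q X)) = 0" if "j < k" for j X
    using that by (simp add: pl AQ)
  have tangent2: "Re (pairing (A j) (\<i> *s Q X)) = 0" if "j < k" for j X
    using that by (simp add: pairing_scale AQ)
  have PX: "norm (X - Q X) \<le> c * norm X" for X
    using norm_triangle_ineq4[of X "Q X"] Qn[of X] by (simp add: algebra_simps)
  define good where "good e \<phi> s \<longleftrightarrow> continuous_on (cball 0 1) \<phi> \<and> (\<forall>\<zeta>\<in>cball 0 1. norm (\<phi> \<zeta> - e) \<le> \<eta> * norm e) \<and>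
        (\<forall>\<zeta>\<in>sphere 0 1. \<forall>j<k. DR j \<zeta> (\<phi> \<zeta>) = 0) \<and>
        continuous_on (cball 0 1 - {0}) s \<and> (\<forall>\<zeta>\<in>sphere 0 1. Re (s \<zeta>) = 0) \<and>
        (\<forall>\<zeta>\<in>ball 0 1 - {0}. pairing (g \<zeta>) (\<phi> \<zeta>) = s \<zeta>)" for e \<phi> s
  have "\<exists>\<phi> s. good e \<phi> s" if "\<And>j. j < k \<Longrightarrow> Re (pairing (A j) e) = 0" for e
    using var[OF that] unfolding good_def by blast
  then have "\<forall>e. \<exists>p. (\<forall>j<k. Re (pairing (A j) e) = 0) \<longrightarrow> good e (fst p) (snd p)"
    by (metis fst_conv snd_conv)
  then obtain p where p: "\<And>e. (\<And>j. j < k \<Longrightarrow> Re (pairing (A j) e) = 0) \<Longrightarrow> good e (fst (p e)) (snd (p e))"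
    by metis
  define \<phi> where "\<phi> e = fst (p e)" for e
  define s where "s e = snd (p e)" for e
  have \<phi>c: "\<And>e. (\<And>j. j < k \<Longrightarrow> Re (pairing (A j) e) = 0) \<Longrightarrow> continuous_on (cball 0 1) (\<phi> e)"
    and \<phi>e: "\<And>e \<zeta>. (\<And>j. j < k \<Longrightarrow> Re (pairing (A j) e) = 0) \<Longrightarrow> \<zeta> \<in> cball 0 1 \<Longrightarrow> norm (\<phi> e \<zeta> - e) \<le> \<eta> * norm e"
    and \<phi>t: "\<And>e \<zeta> j. (\<And>j. j < k \<Longrightarrow> Re (pairing (A j) e) = 0) \<Longrightarrow> \<zeta> \<in> sphere 0 1 \<Longrightarrow> j < k \<Longrightarrow> DR j \<zeta> (\<phi> e \<zeta>) = 0"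
    and sc: "\<And>e. (\<And>j. j < k \<Longrightarrow> Re (pairing (A j) e) = 0) \<Longrightarrow> continuous_on (cball 0 1 - {0}) (s e)"
    and s0: "\<And>e \<zeta>. (\<And>j. j < k \<Longrightarrow> Re (pairing (A j) e) = 0) \<Longrightarrow> \<zeta> \<in> sphere 0 1 \<Longrightarrow> Re (s e \<zeta>) = 0"
    and sg: "\<And>e \<zeta>. (\<And>j. j < k \<Longrightarrow> Re (pairing (A j) e) = 0) \<Longrightarrow> \<zeta> \<in> ball 0 1 - {0} \<Longrightarrow> pairing (g \<zeta>) (\<phi> e \<zeta>) = s e \<zeta>"
    using p unfolding good_def \<phi>_def s_def by blast+
  define a :: "'n \<Rightarrow> complex ^ 'n" where "a m = axis m 1" for m
  have an: "norm (a m) = 1" for m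
  proof -
    have "(\<Sum>i\<in>UNIV. (norm (a m $ i))\<^sup>2) = (\<Sum>i\<in>UNIV. if i = m then 1 else 0)"
      by (rule sum.cong) (auto simp: a_def axis_def)
    then show ?thesis by (simp add: norm_vec_def L2_set_def)
  qed
  \<comment> \<open>Modelled on a = (a - Q a) - i (i Q a), which writes each basis vector as a
    complex combination of tangent vectors.\<close>
  define \<Phi> where "\<Phi> m \<zeta> = \<phi> (a m - Q (a m)) \<zeta> - \<i> *s \<phi> (\<i> *s Q (a m)) \<zeta>" for m \<zeta>
  obtain G where G: "continuous_on (cball 0 1 - {0}) G" "\<And>\<zeta>. \<zeta> \<in> ball 0 1 - {0} \<Longrightarrow> G \<zeta> = g \<zeta>"
  proof (rule pairing_system_extension[of "cball 0 1 - {0}" \<Phi> "2 * \<eta> * c"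
        "\<lambda>m \<zeta>. s (a m - Q (a m)) \<zeta> - \<i> * s (\<i> *s Q (a m)) \<zeta>" "ball 0 1 - {0}" g])
    show "continuous_on (cball 0 1 - {0}) (\<Phi> m)" for m
    proof -
      have "continuous_on (cball 0 1) (\<lambda>\<zeta>. \<chi> j. \<phi> (a m - Q (a m)) \<zeta> $ j - \<i> * \<phi> (\<i> *s Q (a m)) \<zeta> $ j)"
        by (intro continuous_on_vec_lambda continuous_intros continuous_on_component \<phi>c tangent1 tangent2)
      moreover have "(\<lambda>\<zeta>. \<chi> j. \<phi> (a m - Q (a m)) \<zeta> $ j - \<i> * \<phi> (\<i> *s Q (a m)) \<zeta> $ j) = \<Phi> m"
        by (simp add: \<Phi>_def vec_eq_iff fun_eq_iff)
      ultimately have "continuous_on (cball 0 1) (\<Phi> m)" by (simp only:)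
      then show ?thesis by (rule continuous_on_subset) auto
    qed
    show "norm (\<Phi> m \<zeta> - axis m 1) \<le> 2 * \<eta> * c" if "\<zeta> \<in> cball 0 1 - {0}" for m \<zeta>
    proof -
      have eq: "\<Phi> m \<zeta> - axis m 1 = (\<phi> (a m - Q (a m)) \<zeta> - (a m - Q (a m))) - \<i> *s (\<phi> (\<i> *s Q (a m)) \<zeta> - \<i> *s Q (a m))"
        by (simp add: \<Phi>_def a_def vec_eq_iff algebra_simps)
      have "norm (\<Phi> m \<zeta> - axis m 1) \<le> norm (\<phi> (a m - Q (a m)) \<zeta> - (a m - Q (a m))) + norm (\<i> *s (\<phi> (\<i> *s Q (a m)) \<zeta> - \<i> *s Q (a m)))"
        unfolding eq by (rule norm_triangle_ineq4)
      also have "\<dots> \<le> \<eta> * norm (a m - Q (a m)) + \<eta> * norm (\<i> *s Q (a m))"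
      proof (rule add_mono)
        have \<zeta>: "\<zeta> \<in> cball 0 1" using that by simp
        show "norm (\<phi> (a m - Q (a m)) \<zeta> - (a m - Q (a m))) \<le> \<eta> * norm (a m - Q (a m))"
          by (rule \<phi>e[OF tangent1 \<zeta>])
        have ni: "norm (\<i> *s w) = norm w" for w :: "complex ^ 'n" by (simp add: norm_vec_scale)
        show "norm (\<i> *s (\<phi> (\<i> *s Q (a m)) \<zeta> - \<i> *s Q (a m))) \<le> \<eta> * norm (\<i> *s Q (a m))"
          unfolding ni[of "\<phi> (\<i> *s Q (a m)) \<zeta> - \<i> *s Q (a m)"] by (rule \<phi>e[OF tangent2 \<zeta>])
      qed
      also have "\<dots> \<le> \<eta> * c + \<eta> * c"
        using PX[of "a m"] Qn[of "a m"] \<eta>(1) by (intro add_mono mult_left_mono) (auto simp: an norm_vec_scale)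
      finally show ?thesis by simp
    qed
    \<comment> \<open>The two tangent vectors contribute \<eta>c each. The factor 4 in the
      hypothesis also gives \<eta>c \<le> 1/4, used in the halving argument.\<close>
    have "2 * \<eta> * c * real CARD('n) = (4 * \<eta> * (1 + (\<Sum>j<k. norm (A j) * norm (b j))) * real CARD('n)) / 2"
      by (simp add: c_def)
    also have "\<dots> < 1" by (rule order_le_less_trans[OF divide_right_mono[OF \<eta>(2)]]) simp_all
    finally show "2 * \<eta> * c * real CARD('n) < 1" .
    show "continuous_on (cball 0 1 - {0}) (\<lambda>\<zeta>. s (a m - Q (a m)) \<zeta> - \<i> * s (\<i> *s Q (a m)) \<zeta>)" for m
      by (intro continuous_intros sc tangent1 tangent2)
    show "pairing (\<Phi> m \<zeta>) (g \<zeta>) = s (a m - Q (a m)) \<zeta> - \<i> * s (\<i> *s Q (a m)) \<zeta>" if "\<zeta> \<in> ball 0 1 - {0}" for m \<zeta>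
      using sg[OF tangent1 that, of "a m"] sg[OF tangent2 that, of "a m"]
      by (subst pairing_commute) (simp add: \<Phi>_def pl pairing_scale)
  qed auto
  have sG: "pairing (G \<zeta>) (\<phi> e \<zeta>) = s e \<zeta>"
    if e: "\<And>j. j < k \<Longrightarrow> Re (pairing (A j) e) = 0" and \<zeta>: "\<zeta> \<in> sphere 0 1" for e \<zeta>
  proof -
    define d where "d z = pairing (G z) (\<phi> e z) - s e z" for z
    have d: "continuous_on (cball 0 1 - {0}) d"
      unfolding d_def by (intro continuous_intros pairing_continuous G sc e continuous_on_subset[OF \<phi>c]) auto
    have "d \<zeta> = 0"
      by (rule punctured_disc_vanish[OF d _ \<zeta>]) (simp add: d_def sg[OF e] G(2))
    then show ?thesis by (simp add: d_def)
  qed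
  \<comment> \<open>The factor 1/2 is 1/4 + 1/4: Q X is short since X is almost tangent at the
    centre, and \<phi> stays close to X - Q X. Subtracting the value of \<phi> does not change the
    real part of the pairing with \<open>G \<zeta>\<close>.\<close>
  have half: "\<bar>Re (pairing (G \<zeta>) X)\<bar> \<le> norm (G \<zeta>) * norm X * (1/2) ^ n"
    if \<zeta>: "\<zeta> \<in> sphere 0 1" and X: "\<And>j. j < k \<Longrightarrow> DR j \<zeta> X = 0" for \<zeta> X n
    using X
  proof (induction n arbitrary: X)
    case 0
    show ?case using norm_pairing_le[of "G \<zeta>" X] abs_Re_le_cmod[of "pairing (G \<zeta>) X"] by simp
  next
    case (Suc n)
    define Y where "Y = X - \<phi> (X - Q X) \<zeta>"
    have "\<bar>Re (pairing (A j) X)\<bar> \<le> \<kappa> * norm X" if "j < k" for j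
      using near[OF that \<zeta>, of X] Suc.prems[OF that] by simp
    then have "(\<Sum>j<k. norm (Re (pairing (A j) X) *\<^sub>R b j)) \<le> (\<Sum>j<k. (\<kappa> * norm X) * norm (b j))"
      by (intro sum_mono) (simp add: mult_right_mono)
    then have "norm (Q X) \<le> (\<Sum>j<k. (\<kappa> * norm X) * norm (b j))"
      unfolding Q_def by (rule order_trans[OF norm_sum])
    also have "\<dots> = (\<kappa> * (\<Sum>j<k. norm (b j))) * norm X" by (simp add: sum_distrib_left mult_ac)
    also have "\<dots> \<le> 1/4 * norm X" using \<kappa> by (rule mult_right_mono) simp
    finally have 1: "norm (Q X) \<le> 1/4 * norm X" .
    have "norm (\<phi> (X - Q X) \<zeta> - (X - Q X)) \<le> \<eta> * norm (X - Q X)"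
      using \<zeta> by (intro \<phi>e tangent1) auto
    also have "\<dots> \<le> \<eta> * (c * norm X)" using PX \<eta>(1) by (intro mult_left_mono) auto
    also have "\<dots> \<le> 1/4 * norm X"
    proof -
      have "4 * \<eta> * c * 1 \<le> 4 * \<eta> * c * real CARD('n)" using N c \<eta>(1) by (intro mult_left_mono) auto
      then have "\<eta> * c \<le> 1/4" using \<eta>(2) by (simp add: c_def)
      then show ?thesis using mult_right_mono[of "\<eta> * c" "1/4" "norm X"] by simp
    qed
    finally have 2: "norm (\<phi> (X - Q X) \<zeta> - (X - Q X)) \<le> 1/4 * norm X" .
    have "Y = Q X - (\<phi> (X - Q X) \<zeta> - (X - Q X))" by (simp add: Y_def)
    then have Yn: "norm Y \<le> 1/2 * norm X"
      using norm_triangle_ineq4[of "Q X" "\<phi> (X - Q X) \<zeta> - (X - Q X)"] 1 2 by simp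
    have "DR j \<zeta> Y = 0" if "j < k" for j
    proof -
      interpret bounded_linear "DR j \<zeta>" by (rule DR[OF that \<zeta>])
      show ?thesis using Suc.prems[OF that] \<phi>t[OF tangent1 \<zeta> that, of X] by (simp add: Y_def diff)
    qed
    then have "\<bar>Re (pairing (G \<zeta>) Y)\<bar> \<le> norm (G \<zeta>) * norm Y * (1/2) ^ n" by (rule Suc.IH)
    also have "\<dots> \<le> norm (G \<zeta>) * (1/2 * norm X) * (1/2) ^ n"
      using Yn by (intro mult_right_mono mult_left_mono) auto
    also have "Re (pairing (G \<zeta>) Y) = Re (pairing (G \<zeta>) X)"
      using sG[OF tangent1 \<zeta>, of X] s0[OF tangent1 \<zeta>, of X] by (simp add: Y_def pl)
    finally show ?case by simp
  qed
  show ?thesis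
  proof (rule that[OF G])
    fix \<zeta> X assume "\<zeta> \<in> sphere (0::complex) 1" "\<And>j. j < k \<Longrightarrow> DR j \<zeta> X = 0"
    then have "\<bar>Re (pairing (G \<zeta>) X)\<bar> \<le> norm (G \<zeta>) * norm X * (1/2) ^ n" for n by (rule half)
    moreover have "(\<lambda>n. norm (G \<zeta>) * norm X * (1/2) ^ n) \<longlonglongrightarrow> 0"
      by (intro tendsto_mult_right_zero LIMSEQ_power_zero) simp
    ultimately have "\<bar>Re (pairing (G \<zeta>) X)\<bar> \<le> 0"
      by (intro LIMSEQ_le_const) auto
    then show "Re (pairing (G \<zeta>) X) = 0" by simp
  qed
qed

text \<open>Both suprema are nonnegative, so each is below their sum. Boundedness and the Hoelder
  condition ensure that they are suprema of bounded sets and hence bound their members.\<close>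

lemma holder_norm_bounds:
  fixes f :: "'a::metric_space \<Rightarrow> 'b::real_normed_vector"
  assumes hol: "holder_on \<beta> S f" and bdd: "bounded (f ` S)" and le: "holder_norm \<beta> S f < \<epsilon>"
    and x: "x \<in> S"
  shows "norm (f x) \<le> \<epsilon>" and "y \<in> S \<Longrightarrow> norm (f x - f y) \<le> \<epsilon> * dist x y powr \<beta>"
proof -
  define a where "a = (SUP x\<in>S. norm (f x))"
  define b where "b = (SUP (x, y)\<in>S \<times> S. norm (f x - f y) / dist x y powr \<beta>)"
  have ab: "a + b < \<epsilon>" using le by (simp add: holder_norm_def a_def b_def)
  have 1: "norm (f x) \<le> a" if "x \<in> S" for x
    unfolding a_def
  proof (rule cSUP_upper[OF that])
    show "bdd_above ((\<lambda>x. norm (f x)) ` S)"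
    proof -
      obtain B where "\<forall>x\<in>S. norm (f x) \<le> B" using bdd by (auto simp: bounded_iff)
      then show ?thesis by (auto intro!: bdd_aboveI2[where M = B])
    qed
  qed
  obtain C where C: "\<And>x y. x \<in> S \<Longrightarrow> y \<in> S \<Longrightarrow> dist (f x) (f y) \<le> C * dist x y powr \<beta>"
    using hol unfolding holder_on_def by blast
  have quot: "norm (f x - f y) / dist x y powr \<beta> \<le> \<bar>C\<bar>" if "x \<in> S" "y \<in> S" for x y
  proof (cases "x = y")
    case False
    then have "0 < dist x y powr \<beta>" by simp
    moreover have "norm (f x - f y) \<le> \<bar>C\<bar> * dist x y powr \<beta>"
      using order_trans[OF C[OF that] mult_right_mono[OF abs_ge_self]] by (simp add: dist_norm)
    ultimately show ?thesis by (simp add: divide_le_eq)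
  qed simp
  have 2: "norm (f x - f y) / dist x y powr \<beta> \<le> b" if "x \<in> S" "y \<in> S" for x y
  proof -
    have "(\<lambda>(x, y). norm (f x - f y) / dist x y powr \<beta>) (x, y) \<le> b"
      unfolding b_def
    proof (rule cSUP_upper)
      show "bdd_above ((\<lambda>(x, y). norm (f x - f y) / dist x y powr \<beta>) ` (S \<times> S))"
        using quot by (auto intro!: bdd_aboveI2[where M = "\<bar>C\<bar>"])
    qed (use that in auto)
    then show ?thesis by simp
  qed
  have "0 \<le> a" using 1[OF x] norm_ge_zero order_trans by blast
  moreover have "0 \<le> b" using 2[OF x x] by simp
  ultimately show "norm (f x) \<le> \<epsilon>" using 1[OF x] ab by simp
  show "norm (f x - f y) \<le> \<epsilon> * dist x y powr \<beta>" if y: "y \<in> S"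
  proof (cases "x = y")
    case False
    then have pos: "0 < dist x y powr \<beta>" by simp
    have "norm (f x - f y) \<le> b * dist x y powr \<beta>"
      using 2[OF x y] pos by (simp add: divide_le_eq)
    also have "\<dots> \<le> \<epsilon> * dist x y powr \<beta>"
      using \<open>0 \<le> a\<close> ab by (intro mult_right_mono) auto
    finally show ?thesis .
  qed simp
qed

text \<open>Identifies the derivative of the limit with \<open>complex_jacobian\<close>, which is
  defined by one-variable derivatives: complex linearity lets the values on the standard basis
  determine the whole real derivative.\<close>

lemma holo_polynomial_map_uniform_limit:
  fixes P :: "nat \<Rightarrow> complex ^ 'n \<Rightarrow> complex ^ 'm"
  assumes P: "\<And>n. holo_polynomial_map (P n)" and "open \<Omega>" and lim: "uniform_limit \<Omega> P F sequentially"
  shows "z \<in> \<Omega> \<Longrightarrow> (F has_derivative (\<lambda>v. complex_jacobian F z *v v)) (at z)"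
    and "open S \<Longrightarrow> (\<And>j. (\<lambda>\<zeta>. f \<zeta> $ j) holomorphic_on S) \<Longrightarrow> f ` S \<subseteq> \<Omega> \<Longrightarrow>
      (\<lambda>\<zeta>. complex_jacobian F (f \<zeta>) $ i $ j) holomorphic_on S"
proof -
  have "\<exists>D. (\<forall>z\<in>\<Omega>. ((\<lambda>z. F z $ i) has_derivative D z) (at z)) \<and> (\<forall>z\<in>\<Omega>. \<forall>c v. D z (c *s v) = c * D z v) \<and>
     (\<forall>S f v. open S \<longrightarrow> (\<forall>j. (\<lambda>\<zeta>. f \<zeta> $ j) holomorphic_on S) \<longrightarrow> f ` S \<subseteq> \<Omega> \<longrightarrow>
        (\<lambda>\<zeta>. D (f \<zeta>) v) holomorphic_on S)" for i
    using P by (intro holo_polynomial_uniform_limit[OF _ \<open>open \<Omega>\<close> bounded_linear.uniform_limit[OF bounded_linear_vec_nth lim]])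
       (auto simp: holo_polynomial_map_def)
  then obtain D where D: "\<And>i z. z \<in> \<Omega> \<Longrightarrow> ((\<lambda>z. F z $ i) has_derivative D i z) (at z)"
    and Dc: "\<And>i z c v. z \<in> \<Omega> \<Longrightarrow> D i z (c *s v) = c * D i z v"
    and Dh: "\<And>i S f v. open S \<Longrightarrow> (\<And>j. (\<lambda>\<zeta>. f \<zeta> $ j) holomorphic_on S) \<Longrightarrow> f ` S \<subseteq> \<Omega> \<Longrightarrow>
        (\<lambda>\<zeta>. D i (f \<zeta>) v) holomorphic_on S"
    by metis
  have jac: "complex_jacobian F z $ i $ j = D i z (axis j 1)" if z: "z \<in> \<Omega>" for z i j
  proof -
    have e: "axis j w = w *s axis j (1::complex)" for w :: complex
      by (simp add: axis_def vec_eq_iff)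
    have "((\<lambda>w. z + w *s axis j 1) has_derivative (\<lambda>w. w *s axis j 1)) (at 0)"
      by (auto intro!: derivative_eq_intros bounded_linear_imp_has_derivative bounded_linear_scale_vec)
    moreover have "((\<lambda>z. F z $ i) has_derivative D i z) (at (z + 0 *s axis j 1))"
      using D[OF z] by simp
    ultimately have "((\<lambda>w. F (z + w *s axis j 1) $ i) has_derivative (\<lambda>w. D i z (w *s axis j 1))) (at 0)"
      by (rule has_derivative_compose)
    then have "((\<lambda>w. F (z + w *s axis j 1) $ i) has_field_derivative D i z (axis j 1)) (at 0)"
      by (simp add: has_field_derivative_def Dc[OF z] mult.commute[of _ "D i z _"] fun_eq_iff)
    from DERIV_imp_deriv[OF this] show ?thesis
      by (simp add: complex_jacobian_def e[symmetric])
  qed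
  have rep: "D i z v = (complex_jacobian F z *v v) $ i" if z: "z \<in> \<Omega>" for z i v
  proof -
    interpret bounded_linear "D i z" by (rule has_derivative_bounded_linear[OF D[OF z]])
    have "D i z v = D i z (\<Sum>j\<in>UNIV. (v $ j) *s axis j 1)" by (simp add: basis_expansion)
    also have "\<dots> = (\<Sum>j\<in>UNIV. v $ j * D i z (axis j 1))" by (simp add: sum Dc[OF z])
    also have "\<dots> = (complex_jacobian F z *v v) $ i"
      by (simp add: matrix_vector_mult_def jac[OF z] mult.commute)
    finally show ?thesis .
  qed
  show "(F has_derivative (\<lambda>v. complex_jacobian F z *v v)) (at z)" if z: "z \<in> \<Omega>" for z
  proof -
    have "((\<lambda>z. \<Sum>i\<in>UNIV. (F z $ i) *s axis i 1) has_derivative (\<lambda>v. \<Sum>i\<in>UNIV. D i z v *s axis i 1)) (at z)"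
      by (intro has_derivative_sum bounded_linear.has_derivative[OF bounded_linear_scale_vec] D[OF z])
    then show ?thesis
      unfolding rep[OF z] basis_expansion .
  qed
  show "(\<lambda>\<zeta>. complex_jacobian F (f \<zeta>) $ i $ j) holomorphic_on S"
    if "open S" "\<And>j. (\<lambda>\<zeta>. f \<zeta> $ j) holomorphic_on S" "f ` S \<subseteq> \<Omega>"
    for S i j and f :: "complex \<Rightarrow> complex ^ 'n"
  proof -
    have "(\<lambda>\<zeta>. D i (f \<zeta>) (axis j 1)) holomorphic_on S" by (rule Dh[OF that])
    then show ?thesis
      by (rule holomorphic_transform) (use jac that(3) in auto)
  qed
qed

lemma pairing_vector_matrix: "pairing (x v* K) v = pairing x (K *v (v :: complex ^ 'n))"
proof -
  have "pairing (x v* K) v = (\<Sum>j\<in>UNIV. \<Sum>i\<in>UNIV. x $ i * (K $ i $ j * v $ j))"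
    by (simp add: pairing_def vector_matrix_mult_def sum_distrib_right sum_distrib_left mult_ac)
  also have "\<dots> = (\<Sum>i\<in>UNIV. \<Sum>j\<in>UNIV. x $ i * (K $ i $ j * v $ j))" by (rule sum.swap)
  also have "\<dots> = pairing x (K *v v)"
    by (simp add: pairing_def matrix_vector_mult_def sum_distrib_left)
  finally show ?thesis .
qed

lemma matrix_inv_unique_left:
  fixes J K :: "'a::field ^ 'n ^ 'n"
  assumes "K ** J = mat 1"
  shows "matrix_inv J = K"
proof -
  have JK: "J ** K = mat 1" using assms matrix_left_right_inverse by blast
  have "J ** matrix_inv J = mat 1 \<and> matrix_inv J ** J = mat 1"
    unfolding matrix_inv_def by (rule someI[of _ K]) (use JK assms in simp)
  then have inv: "matrix_inv J ** J = mat 1" ..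
  have "matrix_inv J = matrix_inv J ** (J ** K)" using JK by simp
  also have "\<dots> = K" using inv by (simp add: matrix_mul_assoc)
  finally show ?thesis .
qed

section \<open>Invariance of stationary discs\<close>

theorem proposition2:
  fixes M\<^sub>1 M\<^sub>2 U\<^sub>1 U\<^sub>2 :: "(complex ^ 'n) set"
    and F G F\<^sub>1 :: "complex ^ 'n \<Rightarrow> complex ^ 'n"
    and p :: "complex ^ 'n"
    and \<alpha> \<beta> :: real
  assumes "generic_manifold M\<^sub>1" and "generic_manifold M\<^sub>2"
    and "homeomorphism M\<^sub>1 M\<^sub>2 F G"
    and "CR_map M\<^sub>1 F" and "CR_map M\<^sub>2 G"
    and "0 < \<alpha>" and "\<alpha> < 1"
    and "holder_on \<alpha> M\<^sub>1 F" and "holder_on \<alpha> M\<^sub>2 G"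
    and "0 < \<beta>" and "\<beta> < 1"
    and "p \<in> M\<^sub>1"
    and "open U\<^sub>1" and "p \<in> U\<^sub>1" and "open U\<^sub>2" and "F p \<in> U\<^sub>2"
    and "F ` (M\<^sub>1 \<inter> U\<^sub>1) \<subseteq> U\<^sub>2"
    and "polynomial_limit (M\<^sub>1 \<inter> U\<^sub>1) F" and "polynomial_limit (M\<^sub>2 \<inter> U\<^sub>2) G"
    and "disc_extension (M\<^sub>1 \<inter> U\<^sub>1) F F\<^sub>1"
  shows "\<exists>\<epsilon>>0. \<forall>D f\<^sub>1 f\<^sub>1'.
    open D \<and> connected D \<and> D \<subseteq> interior (disc_hull (M\<^sub>1 \<inter> U\<^sub>1)) \<and>
    stationary_disc M\<^sub>1 f\<^sub>1 \<and> f\<^sub>1 ` sphere 0 1 \<subseteq> M\<^sub>1 \<inter> U\<^sub>1 \<and>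
    holder_on \<beta> (cball 0 1) f\<^sub>1 \<and> holder_norm \<beta> (cball 0 1) (\<lambda>\<zeta>. f\<^sub>1 \<zeta> - p) < \<epsilon> \<and>
    f\<^sub>1 ` ball 0 1 \<subseteq> D \<and>
    supporting_lift M\<^sub>1 f\<^sub>1 f\<^sub>1'
    \<longrightarrow>
    stationary_disc M\<^sub>2 (F\<^sub>1 \<circ> f\<^sub>1) \<and>
    (\<exists>f\<^sub>2'. is_lift M\<^sub>2 (F\<^sub>1 \<circ> f\<^sub>1) f\<^sub>2' \<and>
      (\<forall>\<zeta>\<in>ball 0 1 - {0}. f\<^sub>2' \<zeta> = f\<^sub>1' \<zeta> v* matrix_inv (complex_jacobian F\<^sub>1 (f\<^sub>1 \<zeta>))))"
proof -
  note gen2 = assms(2) and hom = assms(3) and \<alpha> = assms(6,7) and holF = assms(8)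
    and \<beta> = assms(10,11) and p = assms(12) and U2 = assms(15,16) and FU = assms(17)
    and limG = assms(19) and ext = assms(20)

  \<comment> \<open>The two extensions and their Jacobians\<close>
  define S\<^sub>1 where "S\<^sub>1 = M\<^sub>1 \<inter> U\<^sub>1"
  define S\<^sub>2 where "S\<^sub>2 = M\<^sub>2 \<inter> U\<^sub>2"
  have GF: "\<And>x. x \<in> M\<^sub>1 \<Longrightarrow> G (F x) = x" and FM: "\<And>x. x \<in> M\<^sub>1 \<Longrightarrow> F x \<in> M\<^sub>2"
    and GM: "\<And>y. y \<in> M\<^sub>2 \<Longrightarrow> G y \<in> M\<^sub>1"
    using hom by (auto simp: homeomorphism_def)
  have FS: "F x \<in> S\<^sub>2" if "x \<in> S\<^sub>1" for x
    using that FM FU by (auto simp: S\<^sub>1_def S\<^sub>2_def)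
  obtain P where P: "\<And>n. holo_polynomial_map (P n)" and limP: "uniform_limit S\<^sub>1 P F sequentially"
    and limP1: "uniform_limit (disc_hull S\<^sub>1) P F\<^sub>1 sequentially"
    using ext unfolding disc_extension_def S\<^sub>1_def by blast
  obtain Q where Q: "\<And>n. holo_polynomial_map (Q n)" and limQ: "uniform_limit S\<^sub>2 Q G sequentially"
    using limG unfolding polynomial_limit_def S\<^sub>2_def by blast
  obtain F\<^sub>2 where limQ2: "uniform_limit (disc_hull S\<^sub>2) Q F\<^sub>2 sequentially"
    using disc_extension_exists[OF Q limQ] by blast
  have F1: "F\<^sub>1 x = F x" if "x \<in> S\<^sub>1" for x
    by (rule disc_extension_eq[OF limP limP1 that])
  have F2: "F\<^sub>2 x = G x" if "x \<in> S\<^sub>2" for x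
    by (rule disc_extension_eq[OF limQ limQ2 that])
  have push: "attached_disc S\<^sub>2 (\<lambda>\<zeta>. F\<^sub>1 (g \<zeta>))" if g: "attached_disc S\<^sub>1 g" for g
    using disc_extension_disc[OF P limP1 g] g F1 FS by (auto simp: attached_disc_def image_subset_iff)
  \<comment> \<open>Along a disc attached to \<open>S\<^sub>1\<close> both sides are analytic discs
    that agree on the circle.\<close>
  have inv: "F\<^sub>2 (F\<^sub>1 (g \<zeta>)) = g \<zeta>" if g: "attached_disc S\<^sub>1 g" and \<zeta>: "\<zeta> \<in> cball 0 1" for g \<zeta>
  proof (rule analytic_disc_eqI[OF disc_extension_disc[OF Q limQ2 push[OF g]] _ _ \<zeta>])
    show "analytic_disc g" using g by (simp add: attached_disc_def)
    fix \<tau> :: complex assume "\<tau> \<in> sphere 0 1"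
    then have "g \<tau> \<in> S\<^sub>1" using g by (auto simp: attached_disc_def)
    then show "F\<^sub>2 (F\<^sub>1 (g \<tau>)) = g \<tau>"
      using F1 F2 FS GF by (simp add: S\<^sub>1_def)
  qed
  have inv': "F\<^sub>2 (F\<^sub>1 z) = z" and hull2: "F\<^sub>1 z \<in> disc_hull S\<^sub>2" if "z \<in> disc_hull S\<^sub>1" for z
  proof -
    obtain g \<zeta> where g: "attached_disc S\<^sub>1 g" "\<zeta> \<in> cball 0 1" "z = g \<zeta>"
      using \<open>z \<in> disc_hull S\<^sub>1\<close> by (auto simp: disc_hull_def)
    then show "F\<^sub>2 (F\<^sub>1 z) = z" using inv by simp
    show "F\<^sub>1 z \<in> disc_hull S\<^sub>2" using push[OF g(1)] g unfolding disc_hull_def by blast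
  qed
  define \<Omega>\<^sub>1 where "\<Omega>\<^sub>1 = interior (disc_hull S\<^sub>1)"
  \<comment> \<open>Openness of this image comes from invariance of domain, \<open>F\<^sub>1\<close>
    being continuous and injective. Only then can \<open>F\<^sub>2\<close> be differentiated on it,
    and differentiating \<open>F\<^sub>2 \<circ> F\<^sub>1\<close> shows that the Jacobians are
    inverse to each other.\<close>
  define \<Omega>\<^sub>2 where "\<Omega>\<^sub>2 = F\<^sub>1 ` \<Omega>\<^sub>1"
  have \<Omega>1: "open \<Omega>\<^sub>1" "\<Omega>\<^sub>1 \<subseteq> disc_hull S\<^sub>1"
    by (auto simp: \<Omega>\<^sub>1_def interior_subset)
  have limP\<Omega>: "uniform_limit \<Omega>\<^sub>1 P F\<^sub>1 sequentially"
    by (rule uniform_limit_on_subset[OF limP1 \<Omega>1(2)])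
  have "continuous_on \<Omega>\<^sub>1 F\<^sub>1"
    by (rule uniform_limit_theorem[OF _ limP\<Omega>]) (use holo_polynomial_map_continuous[OF P] in auto)
  moreover have "inj_on F\<^sub>1 \<Omega>\<^sub>1"
    using inv' \<Omega>1(2) by (intro inj_on_inverseI[of _ F\<^sub>2]) auto
  ultimately have \<Omega>2: "open \<Omega>\<^sub>2"
    unfolding \<Omega>\<^sub>2_def using \<Omega>1(1) by (intro invariance_of_domain)
  have "\<Omega>\<^sub>2 \<subseteq> disc_hull S\<^sub>2" using hull2 \<Omega>1(2) by (auto simp: \<Omega>\<^sub>2_def)
  then have limQ\<Omega>: "uniform_limit \<Omega>\<^sub>2 Q F\<^sub>2 sequentially"
    by (rule uniform_limit_on_subset[OF limQ2])
  define J\<^sub>1 where "J\<^sub>1 = complex_jacobian F\<^sub>1"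
  define J\<^sub>2 where "J\<^sub>2 = complex_jacobian F\<^sub>2"
  note J1 = holo_polynomial_map_uniform_limit(1)[OF P \<Omega>1(1) limP\<Omega>, folded J\<^sub>1_def]
  note J2 = holo_polynomial_map_uniform_limit[OF Q \<Omega>2 limQ\<Omega>, folded J\<^sub>2_def]
  have J21: "J\<^sub>2 (F\<^sub>1 z) ** J\<^sub>1 z = mat 1" if z: "z \<in> \<Omega>\<^sub>1" for z
  proof -
    have "F\<^sub>1 z \<in> \<Omega>\<^sub>2" using z by (simp add: \<Omega>\<^sub>2_def)
    from has_derivative_compose[OF J1[OF z] J2(1)[OF this]]
    have "((\<lambda>x. F\<^sub>2 (F\<^sub>1 x)) has_derivative (\<lambda>v. J\<^sub>2 (F\<^sub>1 z) *v (J\<^sub>1 z *v v))) (at z)" .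
    then have "((\<lambda>x. x) has_derivative (\<lambda>v. J\<^sub>2 (F\<^sub>1 z) *v (J\<^sub>1 z *v v))) (at z)"
      by (rule has_derivative_transform_within_open[OF _ \<Omega>1(1) z]) (use inv' \<Omega>1(2) in auto)
    from has_derivative_unique[OF this has_derivative_ident]
    show ?thesis by (simp add: matrix_eq matrix_vector_mul_assoc[symmetric] fun_eq_iff)
  qed

  \<comment> \<open>Local data at \<open>F p\<close> and the choice of constants\<close>
  define q where "q = F p"
  have "q \<in> M\<^sub>2" using FM p by (simp add: q_def)
  obtain k \<rho> s L A b where s: "0 < s" and L0: "0 \<le> L" and sU: "cball q s \<subseteq> U\<^sub>2"
    and Miff: "\<And>z. z \<in> cball q s \<Longrightarrow> z \<in> M\<^sub>2 \<longleftrightarrow> (\<forall>j<(k::nat). \<rho> j z = (0::real))"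
    and d\<rho>: "\<And>j x. j < k \<Longrightarrow> x \<in> cball q s \<Longrightarrow> (\<rho> j has_derivative frechet_derivative (\<rho> j) (at x)) (at x)"
    and L: "\<And>j x y v. j < k \<Longrightarrow> x \<in> cball q s \<Longrightarrow> y \<in> cball q s \<Longrightarrow>
        norm (frechet_derivative (\<rho> j) (at x) v - frechet_derivative (\<rho> j) (at y) v) \<le> L * norm (x - y) * norm v"
    and dq: "\<And>j v. j < k \<Longrightarrow> frechet_derivative (\<rho> j) (at q) v = Re (pairing (A j) v)"
    and AB: "\<And>i j. i < k \<Longrightarrow> j < k \<Longrightarrow> pairing (A i) (b j) = (if i = j then 1 else 0)"
    by (rule generic_manifold_local[OF gen2 \<open>q \<in> M\<^sub>2\<close> U2(1) U2(2)[folded q_def]]) (rule that; assumption)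
  \<comment> \<open>Removing the linear part at q leaves a function whose derivative vanishes there,
    as the contraction in \<open>bishop_discs\<close> requires.\<close>
  define r where "r j x = \<rho> j x - Re (pairing (A j) (x - q))" for j x
  define Dr where "Dr j x v = frechet_derivative (\<rho> j) (at x) v - Re (pairing (A j) v)" for j x v
  define c where "c = 1 + (\<Sum>j<k. norm (A j) * norm (b j))"
  have c: "1 \<le> c" by (simp add: c_def sum_nonneg)
  define \<eta> where "\<eta> = 1 / (4 * c * real CARD('n))"
  have \<eta>: "0 < \<eta>" "4 * \<eta> * c * real CARD('n) \<le> 1" using c by (simp_all add: \<eta>_def)
  have blA: "bounded_linear (\<lambda>v. Re (pairing (A j) v))" for j
    by (rule bounded_linear_compose[OF bounded_linear_Re bounded_linear_pairing])
  \<comment> \<open>The exponent of an \<alpha>-Hoelder map composed with a \<beta>-Hoelder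
    disc.\<close>
  define \<gamma> where "\<gamma> = \<alpha> * \<beta>"
  have \<gamma>: "0 < \<gamma>" "\<gamma> < 1"
    using \<alpha> \<beta> mult_strict_mono[of \<alpha> 1 \<beta> 1] by (auto simp: \<gamma>_def)
  have "\<exists>\<delta>>0. 2 * \<delta> \<le> s \<and> (\<forall>f e. holder_bound \<gamma> (sphere 0 1) \<delta> (\<lambda>\<zeta>. f \<zeta> - q) \<longrightarrow>
    (\<exists>t \<phi> g. bishop_variation k r b \<delta> \<eta> f e t \<phi> g))"
  proof (rule bishop_discs[OF \<gamma> s L0 \<eta>(1)])
    show "(r j has_derivative Dr j x) (at x)" if "j < k" "x \<in> cball q s" for j x
    proof -
      have "((\<lambda>x. Re (pairing (A j) (x - q))) has_derivative (\<lambda>v. Re (pairing (A j) v))) (at x)"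
        by (rule bounded_linear.has_derivative[OF blA]) (auto intro!: derivative_eq_intros)
      from has_derivative_diff[OF d\<rho>[OF that] this] show ?thesis
        by (simp add: r_def[abs_def] Dr_def[abs_def])
    qed
    show "norm (Dr j x v - Dr j y v) \<le> L * norm (x - y) * norm v"
      if "j < k" "x \<in> cball q s" "y \<in> cball q s" for j x y v
      using L[OF that, of v] by (simp add: Dr_def)
    show "Dr j q v = 0" if "j < k" for j v using dq[OF that] by (simp add: Dr_def)
  qed (rule AB)
  then obtain \<delta> where \<delta>: "0 < \<delta>" "2 * \<delta> \<le> s" and bishop:
    "\<And>f e. holder_bound \<gamma> (sphere 0 1) \<delta> (\<lambda>\<zeta>. f \<zeta> - q) \<Longrightarrow>
      \<exists>t \<phi> g. bishop_variation k r b \<delta> \<eta> f e t \<phi> g"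
    by blast
  define B where "B = (\<Sum>j<k. norm (b j))"
  have B: "0 \<le> L * B" using L0 by (simp add: B_def sum_nonneg)
  define \<delta>' where "\<delta>' = min \<delta> (1 / (4 * (L * B + 1)))"
  have \<delta>': "0 < \<delta>'" "\<delta>' \<le> \<delta>" using \<delta> B by (auto simp: \<delta>'_def)
  have "(L * B) * \<delta>' \<le> (L * B) * (1 / (4 * (L * B + 1)))"
    using B by (intro mult_left_mono) (auto simp: \<delta>'_def)
  also have "\<dots> \<le> 1 / 4" using B by (simp add: divide_simps)
  finally have \<kappa>: "L * \<delta>' * B \<le> 1 / 4" by (simp add: mult_ac)
  obtain C where C: "\<And>x y. x \<in> M\<^sub>1 \<Longrightarrow> y \<in> M\<^sub>1 \<Longrightarrow> dist (F x) (F y) \<le> C * dist x y powr \<alpha>"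
    using holF unfolding holder_on_def by blast
  define C' where "C' = \<bar>C\<bar> + 1"
  have C': "0 < C'" "C \<le> C'" by (auto simp: C'_def)
  \<comment> \<open>The solution of C' \<epsilon>^\<alpha> = \<delta>', so that an \<epsilon>-small
    disc is mapped to a \<delta>'-small one.\<close>
  define \<epsilon> where "\<epsilon> = (\<delta>' / C') powr (1 / \<alpha>)"
  have "0 < \<delta>' / C'" using \<delta>' C' by simp
  then have \<epsilon>: "0 < \<epsilon>" "\<epsilon> powr \<alpha> = \<delta>' / C'"
    using \<alpha> \<delta>' C' by (simp_all add: \<epsilon>_def powr_powr)
  show ?thesis
  proof (intro exI[of _ \<epsilon>] conjI allI impI; (elim conjE)?)
    show "0 < \<epsilon>" by fact
  next
    fix D and f\<^sub>1 f\<^sub>1' :: "complex \<Rightarrow> complex ^ 'n"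
    assume "D \<subseteq> interior (disc_hull (M\<^sub>1 \<inter> U\<^sub>1))" and st: "stationary_disc M\<^sub>1 f\<^sub>1"
      and f1S: "f\<^sub>1 ` sphere 0 1 \<subseteq> M\<^sub>1 \<inter> U\<^sub>1" and f1h: "holder_on \<beta> (cball 0 1) f\<^sub>1"
      and f1n: "holder_norm \<beta> (cball 0 1) (\<lambda>\<zeta>. f\<^sub>1 \<zeta> - p) < \<epsilon>"
      and "f\<^sub>1 ` ball 0 1 \<subseteq> D" and sup: "supporting_lift M\<^sub>1 f\<^sub>1 f\<^sub>1'"
    then have f1\<Omega>: "f\<^sub>1 \<zeta> \<in> \<Omega>\<^sub>1" if "\<zeta> \<in> ball 0 1" for \<zeta>
      using that unfolding \<Omega>\<^sub>1_def S\<^sub>1_def by blast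

    \<comment> \<open>The image disc and its Hoelder bound\<close>
    have f1d: "analytic_disc f\<^sub>1" using st by (simp add: stationary_disc_def attached_disc_def)
    have f1a: "attached_disc S\<^sub>1 f\<^sub>1" using f1d f1S by (simp add: attached_disc_def S\<^sub>1_def)
    define f\<^sub>2 where "f\<^sub>2 = F\<^sub>1 \<circ> f\<^sub>1"
    have f2: "f\<^sub>2 \<zeta> = F\<^sub>1 (f\<^sub>1 \<zeta>)" for \<zeta> by (simp add: f\<^sub>2_def)
    have f2a: "attached_disc S\<^sub>2 f\<^sub>2"
      using push[OF f1a] by (simp add: f\<^sub>2_def o_def)
    have f2d: "analytic_disc f\<^sub>2" using f2a by (simp add: attached_disc_def)
    have f2F: "f\<^sub>2 \<zeta> = F (f\<^sub>1 \<zeta>)" "f\<^sub>1 \<zeta> \<in> M\<^sub>1" if "\<zeta> \<in> sphere 0 1" for \<zeta>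
      using f1S F1 that unfolding f2 S\<^sub>1_def by blast+
    have f2M: "f\<^sub>2 \<zeta> \<in> M\<^sub>2" if "\<zeta> \<in> sphere 0 1" for \<zeta>
      using f2F[OF that] FM by simp
    have holp: "holder_on \<beta> (cball 0 1) (\<lambda>\<zeta>. f\<^sub>1 \<zeta> - p)"
      using f1h by (simp add: holder_on_def dist_norm)
    have "compact ((\<lambda>\<zeta>. f\<^sub>1 \<zeta> - p) ` cball 0 1)"
      using f1d by (intro compact_continuous_image continuous_intros) (auto simp: analytic_disc_def)
    then have bdd: "bounded ((\<lambda>\<zeta>. f\<^sub>1 \<zeta> - p) ` cball 0 1)" by (rule compact_imp_bounded)
    note hn = holder_norm_bounds[OF holp bdd f1n]
    have f2h': "holder_bound \<gamma> (sphere 0 1) \<delta>' (\<lambda>\<zeta>. f\<^sub>2 \<zeta> - q)"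
    proof (rule holder_boundI)
      fix \<zeta> :: complex assume \<zeta>: "\<zeta> \<in> sphere 0 1"
      have "norm (f\<^sub>2 \<zeta> - q) \<le> C * dist (f\<^sub>1 \<zeta>) p powr \<alpha>"
        using C[OF f2F(2)[OF \<zeta>] p] f2F(1)[OF \<zeta>] by (simp add: q_def dist_norm)
      also have "\<dots> \<le> C' * \<epsilon> powr \<alpha>"
        using C' hn(1)[of \<zeta>] \<zeta> \<alpha> by (intro mult_mono powr_mono2) (auto simp: dist_norm)
      also have "\<dots> = \<delta>'" using C' by (simp add: \<epsilon>)
      finally show "norm (f\<^sub>2 \<zeta> - q) \<le> \<delta>'" .
    next
      fix x y :: complex assume xy: "x \<in> sphere 0 1" "y \<in> sphere 0 1"
      have "norm (f\<^sub>1 x - f\<^sub>1 y) \<le> \<epsilon> * dist x y powr \<beta>"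
        using hn(2)[of x y] xy by simp
      then have "dist (f\<^sub>1 x) (f\<^sub>1 y) powr \<alpha> \<le> (\<epsilon> * dist x y powr \<beta>) powr \<alpha>"
        using \<alpha> by (intro powr_mono2) (auto simp: dist_norm)
      also have "\<dots> = \<epsilon> powr \<alpha> * dist x y powr \<gamma>"
        using \<epsilon>(1) by (simp add: powr_mult powr_powr \<gamma>_def mult.commute)
      finally have 1: "dist (f\<^sub>1 x) (f\<^sub>1 y) powr \<alpha> \<le> \<epsilon> powr \<alpha> * dist x y powr \<gamma>" .
      have "norm (f\<^sub>2 x - q - (f\<^sub>2 y - q)) \<le> C * dist (f\<^sub>1 x) (f\<^sub>1 y) powr \<alpha>"
        using C[OF f2F(2)[OF xy(1)] f2F(2)[OF xy(2)]] f2F(1)[OF xy(1)] f2F(1)[OF xy(2)] by (simp add: dist_norm)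
      also have "\<dots> \<le> C' * (\<epsilon> powr \<alpha> * dist x y powr \<gamma>)"
        using C' 1 by (intro mult_mono) auto
      also have "\<dots> = \<delta>' * dist x y powr \<gamma>" using C' by (simp add: \<epsilon>)
      finally show "norm (f\<^sub>2 x - q - (f\<^sub>2 y - q)) \<le> \<delta>' * dist x y powr \<gamma>" .
    qed
    have f2h: "holder_bound \<gamma> (sphere 0 1) \<delta> (\<lambda>\<zeta>. f\<^sub>2 \<zeta> - q)"
      by (rule holder_bound_mono[OF f2h' \<delta>'(2)])
    have f2q: "norm (f\<^sub>2 \<zeta> - q) \<le> \<delta>'" if "\<zeta> \<in> sphere 0 1" for \<zeta>
      by (rule holder_bound_norm[OF f2h' that])
    have f2s: "f\<^sub>2 \<zeta> \<in> ball q s" "f\<^sub>2 \<zeta> \<in> cball q s" if "\<zeta> \<in> sphere 0 1" for \<zeta>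
      using f2q[OF that] \<delta> \<delta>' by (auto simp: dist_norm norm_minus_commute)
    have lift1: "is_lift M\<^sub>1 f\<^sub>1 f\<^sub>1'" using sup by (simp add: supporting_lift_def nonzero_lift_def)
    obtain a where a: "analytic_disc a" "\<And>\<zeta>. \<zeta> \<in> cball 0 1 - {0} \<Longrightarrow> a \<zeta> = \<zeta> *s f\<^sub>1' \<zeta>"
      using lift_times_zeta[OF lift1] by blast

    \<comment> \<open>The lift inside the disc and its boundary values\<close>
    define g where "g \<zeta> = f\<^sub>1' \<zeta> v* matrix_inv (J\<^sub>1 (f\<^sub>1 \<zeta>))" for \<zeta>
    \<comment> \<open>In this form holomorphy can be read off, since the entries of
      \<open>J\<^sub>2\<close> are holomorphic along \<open>f\<^sub>2\<close>.\<close>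
    have g: "g \<zeta> = f\<^sub>1' \<zeta> v* J\<^sub>2 (f\<^sub>2 \<zeta>)" if "\<zeta> \<in> ball 0 1" for \<zeta>
      using matrix_inv_unique_left[OF J21[OF f1\<Omega>[OF that]]] by (simp add: g_def f2)
    have f2\<Omega>: "f\<^sub>2 ` ball 0 1 \<subseteq> \<Omega>\<^sub>2" using f1\<Omega> by (auto simp: \<Omega>\<^sub>2_def f2)
    have J2hol: "(\<lambda>\<zeta>. J\<^sub>2 (f\<^sub>2 \<zeta>) $ i $ j) holomorphic_on ball 0 1" for i j
      using f2d by (intro J2(2) f2\<Omega>) (auto simp: analytic_disc_def)
    \<comment> \<open>On the circle the formula for \<open>g\<close> carries no information, as
      \<open>F\<^sub>1\<close> need not be differentiable there; \<open>H\<close> agrees with it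
      inside and supplies the boundary values.\<close>
    obtain H where H: "continuous_on (cball 0 1 - {0}) H" "\<And>\<zeta>. \<zeta> \<in> ball 0 1 - {0} \<Longrightarrow> H \<zeta> = g \<zeta>"
      and Hc: "\<And>\<zeta> X. \<zeta> \<in> sphere 0 1 \<Longrightarrow> (\<And>j. j < k \<Longrightarrow> frechet_derivative (\<rho> j) (at (f\<^sub>2 \<zeta>)) X = 0) \<Longrightarrow>
        Re (pairing (H \<zeta>) X) = 0"
    proof (rule conormal_extension[of k A b "\<lambda>j \<zeta>. frechet_derivative (\<rho> j) (at (f\<^sub>2 \<zeta>))" "L * \<delta>'" \<eta> g])
      show "bounded_linear (frechet_derivative (\<rho> j) (at (f\<^sub>2 \<zeta>)))" if "j < k" "\<zeta> \<in> sphere 0 1" for j \<zeta>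
        using d\<rho>[OF that(1) f2s(2)[OF that(2)]] by (rule has_derivative_bounded_linear)
      show "\<bar>frechet_derivative (\<rho> j) (at (f\<^sub>2 \<zeta>)) X - Re (pairing (A j) X)\<bar> \<le> L * \<delta>' * norm X"
        if "j < k" "\<zeta> \<in> sphere 0 1" for j \<zeta> X
      proof -
        have "norm (frechet_derivative (\<rho> j) (at (f\<^sub>2 \<zeta>)) X - frechet_derivative (\<rho> j) (at q) X) \<le> L * norm (f\<^sub>2 \<zeta> - q) * norm X"
          using s by (intro L[OF that(1) f2s(2)[OF that(2)]]) auto
        also have "\<dots> \<le> L * \<delta>' * norm X"
          using f2q[OF that(2)] L0 by (intro mult_right_mono mult_left_mono) auto
        finally show ?thesis by (simp add: dq[OF that(1)])
      qed
      show "L * \<delta>' * (\<Sum>j<k. norm (b j)) \<le> 1 / 4" using \<kappa> by (simp add: B_def)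
      show "4 * \<eta> * (1 + (\<Sum>j<k. norm (A j) * norm (b j))) * real CARD('n) \<le> 1"
        using \<eta>(2) unfolding c_def .
      fix e assume e: "\<And>j. j < k \<Longrightarrow> Re (pairing (A j) e) = 0"
      obtain t \<phi> w where t: "\<And>n. 0 < t n" "t \<longlonglongrightarrow> 0" and \<phi>: "analytic_disc \<phi>"
        and \<phi>e: "\<And>\<zeta>. \<zeta> \<in> cball 0 1 \<Longrightarrow> norm (\<phi> \<zeta> - e) \<le> \<eta> * norm e"
        and wd: "\<And>\<sigma> n. \<sigma> \<in> {1, -1 :: real} \<Longrightarrow> analytic_disc (w \<sigma> n)"
        and wn: "\<And>\<sigma> n \<zeta>. \<sigma> \<in> {1, -1} \<Longrightarrow> \<zeta> \<in> sphere 0 1 \<Longrightarrow> norm (w \<sigma> n \<zeta>) \<le> \<delta>"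
        and wc: "\<And>\<sigma> n \<zeta>. \<sigma> \<in> {1, -1} \<Longrightarrow> \<zeta> \<in> sphere 0 1 \<Longrightarrow>
            \<exists>c. w \<sigma> n \<zeta> = (\<sigma> * t n) *\<^sub>R e + (\<Sum>j<k. c j *s b j) \<and>
              (\<forall>j<k. Re (c j) = r j (f\<^sub>2 \<zeta>) - r j (f\<^sub>2 \<zeta> + w \<sigma> n \<zeta>))"
        and wlim: "\<And>\<sigma> \<zeta>. \<sigma> \<in> {1, -1} \<Longrightarrow> \<zeta> \<in> cball 0 1 \<Longrightarrow> (\<lambda>n. (1 / (\<sigma> * t n)) *\<^sub>R w \<sigma> n \<zeta>) \<longlonglongrightarrow> \<phi> \<zeta>"
      proof -
        obtain t \<phi> w where "bishop_variation k r b \<delta> \<eta> f\<^sub>2 e t \<phi> w"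
          using bishop[OF f2h, of e] by blast
        then show thesis unfolding bishop_variation_def by (intro that[of t \<phi> w]) blast+
      qed
      have nz: "\<sigma> * t n \<noteq> 0" if "\<sigma> \<in> {1, -1}" for \<sigma> n using that t(1)[of n] by auto
      \<comment> \<open>Since e is tangent at q and b is dual to \<open>A\<close>, pairing A_j with
        the perturbation has real part Re c_j, which is exactly the amount that compensates the
        change of \<open>r j\<close>. So \<rho>_j keeps the value 0.\<close>
      have pert: "f\<^sub>2 \<zeta> + w \<sigma> n \<zeta> \<in> cball q s" "j < k \<Longrightarrow> \<rho> j (f\<^sub>2 \<zeta> + w \<sigma> n \<zeta>) = 0"
        if \<sigma>: "\<sigma> \<in> {1, -1}" and \<zeta>: "\<zeta> \<in> sphere 0 1" for \<sigma> \<zeta> n j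
      proof -
        have "norm (f\<^sub>2 \<zeta> - q + w \<sigma> n \<zeta>) \<le> s"
          using norm_triangle_ineq[of "f\<^sub>2 \<zeta> - q" "w \<sigma> n \<zeta>"] f2q[OF \<zeta>] wn[OF \<sigma> \<zeta>, of n] \<delta> \<delta>' by simp
        then show "f\<^sub>2 \<zeta> + w \<sigma> n \<zeta> \<in> cball q s"
          by (simp add: dist_norm norm_minus_commute algebra_simps)
        assume j: "j < k"
        obtain c where c: "w \<sigma> n \<zeta> = (\<sigma> * t n) *\<^sub>R e + (\<Sum>j<k. c j *s b j)"
          "Re (c j) = r j (f\<^sub>2 \<zeta>) - r j (f\<^sub>2 \<zeta> + w \<sigma> n \<zeta>)"
          using wc[OF \<sigma> \<zeta>, of n] j by blast
        interpret bounded_linear "pairing (A j)" by (rule bounded_linear_pairing)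
        have "pairing (A j) (\<Sum>i<k. c i *s b i) = (\<Sum>i<k. c i * pairing (A j) (b i))"
          by (simp add: sum pairing_scale)
        also have "\<dots> = (\<Sum>i<k. if j = i then c i else 0)"
          using AB[OF j] by (intro sum.cong) (auto split: if_splits)
        also have "\<dots> = c j" using j by simp
        finally have "Re (pairing (A j) (w \<sigma> n \<zeta>)) = Re (c j)"
          unfolding c(1) by (simp add: add scaleR e[OF j])
        moreover have "\<rho> j (f\<^sub>2 \<zeta>) = 0"
          using Miff[OF f2s(2)[OF \<zeta>]] f2M[OF \<zeta>] j by blast
        ultimately show "\<rho> j (f\<^sub>2 \<zeta> + w \<sigma> n \<zeta>) = 0"
          using c(2) by (simp add: r_def add diff)
      qed
      have att: "attached_disc S\<^sub>2 (\<lambda>\<zeta>. f\<^sub>2 \<zeta> + w \<sigma> n \<zeta>)" if \<sigma>: "\<sigma> \<in> {1, -1}" for \<sigma> n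
      proof -
        have "f\<^sub>2 \<zeta> + w \<sigma> n \<zeta> \<in> S\<^sub>2" if "\<zeta> \<in> sphere 0 1" for \<zeta>
          using pert[OF \<sigma> that] Miff sU unfolding S\<^sub>2_def by blast
        then show ?thesis
          using analytic_disc_add[OF f2d wd[OF \<sigma>]] unfolding attached_disc_def by blast
      qed
      \<comment> \<open>The first variation of the discs \<open>F\<^sub>2 (f\<^sub>2 + w)\<close>,
        which are attached to \<open>M\<^sub>1\<close> and therefore admissible in the support
        inequality.\<close>
      define \<Psi> where "\<Psi> \<zeta> = J\<^sub>2 (f\<^sub>2 \<zeta>) *v \<phi> \<zeta>" for \<zeta>
      have "\<exists>c. \<exists>b::real. \<forall>\<zeta>\<in>ball 0 1. pairing (a \<zeta>) (\<Psi> \<zeta>) = c + \<i> * b * \<zeta> - cnj c * \<zeta>\<^sup>2"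
      proof (rule lift_variation[OF a(1) f1d, of "\<lambda>\<sigma> n \<zeta>. F\<^sub>2 (f\<^sub>2 \<zeta> + w \<sigma> n \<zeta>)" t])
        fix \<sigma> :: real assume \<sigma>: "\<sigma> \<in> {1, -1}"
        show "analytic_disc (\<lambda>\<zeta>. F\<^sub>2 (f\<^sub>2 \<zeta> + w \<sigma> n \<zeta>))" for n
          by (rule disc_extension_disc[OF Q limQ2 att[OF \<sigma>]])
        show "0 \<le> Re (pairing (a \<zeta>) (F\<^sub>2 (f\<^sub>2 \<zeta> + w \<sigma> n \<zeta>) - f\<^sub>1 \<zeta>) / \<zeta>)" if \<zeta>: "\<zeta> \<in> sphere 0 1" for \<zeta> n
        proof -
          have "f\<^sub>2 \<zeta> + w \<sigma> n \<zeta> \<in> S\<^sub>2" using att[OF \<sigma>, of n] \<zeta> unfolding attached_disc_def by blast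
          then have "F\<^sub>2 (f\<^sub>2 \<zeta> + w \<sigma> n \<zeta>) \<in> M\<^sub>1" using F2 GM by (simp add: S\<^sub>2_def)
          then have "0 \<le> Re (pairing (f\<^sub>1' \<zeta>) (F\<^sub>2 (f\<^sub>2 \<zeta> + w \<sigma> n \<zeta>) - f\<^sub>1 \<zeta>))"
            using sup \<zeta> unfolding supporting_lift_def by blast
          moreover have z0: "\<zeta> \<noteq> 0" using \<zeta> by auto
          moreover have "a \<zeta> = \<zeta> *s f\<^sub>1' \<zeta>" using \<zeta> z0 by (intro a(2)) simp
          ultimately show ?thesis
            by (simp add: pairing_commute[of "\<zeta> *s f\<^sub>1' \<zeta>"] pairing_scale) (simp add: pairing_commute)
        qed
        show "(\<lambda>n. (1 / (\<sigma> * t n)) *\<^sub>R (F\<^sub>2 (f\<^sub>2 \<zeta> + w \<sigma> n \<zeta>) - f\<^sub>1 \<zeta>)) \<longlonglongrightarrow> \<Psi> \<zeta>" if \<zeta>: "\<zeta> \<in> ball 0 1" for \<zeta>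
        proof -
          have "f\<^sub>2 \<zeta> \<in> \<Omega>\<^sub>2" using f2\<Omega> \<zeta> by blast
          moreover have "(\<lambda>n. \<sigma> * t n) \<longlonglongrightarrow> 0" by (rule tendsto_mult_right_zero[OF t(2)])
          ultimately have "(\<lambda>n. (1 / (\<sigma> * t n)) *\<^sub>R (F\<^sub>2 (f\<^sub>2 \<zeta> + (\<sigma> * t n) *\<^sub>R ((1 / (\<sigma> * t n)) *\<^sub>R w \<sigma> n \<zeta>)) - F\<^sub>2 (f\<^sub>2 \<zeta>))) \<longlonglongrightarrow> J\<^sub>2 (f\<^sub>2 \<zeta>) *v \<phi> \<zeta>"
            using \<zeta> nz[OF \<sigma>] by (intro directional_difference_quotient[OF J2(1)] wlim[OF \<sigma>]) auto
          moreover have "(\<sigma> * t n) *\<^sub>R ((1 / (\<sigma> * t n)) *\<^sub>R w \<sigma> n \<zeta>) = w \<sigma> n \<zeta>" for n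
            using nz[OF \<sigma>, of n] by simp
          moreover have "F\<^sub>2 (f\<^sub>2 \<zeta>) = f\<^sub>1 \<zeta>" using inv[OF f1a, of \<zeta>] \<zeta> by (simp add: f2)
          ultimately show ?thesis by (simp only: \<Psi>_def)
        qed
      next
        show "(\<lambda>\<zeta>. \<Psi> \<zeta> $ j) holomorphic_on ball 0 1" for j
        proof -
          have "(\<lambda>\<zeta>. \<Sum>i\<in>UNIV. J\<^sub>2 (f\<^sub>2 \<zeta>) $ j $ i * \<phi> \<zeta> $ i) holomorphic_on ball 0 1"
            using \<phi> by (intro holomorphic_intros J2hol) (auto simp: analytic_disc_def)
          then show ?thesis by (simp add: \<Psi>_def matrix_vector_mult_def)
        qed
      qed (rule t(1))
      then obtain z y where zy: "\<And>\<zeta>. \<zeta> \<in> ball 0 1 \<Longrightarrow> pairing (a \<zeta>) (\<Psi> \<zeta>) = z + \<i> * complex_of_real y * \<zeta> - cnj z * \<zeta>\<^sup>2"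
        by blast
      \<comment> \<open>An explicit function, continuous up to the circle, where it is imaginary
        because 1/\<zeta> is the conjugate of \<zeta>. It provides the boundary values of the
        pairing of \<open>g\<close> with \<phi>.\<close>
      define \<sigma> where "\<sigma> \<zeta> = (z + \<i> * y * \<zeta> - cnj z * \<zeta>\<^sup>2) / \<zeta>" for \<zeta>
      have "continuous_on (cball 0 1) \<phi>" using \<phi> by (simp add: analytic_disc_def)
      \<comment> \<open>Differentiate \<rho>_j = 0 along the perturbed discs: at a boundary point
        they lie in \<open>M\<^sub>2\<close>, so their first-order term is in the kernel.\<close>
      moreover have "frechet_derivative (\<rho> j) (at (f\<^sub>2 \<zeta>)) (\<phi> \<zeta>) = 0" if \<zeta>: "\<zeta> \<in> sphere 0 1" and j: "j < k" for \<zeta> j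
      proof -
        have "(\<lambda>n. (1 / (1 * t n)) *\<^sub>R (\<rho> j (f\<^sub>2 \<zeta> + (1 * t n) *\<^sub>R ((1 / (1 * t n)) *\<^sub>R w 1 n \<zeta>)) - \<rho> j (f\<^sub>2 \<zeta>)))
            \<longlonglongrightarrow> frechet_derivative (\<rho> j) (at (f\<^sub>2 \<zeta>)) (\<phi> \<zeta>)"
        proof (rule directional_difference_quotient[OF d\<rho>[OF j f2s(2)[OF \<zeta>]]])
          show "(\<lambda>n. 1 * t n) \<longlonglongrightarrow> 0" using t(2) by simp
          show "1 * t n \<noteq> 0" for n by (rule nz) simp
          show "(\<lambda>n. (1 / (1 * t n)) *\<^sub>R w 1 n \<zeta>) \<longlonglongrightarrow> \<phi> \<zeta>" by (rule wlim) (use \<zeta> in auto)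
        qed
        moreover have "(1 * t n) *\<^sub>R ((1 / (1 * t n)) *\<^sub>R w 1 n \<zeta>) = w 1 n \<zeta>" for n
          using nz[of 1 n] by simp
        moreover have "\<rho> j (f\<^sub>2 \<zeta> + w 1 n \<zeta>) = 0" for n by (rule pert(2)) (use \<zeta> j in auto)
        moreover have "\<rho> j (f\<^sub>2 \<zeta>) = 0"
          using Miff[OF f2s(2)[OF \<zeta>]] f2M[OF \<zeta>] j by blast
        ultimately have "(\<lambda>n. 0) \<longlonglongrightarrow> frechet_derivative (\<rho> j) (at (f\<^sub>2 \<zeta>)) (\<phi> \<zeta>)"
          by (simp only: diff_self scaleR_zero_right)
        then show ?thesis by (simp add: LIMSEQ_const_iff)
      qed
      moreover have "continuous_on (cball 0 1 - {0}) \<sigma>"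
        unfolding \<sigma>_def[abs_def] by (intro continuous_intros) auto
      moreover have "Re (\<sigma> \<zeta>) = 0" if \<zeta>: "\<zeta> \<in> sphere 0 1" for \<zeta>
      proof -
        have z0: "\<zeta> \<noteq> 0" and zz: "1 / \<zeta> = cnj \<zeta>"
          using \<zeta> complex_div_cnj[of 1 \<zeta>] by auto
        have "\<sigma> \<zeta> = z * (1 / \<zeta>) + \<i> * y - cnj z * \<zeta>"
          using z0 by (simp add: \<sigma>_def add_divide_distrib diff_divide_distrib power2_eq_square)
        also have "\<dots> = \<i> * y + (z * cnj \<zeta> - cnj (z * cnj \<zeta>))" by (simp add: zz)
        finally show ?thesis by simp
      qed
      moreover have "pairing (g \<zeta>) (\<phi> \<zeta>) = \<sigma> \<zeta>" if \<zeta>: "\<zeta> \<in> ball 0 1 - {0}" for \<zeta>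
      proof -
        have "pairing (a \<zeta>) (\<Psi> \<zeta>) = \<zeta> * pairing (f\<^sub>1' \<zeta>) (\<Psi> \<zeta>)"
          using a(2)[of \<zeta>] \<zeta> by (simp add: pairing_commute[of "\<zeta> *s f\<^sub>1' \<zeta>"] pairing_scale) (simp add: pairing_commute)
        also have "pairing (f\<^sub>1' \<zeta>) (\<Psi> \<zeta>) = pairing (g \<zeta>) (\<phi> \<zeta>)"
          using g[of \<zeta>] \<zeta> by (simp add: \<Psi>_def pairing_vector_matrix)
        finally show ?thesis using zy[of \<zeta>] \<zeta> by (simp add: \<sigma>_def eq_divide_eq mult.commute)
      qed
      ultimately show "\<exists>\<phi> s. continuous_on (cball 0 1) \<phi> \<and> (\<forall>\<zeta>\<in>cball 0 1. norm (\<phi> \<zeta> - e) \<le> \<eta> * norm e) \<and>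
        (\<forall>\<zeta>\<in>sphere 0 1. \<forall>j<k. frechet_derivative (\<rho> j) (at (f\<^sub>2 \<zeta>)) (\<phi> \<zeta>) = 0) \<and>
        continuous_on (cball 0 1 - {0}) s \<and> (\<forall>\<zeta>\<in>sphere 0 1. Re (s \<zeta>) = 0) \<and>
        (\<forall>\<zeta>\<in>ball 0 1 - {0}. pairing (g \<zeta>) (\<phi> \<zeta>) = s \<zeta>)"
        using \<phi>e by (intro exI[of _ \<phi>] exI[of _ \<sigma>]) blast
    qed (use AB \<eta>(1) in auto)

    \<comment> \<open>The lift conditions and nonvanishing\<close>
    define h where "h j \<zeta> = (\<Sum>i\<in>UNIV. J\<^sub>2 (f\<^sub>2 \<zeta>) $ i $ j * a \<zeta> $ i)" for j \<zeta>
    have h: "h j holomorphic_on ball 0 1" for j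
      unfolding h_def[abs_def] using a(1) by (intro holomorphic_intros J2hol) (auto simp: analytic_disc_def)
    have hH: "h j \<zeta> = \<zeta> * H \<zeta> $ j" if "\<zeta> \<in> ball 0 1 - {0}" for j \<zeta>
      using H(2)[OF that] g[of \<zeta>] a(2)[of \<zeta>] that
      by (simp add: h_def vector_matrix_mult_def sum_distrib_left mult_ac)
    have lift2: "is_lift M\<^sub>2 f\<^sub>2 H"
      unfolding is_lift_def
    proof (intro conjI allI ballI)
      show "continuous_on (cball 0 1 - {0}) H" by (rule H(1))
      show "(\<lambda>\<zeta>. H \<zeta> $ j) holomorphic_on ball 0 1 - {0}" for j
      proof -
        have "(\<lambda>\<zeta>. h j \<zeta> / \<zeta>) holomorphic_on ball 0 1 - {0}"
          by (intro holomorphic_intros holomorphic_on_subset[OF h]) auto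
        then show ?thesis by (rule holomorphic_transform) (use hH in auto)
      qed
      show "\<exists>h. h holomorphic_on ball 0 1 \<and> (\<forall>\<zeta>\<in>ball 0 1 - {0}. h \<zeta> = \<zeta> * H \<zeta> $ j)" for j
        using h hH by blast
      fix \<zeta> :: complex and X assume \<zeta>: "\<zeta> \<in> sphere 0 1" and X: "X \<in> tangent_space M\<^sub>2 (f\<^sub>2 \<zeta>)"
      show "Re (pairing (H \<zeta>) X) = 0"
      proof (rule Hc[OF \<zeta>])
        fix j assume j: "j < k"
        show "frechet_derivative (\<rho> j) (at (f\<^sub>2 \<zeta>)) X = 0"
        proof (rule tangent_space_kernel[OF X open_ball f2s(1)[OF \<zeta>]])
          show "\<rho> j x = 0" if "x \<in> M\<^sub>2 \<inter> ball q s" for x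
            using Miff[of x] that j by auto
        qed (rule d\<rho>[OF j f2s(2)[OF \<zeta>]])
      qed
    qed
    \<comment> \<open>If \<open>H\<close> vanished, multiplication by the invertible
      \<open>J\<^sub>1\<close> would make \<open>f\<^sub>1'\<close> vanish in the punctured disc
      and, by continuity, on the circle.\<close>
    have "\<exists>\<zeta>\<in>cball 0 1 - {0}. H \<zeta> \<noteq> 0"
    proof (rule ccontr)
      assume neg: "\<not> ?thesis"
      have zero: "f\<^sub>1' \<zeta> = 0" if "\<zeta> \<in> ball 0 1 - {0}" for \<zeta>
      proof -
        have \<zeta>: "\<zeta> \<in> ball 0 1" using that by simp
        have "H \<zeta> = 0" using neg that by auto
        then have "g \<zeta> = 0" using H(2)[OF that] by simp
        then have "f\<^sub>1' \<zeta> v* J\<^sub>2 (f\<^sub>2 \<zeta>) = 0" using g[OF \<zeta>] by simp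
        then have "f\<^sub>1' \<zeta> v* (J\<^sub>2 (f\<^sub>2 \<zeta>) ** J\<^sub>1 (f\<^sub>1 \<zeta>)) = 0"
          by (simp add: vector_matrix_mul_assoc[symmetric])
        then show ?thesis using J21[OF f1\<Omega>[OF \<zeta>]] by (simp add: f2)
      qed
      have "continuous_on (cball 0 1 - {0}) f\<^sub>1'" using lift1 by (simp add: is_lift_def)
      from punctured_disc_vanish[OF this zero] zero
      have "f\<^sub>1' \<zeta> = 0" if "\<zeta> \<in> cball 0 1 - {0}" for \<zeta>
        using that by (cases "norm \<zeta> = 1") auto
      then show False
        using sup by (auto simp: supporting_lift_def nonzero_lift_def)
    qed
    then have "stationary_disc M\<^sub>2 f\<^sub>2"
      using lift2 f2d f2M by (auto simp: stationary_disc_def nonzero_lift_def attached_disc_def)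
    moreover have "H \<zeta> = f\<^sub>1' \<zeta> v* matrix_inv (complex_jacobian F\<^sub>1 (f\<^sub>1 \<zeta>))" if "\<zeta> \<in> ball 0 1 - {0}" for \<zeta>
      using H(2)[OF that] by (simp add: g_def J\<^sub>1_def)
    ultimately show "stationary_disc M\<^sub>2 (F\<^sub>1 \<circ> f\<^sub>1)"
      and "\<exists>f\<^sub>2'. is_lift M\<^sub>2 (F\<^sub>1 \<circ> f\<^sub>1) f\<^sub>2' \<and>
        (\<forall>\<zeta>\<in>ball 0 1 - {0}. f\<^sub>2' \<zeta> = f\<^sub>1' \<zeta> v* matrix_inv (complex_jacobian F\<^sub>1 (f\<^sub>1 \<zeta>)))"
      using lift2 unfolding f\<^sub>2_def by blast+
  qed
qed

end
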